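(* The Szegő projection $S$, densely defined on $L^2(d_b(\mathbb H))\cap L^p(d_b(\mathbb H))$, extends to a bounded operator $S:L^p(d_b(\mathbb H))\to L^p(d_b(\mathbb H))$ for every $p\in(1,+\infty)$.
   Context: The Hartogs triangle is $\mathbb H=\{(z_1,z_2)\in\mathbb C^2:|z_1|<|z_2|<1\}$. Its distinguished boundary is $d_b(\mathbb H)=\partial\mathbb D\times\partial\mathbb D=\{(e^{i\theta},e^{i\gamma})\}$, the two-dimensional torus, with the measure $d\theta\,d\gamma$ (up to normalization). The boundary Hardy space is the closed subspace of $L^2(d_b(\mathbb H))$ $$H^2(d_b(\mathbb H))=\Big\{f(e^{i\theta},e^{i\gamma})=\sum_{j=0}^{+\infty}\sum_{k=-j-1}^{+\infty}a_{jk}e^{ij\theta}e^{ik\gamma}:\ \sum_{j,k}|a_{jk}|^2<+\infty\Big\}.$$ The Szegő projection $S:L^2(d_b(\mathbb H))\to H^2(d_b(\mathbb H))$ is the orthogonal projection, i.e. it maps $f=\sum_{j,k\in\mathbb Z}a_{jk}e^{ij\theta}e^{ik\gamma}$ to $Sf=\sum_{j=0}^{+\infty}\sum_{k=-j-1}^{+\infty}a_{jk}e^{ij\theta}e^{ik\gamma}$. *)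

theory Defs
  imports "HOL-Analysis.Analysis"
begin

section \<open>Lebesgue spaces\<close>

text \<open>
  The elements of \<open>L\<^sup>p(M)\<close> are represented by measurable functions; two functions that are equal
  almost everywhere stand for the same element. The definitions are meant for \<open>1 \<le> p < \<infinity>\<close>.
\<close>

definition Lp_space :: "'a measure \<Rightarrow> real \<Rightarrow> ('a \<Rightarrow> complex) set" where
  "Lp_space M p = {f \<in> borel_measurable M. integrable M (\<lambda>x. norm (f x) powr p)}"

definition Lp_norm :: "'a measure \<Rightarrow> real \<Rightarrow> ('a \<Rightarrow> complex) \<Rightarrow> real" where
  "Lp_norm M p f = (\<integral>x. norm (f x) powr p \<partial>M) powr (1 / p)"

definition Lp_dense :: "'a measure \<Rightarrow> real \<Rightarrow> ('a \<Rightarrow> complex) set \<Rightarrow> bool" where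
  "Lp_dense M p D \<longleftrightarrow> D \<subseteq> Lp_space M p \<and>
     (\<forall>f\<in>Lp_space M p. \<forall>\<epsilon>>0. \<exists>g\<in>D. Lp_norm M p (\<lambda>x. f x - g x) < \<epsilon>)"

text \<open>
  A bounded complex-linear operator on \<open>L\<^sup>p(M)\<close>, acting on representatives. The second conjunct
  says that it descends to classes modulo equality almost everywhere; linearity is likewise an
  identity between classes.
\<close>

definition bounded_Lp_operator ::
    "'a measure \<Rightarrow> real \<Rightarrow> (('a \<Rightarrow> complex) \<Rightarrow> ('a \<Rightarrow> complex)) \<Rightarrow> bool" where
  "bounded_Lp_operator M p T \<longleftrightarrow>
     (\<forall>f\<in>Lp_space M p. T f \<in> Lp_space M p) \<and>
     (\<forall>f\<in>Lp_space M p. \<forall>g\<in>Lp_space M p.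
        (AE x in M. f x = g x) \<longrightarrow> (AE x in M. T f x = T g x)) \<and>
     (\<forall>f\<in>Lp_space M p. \<forall>g\<in>Lp_space M p. AE x in M. T (\<lambda>y. f y + g y) x = T f x + T g x) \<and>
     (\<forall>c. \<forall>f\<in>Lp_space M p. AE x in M. T (\<lambda>y. c * f y) x = c * T f x) \<and>
     (\<exists>C. \<forall>f\<in>Lp_space M p. Lp_norm M p (T f) \<le> C * Lp_norm M p f)"


section \<open>The distinguished boundary of the Hartogs triangle\<close>

text \<open>
  For the Hartogs triangle \<open>{(z\<^sub>1, z\<^sub>2). norm z\<^sub>1 < norm z\<^sub>2 \<and> norm z\<^sub>2 < 1}\<close> the distinguished
  boundary is the two-dimensional torus.
\<close>

definition hartogs_db :: "(complex \<times> complex) set" where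
  "hartogs_db = sphere 0 1 \<times> sphere 0 1"

text \<open>The measure \<open>d\<theta> d\<gamma>\<close>, without normalization: the total mass is \<open>4 \<pi>\<^sup>2\<close>.\<close>

definition hartogs_db_measure :: "(complex \<times> complex) measure" where
  "hartogs_db_measure =
     distr (restrict_space lborel ({0..<2 * pi} \<times> {0..<2 * pi})) (restrict_space borel hartogs_db)
       (\<lambda>(\<theta>, \<gamma>). (cis \<theta>, cis \<gamma>))"

lemma space_hartogs_db_measure: "space hartogs_db_measure = hartogs_db"
  by (simp add: hartogs_db_measure_def space_restrict_space)

lemma sets_hartogs_db_measure: "sets hartogs_db_measure = sets (restrict_space borel hartogs_db)"
  by (simp add: hartogs_db_measure_def)

lemma measurable_cis_pair:
  "(\<lambda>(\<theta>, \<gamma>). (cis \<theta>, cis \<gamma>)) \<in>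
     restrict_space lborel ({0..<2 * pi} \<times> {0..<2 * pi}) \<rightarrow>\<^sub>M restrict_space borel hartogs_db"
proof (rule measurable_restrict_space2)
  have "continuous_on UNIV (\<lambda>(\<theta>, \<gamma>). (cis \<theta>, cis \<gamma>))"
    by (auto simp: case_prod_beta intro!: continuous_intros)
  then show "(\<lambda>(\<theta>, \<gamma>). (cis \<theta>, cis \<gamma>)) \<in>
      borel_measurable (restrict_space lborel ({0..<2 * pi} \<times> {0..<2 * pi}))"
    by (intro measurable_restrict_space1) (simp add: borel_measurable_continuous_onI)
qed (auto simp: hartogs_db_def)

lemma emeasure_hartogs_db: "emeasure hartogs_db_measure hartogs_db = ennreal (4 * pi\<^sup>2)"
proof -
  let ?Q = "{0..<2 * pi} \<times> {0..<2 * pi}"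
  have Q: "?Q \<in> sets borel"
    by (simp add: borel_prod[symmetric])
  have "emeasure hartogs_db_measure hartogs_db = emeasure (restrict_space lborel ?Q) ?Q"
    unfolding hartogs_db_measure_def
    by (subst emeasure_distr[OF measurable_cis_pair])
      (auto simp: space_restrict_space sets_restrict_space hartogs_db_def intro!: arg_cong2[where f = emeasure])
  also have "\<dots> = emeasure lborel ?Q"
    using Q by (simp add: emeasure_restrict_space)
  also have "\<dots> = emeasure lborel {0..<2 * pi} * emeasure lborel {0..<2 * pi}"
    by (subst lborel_prod[symmetric]) (simp add: lborel.emeasure_pair_measure_Times)
  also have "\<dots> = ennreal (4 * pi\<^sup>2)"
    by (simp add: ennreal_mult[symmetric] power2_eq_square)
  finally show ?thesis .
qed


section \<open>The Hardy space and the Szego projection\<close>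

text \<open>On the torus this is \<open>e\<^bsup>i j \<theta>\<^esup> e\<^bsup>i k \<gamma>\<^esup>\<close>.\<close>

definition torus_char :: "int \<Rightarrow> int \<Rightarrow> complex \<times> complex \<Rightarrow> complex" where
  "torus_char j k = (\<lambda>(z, w). z powi j * w powi k)"

text \<open>
  \<open>f = (\<Sum>(j,k)\<in>I. a j k * torus_char j k)\<close> with unconditional convergence in \<open>L\<^sup>2\<close>: the analogue of
  \<^const>\<open>has_sum\<close> for the \<open>L\<^sup>2\<close> norm on functions.
\<close>

definition has_L2_fourier_series ::
    "(complex \<times> complex \<Rightarrow> complex) \<Rightarrow> (int \<Rightarrow> int \<Rightarrow> complex) \<Rightarrow> (int \<times> int) set \<Rightarrow> bool" where
  "has_L2_fourier_series f a I \<longleftrightarrow>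
     ((\<lambda>F. Lp_norm hartogs_db_measure 2 (\<lambda>x. f x - (\<Sum>(j,k)\<in>F. a j k * torus_char j k x)))
        \<longlongrightarrow> 0) (finite_subsets_at_top I)"

definition hardy_index :: "(int \<times> int) set" where
  "hardy_index = {(j, k). 0 \<le> j \<and> - j - 1 \<le> k}"

definition hardy_space :: "(complex \<times> complex \<Rightarrow> complex) set" where
  "hardy_space = {f \<in> Lp_space hartogs_db_measure 2.
     \<exists>a. (\<lambda>(j, k). (norm (a j k))\<^sup>2) summable_on hardy_index \<and>
         has_L2_fourier_series f a hardy_index}"

text \<open>
  The orthogonal projection of \<open>L\<^sup>2\<close> onto the Hardy space. The projection of \<open>f\<close> is determined only
  up to equality almost everywhere; \<open>SOME\<close> picks a representative. The value is meaningful for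
  \<open>f\<close> in \<open>L\<^sup>2\<close> only.
\<close>

definition szego_projection ::
    "(complex \<times> complex \<Rightarrow> complex) \<Rightarrow> complex \<times> complex \<Rightarrow> complex" where
  "szego_projection f =
     (SOME g. g \<in> hardy_space \<and>
        (\<forall>h\<in>hardy_space. (\<integral>x. (f x - g x) * cnj (h x) \<partial>hartogs_db_measure) = 0))"

end

theory Submission
  imports Defs
begin

text \<open>
  The index set of the Hardy space is the intersection of the half-planes \<open>2 j + 1 > 0\<close> and
  \<open>2 j + 2 k + 3 > 0\<close>; the linear forms are odd, so no frequency lies on a boundary. Averaging over
  the rotations \<open>(e\<^bsup>2 i \<theta>\<^esup>, 1)\<close> and \<open>(e\<^bsup>2 i \<theta>\<^esup>, e\<^bsup>2 i \<theta>\<^esup>)\<close> reduces each half-plane projection to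
  the theorem of M. Riesz on the circle, for trigonometric polynomials without constant term. That
  theorem amounts to \<open>\<integral> norm H powr p \<le> C \<integral> \<bar>Re H\<bar> powr p\<close> for analytic \<open>H\<close> with mean \<open>0\<close>, which
  follows from the mean value inequality for a smooth subharmonic function that is at most
  \<open>C \<bar>Re z\<bar> powr p - c (norm z powr p)\<close> and vanishes at \<open>0\<close>, up to a regularization. The bound on
  trigonometric polynomials extends to \<open>L\<^sup>p\<close> by density, and the extension agrees with the
  orthogonal projection because the same approximating sequence converges in \<open>L\<^sup>2\<close> and in \<open>L\<^sup>p\<close>.
\<close>

section \<open>Subharmonic functions along exponential sums\<close>

text \<open>Mean 0 is the crux of the inequality on the circle: the constant \<i> has real part 0,
  so nothing is bounded by its real part. A linear form that vanishes at some frequency would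
  produce such constants along the orbits. Doubling the forms makes room for an odd constant term,
  and that term only multiplies the function on an orbit by a unimodular factor, invisible to norms.
  No single comparison function serves all exponents. For \<open>p \<le> 2\<close> the Laplacian of
  \<open>\<bar>Re z\<bar> powr p\<close>, a multiple of
  \<open>\<bar>Re z\<bar> powr (p - 2)\<close>, dominates that of \<open>norm z powr p\<close>
  because the exponent is nonpositive. For \<open>p > 2\<close> it vanishes on the imaginary axis;
  there \<open>(Re z)\<^sup>2 * norm z powr (p - 2)\<close> takes its place, and a pointwise
  splitting leads back to \<open>\<bar>Re z\<bar> powr p\<close>. Both ranges are thus treated
  directly, without duality. A positive \<open>e\<close> added to the bases keeps the negative
  powers in the derivatives away from base 0. The Szego projection is chosen by \<open>SOME\<close>
  and operators act on representatives, so identities are proved almost everywhere, through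
  uniqueness of limits.\<close>

lemma convex_ge_limit_at_bot:
  fixes g g' :: "real \<Rightarrow> real"
  assumes der: "\<And>t. (g has_real_derivative g' t) (at t)"
    and mono: "\<And>s t. s \<le> t \<Longrightarrow> g' s \<le> g' t"
    and lim: "(g \<longlongrightarrow> l) at_bot"
  shows "l \<le> g t"
proof -
  \<comment> \<open>A negative slope at \<open>t\<close> persists to the left, since
    \<open>g'\<close> is monotone, and would make \<open>g\<close> unbounded there. The threshold
    for \<open>s\<close> is taken so far left that the line of slope \<open>g' t\<close> through
    \<open>(t, g t)\<close> has passed \<open>l + 1\<close>.\<close>
  have nonneg: "0 \<le> g' t" for t
  proof (rule ccontr)
    assume neg: "\<not> 0 \<le> g' t"
    have "\<forall>\<^sub>F s in at_bot. g s < l + 1"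
      using lim by (rule order_tendstoD) simp
    moreover have "\<forall>\<^sub>F s in at_bot. s < t + (\<bar>l\<bar> + 1 + \<bar>g t\<bar>) / g' t \<and> s < t"
      by (intro eventually_conj eventually_gt_at_bot)
    ultimately have "\<forall>\<^sub>F s in at_bot. g s < l + 1 \<and> s < t + (\<bar>l\<bar> + 1 + \<bar>g t\<bar>) / g' t \<and> s < t"
      by (rule eventually_conj)
    then obtain s where s: "g s < l + 1" "s < t + (\<bar>l\<bar> + 1 + \<bar>g t\<bar>) / g' t" "s < t"
      by (auto dest: eventually_happens)
    obtain z where z: "s < z" "z < t" "g t - g s = (t - s) * g' z"
      using MVT2[OF \<open>s < t\<close>, of g g'] der by auto
    have "(t - s) * g' z \<le> (t - s) * g' t"
      using mono z by (intro mult_left_mono) auto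
    moreover have "(t - s) * g' t < - (\<bar>l\<bar> + 1 + \<bar>g t\<bar>)"
      using s neg by (simp add: field_simps)
    ultimately show False
      using z s by linarith
  qed
  have "\<forall>\<^sub>F s in at_bot. g s \<le> g t"
    using eventually_le_at_bot[of t]
  proof eventually_elim
    case (elim s)
    show ?case
      using DERIV_nonneg_imp_nondecreasing[OF elim, of g] der nonneg by blast
  qed
  then show ?thesis
    using tendsto_upperbound[OF lim] by simp
qed

lemma has_integral_deriv_periodic:
  fixes f f' :: "real \<Rightarrow> real"
  assumes "\<And>t. (f has_real_derivative f' t) (at t)" and "a \<le> b" and "f a = f b"
  shows "(f' has_integral 0) {a..b}"
  using fundamental_theorem_of_calculus[of a b f f'] assms
  by (auto simp: has_real_derivative_iff_has_vector_derivative intro: has_vector_derivative_at_within)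

text \<open>
  In the coordinates \<open>t + i \<theta>\<close> the function \<open>u = \<Phi> \<circ> h\<close> satisfies
  \<open>u\<^sub>t\<^sub>t + u\<^sub>\<theta>\<^sub>\<theta> = (\<Delta>\<Phi> \<circ> h) (norm h')\<^sup>2 \<ge> 0\<close>, and \<open>u\<^sub>\<theta>\<^sub>\<theta>\<close> integrates to \<open>0\<close> over a period. So the
  mean of \<open>u\<close> over \<open>\<theta>\<close> is a convex function of \<open>t\<close>.
\<close>

lemma subharmonic_C2_mean_ge:
  fixes \<Phi> \<Phi>x \<Phi>y \<Phi>xx \<Phi>xy \<Phi>yy :: "complex \<Rightarrow> real" and h h1 h2 :: "complex \<Rightarrow> complex"
  assumes D: "\<And>z. (\<Phi> has_derivative (\<lambda>v. \<Phi>x z * Re v + \<Phi>y z * Im v)) (at z)"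
    and Dx: "\<And>z. (\<Phi>x has_derivative (\<lambda>v. \<Phi>xx z * Re v + \<Phi>xy z * Im v)) (at z)"
    and Dy: "\<And>z. (\<Phi>y has_derivative (\<lambda>v. \<Phi>xy z * Re v + \<Phi>yy z * Im v)) (at z)"
    and cont: "continuous_on UNIV \<Phi>xx" "continuous_on UNIV \<Phi>xy" "continuous_on UNIV \<Phi>yy"
    and lap: "\<And>z. 0 \<le> \<Phi>xx z + \<Phi>yy z"
    and h: "\<And>z. (h has_field_derivative h1 z) (at z)"
    and h1: "\<And>z. (h1 has_field_derivative h2 z) (at z)"
    and h2: "continuous_on UNIV h2"
    and period: "\<And>z. h (z + 2 * pi * \<i>) = h z" "\<And>z. h1 (z + 2 * pi * \<i>) = h1 z"
    and lim: "filterlim h (nhds 0) (filtercomap Re at_bot)"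
  shows "2 * pi * \<Phi> 0 \<le> integral {0..2*pi} (\<lambda>\<theta>. \<Phi> (h (\<i> * of_real \<theta>)))"
proof -
  define u where "u t \<theta> = \<Phi> (h (Complex t \<theta>))" for t \<theta>
  \<comment> \<open>\<open>ut\<close>, \<open>utt\<close> and \<open>us\<close>, \<open>uss\<close>
    are the derivatives of \<open>u\<close> in t and in \<theta>. Moving in \<theta> multiplies
    \<open>h1\<close> by \<i>, so the pair of its real and imaginary parts becomes
    \<open>(- Im, Re)\<close>.\<close>
  define ut where "ut t \<theta> = (let z = Complex t \<theta> in \<Phi>x (h z) * Re (h1 z) + \<Phi>y (h z) * Im (h1 z))" for t \<theta>
  define utt where "utt t \<theta> = (let z = Complex t \<theta> in
     (\<Phi>xx (h z) * Re (h1 z) + \<Phi>xy (h z) * Im (h1 z)) * Re (h1 z) + \<Phi>x (h z) * Re (h2 z) +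
     ((\<Phi>xy (h z) * Re (h1 z) + \<Phi>yy (h z) * Im (h1 z)) * Im (h1 z) + \<Phi>y (h z) * Im (h2 z)))" for t \<theta>
  define us where "us t \<theta> = (let z = Complex t \<theta> in - \<Phi>x (h z) * Im (h1 z) + \<Phi>y (h z) * Re (h1 z))" for t \<theta>
  define uss where "uss t \<theta> = (let z = Complex t \<theta> in
     (\<Phi>xx (h z) * Im (h1 z) - \<Phi>xy (h z) * Re (h1 z)) * Im (h1 z) - \<Phi>x (h z) * Re (h2 z) +
     ((\<Phi>yy (h z) * Re (h1 z) - \<Phi>xy (h z) * Im (h1 z)) * Re (h1 z) - \<Phi>y (h z) * Im (h2 z)))" for t \<theta>
  have vt: "((\<lambda>t. k (Complex t \<theta>)) has_derivative (\<lambda>x. k' (Complex t \<theta>) * of_real x)) (at t)"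
    if "\<And>z. (k has_field_derivative k' z) (at z)" for k k' :: "complex \<Rightarrow> complex" and t \<theta>
  proof -
    have "((\<lambda>t. Complex t \<theta>) has_derivative of_real) (at t)"
      unfolding Complex_eq by (auto intro!: derivative_eq_intros)
    from has_derivative_compose[OF this that[unfolded has_field_derivative_def]] show ?thesis
      by simp
  qed
  have vs: "((\<lambda>\<theta>. k (Complex t \<theta>)) has_derivative (\<lambda>x. k' (Complex t \<theta>) * (\<i> * of_real x))) (at \<theta>)"
    if "\<And>z. (k has_field_derivative k' z) (at z)" for k k' :: "complex \<Rightarrow> complex" and t \<theta>
  proof -
    have "((\<lambda>\<theta>. Complex t \<theta>) has_derivative (\<lambda>x. \<i> * of_real x)) (at \<theta>)"
      unfolding Complex_eq by (auto intro!: derivative_eq_intros)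
    from has_derivative_compose[OF this that[unfolded has_field_derivative_def]] show ?thesis
      by simp
  qed
  note dt = has_derivative_compose[OF vt[OF h] D] has_derivative_compose[OF vt[OF h] Dx]
    has_derivative_compose[OF vt[OF h] Dy]
  note ds = has_derivative_compose[OF vs[OF h] D] has_derivative_compose[OF vs[OF h] Dx]
    has_derivative_compose[OF vs[OF h] Dy]
  have Dut: "((\<lambda>t. u t \<theta>) has_real_derivative ut t \<theta>) (at t)" for t \<theta>
    unfolding u_def ut_def Let_def has_field_derivative_def
    by (rule has_derivative_eq_rhs[OF dt(1)]) (auto simp: algebra_simps)
  have Dutt: "((\<lambda>t. ut t \<theta>) has_real_derivative utt t \<theta>) (at t)" for t \<theta>
    unfolding ut_def utt_def Let_def has_field_derivative_def
    by (rule has_derivative_eq_rhs, rule has_derivative_add,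
        rule has_derivative_mult[OF dt(2) has_derivative_Re[OF vt[OF h1]]],
        rule has_derivative_mult[OF dt(3) has_derivative_Im[OF vt[OF h1]]])
      (auto simp: algebra_simps)
  have Dus: "((\<lambda>\<theta>. u t \<theta>) has_real_derivative us t \<theta>) (at \<theta>)" for t \<theta>
    unfolding u_def us_def Let_def has_field_derivative_def
    by (rule has_derivative_eq_rhs[OF ds(1)]) (auto simp: algebra_simps)
  have Duss: "((\<lambda>\<theta>. us t \<theta>) has_real_derivative uss t \<theta>) (at \<theta>)" for t \<theta>
    unfolding us_def uss_def Let_def has_field_derivative_def
    by (rule has_derivative_eq_rhs, rule has_derivative_add,
        rule has_derivative_mult[OF has_derivative_minus[OF ds(2)] has_derivative_Im[OF vs[OF h1]]],
        rule has_derivative_mult[OF ds(3) has_derivative_Re[OF vs[OF h1]]])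
      (auto simp: algebra_simps)
  have contC: "continuous_on UNIV (\<lambda>x. Complex (fst x) (snd x))"
    unfolding Complex_eq by (intro continuous_intros)
  have ch: "continuous_on UNIV h" "continuous_on UNIV h1"
    using h h1 by (auto intro: DERIV_continuous_on)
  have cP: "continuous_on UNIV \<Phi>" "continuous_on UNIV \<Phi>x" "continuous_on UNIV \<Phi>y"
    using D Dx Dy by (auto intro!: has_derivative_continuous_on)
  note cc1 = ch[THEN continuous_on_compose2[OF _ contC]] h2[THEN continuous_on_compose2[OF _ contC]]
  note cc2 = cont[THEN continuous_on_compose2[OF _ cc1(1)]] cP[THEN continuous_on_compose2[OF _ cc1(1)]]
  have cu: "continuous_on UNIV (\<lambda>(t, \<theta>). u t \<theta>)" "continuous_on UNIV (\<lambda>(t, \<theta>). ut t \<theta>)"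
    "continuous_on UNIV (\<lambda>(t, \<theta>). utt t \<theta>)" "continuous_on UNIV (\<lambda>(t, \<theta>). uss t \<theta>)"
    unfolding u_def ut_def utt_def uss_def Let_def case_prod_beta
    by (intro continuous_intros cc1 cc2 subset_UNIV)+
  have cu1: "continuous_on S (\<lambda>\<theta>. w t \<theta>)" if "continuous_on UNIV (\<lambda>(t, \<theta>). w t \<theta>)" for w :: "real \<Rightarrow> real \<Rightarrow> real" and S t
    using continuous_on_compose2[OF that continuous_on_Pair[OF continuous_on_const continuous_on_id], of t S]
    by simp
  have int: "w t integrable_on {a..b}" if "continuous_on UNIV (\<lambda>(t, \<theta>). w t \<theta>)" for w :: "real \<Rightarrow> real \<Rightarrow> real" and t a b
    by (intro integrable_continuous_interval cu1 that)
  define I where "I t = integral {0..2*pi} (u t)" for t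
  define I1 where "I1 t = integral {0..2*pi} (ut t)" for t
  define I2 where "I2 t = integral {0..2*pi} (utt t)" for t
  have DI: "(I has_real_derivative I1 t) (at t)" for t
    unfolding I_def I1_def interval_cbox
    by (rule leibniz_rule_field_derivative)
      (auto intro: Dut int cu[THEN continuous_on_subset] simp flip: interval_cbox)
  have DI1: "(I1 has_real_derivative I2 t) (at t)" for t
    unfolding I2_def I1_def interval_cbox
    by (rule leibniz_rule_field_derivative)
      (auto intro: Dutt int cu[THEN continuous_on_subset] simp flip: interval_cbox)
  have I2_nonneg: "0 \<le> I2 t" for t
  proof -
    have "Complex t (2 * pi) = Complex t 0 + 2 * pi * \<i>"
      by (simp add: complex_eq_iff)
    then have "us t 0 = us t (2 * pi)"
      using period[of "Complex t 0"] by (simp add: us_def Let_def)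
    then have 0: "(uss t has_integral 0) {0..2*pi}"
      by (intro has_integral_deriv_periodic[of "us t"] Duss) auto
    have "utt t \<theta> + uss t \<theta> = (\<Phi>xx (h (Complex t \<theta>)) + \<Phi>yy (h (Complex t \<theta>))) * (norm (h1 (Complex t \<theta>)))\<^sup>2" for \<theta>
      unfolding utt_def uss_def Let_def cmod_power2 by algebra
    then have "0 \<le> integral {0..2*pi} (\<lambda>\<theta>. utt t \<theta> + uss t \<theta>)"
      using lap by (intro integral_nonneg integrable_add int cu) auto
    also have "\<dots> = I2 t + integral {0..2*pi} (uss t)"
      unfolding I2_def by (intro integral_add int cu)
    finally show ?thesis
      using 0 by (simp add: integral_unique)
  qed
  \<comment> \<open>The filter \<open>filtercomap Re at_bot\<close> makes the convergence of
    \<open>h\<close> to 0 uniform in the imaginary part, so \<open>u t\<close> is close to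
    \<open>\<Phi> 0\<close> on the whole period at once. The bound \<open>e / (4 * pi)\<close>
    integrates to \<open>e / 2\<close>.\<close>
  have lim_I: "(I \<longlongrightarrow> 2 * pi * \<Phi> 0) at_bot"
  proof (rule tendstoI)
    fix e :: real
    assume "0 < e"
    have "isCont \<Phi> 0"
      using cP(1) by (simp add: continuous_on_eq_continuous_at)
    then have "\<forall>\<^sub>F z in filtercomap Re at_bot. dist (\<Phi> (h z)) (\<Phi> 0) < e / (4 * pi)"
      using lim \<open>0 < e\<close> by (intro tendstoD[OF isCont_tendsto_compose[of 0 \<Phi>]]) auto
    then obtain Q where Q: "eventually Q at_bot" "\<And>z. Q (Re z) \<Longrightarrow> dist (\<Phi> (h z)) (\<Phi> 0) < e / (4 * pi)"
      by (auto simp: eventually_filtercomap)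
    show "\<forall>\<^sub>F t in at_bot. dist (I t) (2 * pi * \<Phi> 0) < e"
      using Q(1)
    proof eventually_elim
      case (elim t)
      have "I t - 2 * pi * \<Phi> 0 = integral {0..2*pi} (\<lambda>\<theta>. u t \<theta> - \<Phi> 0)"
        unfolding I_def by (subst integral_diff) (auto intro: int cu)
      also have "norm \<dots> \<le> integral {0..2*pi} (\<lambda>\<theta>. e / (4 * pi))"
        using Q(2)[of "Complex t _"] elim
        by (intro integral_norm_bound_integral integrable_diff int cu)
          (auto simp: u_def dist_norm intro!: less_imp_le)
      also have "\<dots> < e"
        using \<open>0 < e\<close> by simp
      finally show ?case
        by (simp add: dist_norm)
    qed
  qed
  have "2 * pi * \<Phi> 0 \<le> I 0"
  proof (rule convex_ge_limit_at_bot[OF DI _ lim_I])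
    show "I1 s \<le> I1 t" if "s \<le> t" for s t
      using DERIV_nonneg_imp_nondecreasing[OF that, of I1] DI1 I2_nonneg by blast
  qed
  moreover have "u 0 = (\<lambda>\<theta>. \<Phi> (h (\<i> * of_real \<theta>)))"
    by (simp add: u_def Complex_eq fun_eq_iff)
  ultimately show ?thesis
    by (simp add: I_def)
qed

text \<open>The derivatives enter as witnesses, with one function \<open>\<Phi>xy\<close> for both
  mixed derivatives, so that an instance is established by exhibiting five closed formulas.\<close>

definition subharmonic_C2 :: "(complex \<Rightarrow> real) \<Rightarrow> bool" where
  "subharmonic_C2 \<Phi> \<longleftrightarrow> (\<exists>\<Phi>x \<Phi>y \<Phi>xx \<Phi>xy \<Phi>yy.
     (\<forall>z. (\<Phi> has_derivative (\<lambda>v. \<Phi>x z * Re v + \<Phi>y z * Im v)) (at z)) \<and>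
     (\<forall>z. (\<Phi>x has_derivative (\<lambda>v. \<Phi>xx z * Re v + \<Phi>xy z * Im v)) (at z)) \<and>
     (\<forall>z. (\<Phi>y has_derivative (\<lambda>v. \<Phi>xy z * Re v + \<Phi>yy z * Im v)) (at z)) \<and>
     continuous_on UNIV \<Phi>xx \<and> continuous_on UNIV \<Phi>xy \<and> continuous_on UNIV \<Phi>yy \<and>
     (\<forall>z. 0 \<le> \<Phi>xx z + \<Phi>yy z))"

text \<open>A polynomial in \<open>exp z\<close>, written in the logarithmic coordinate
  \<open>z\<close>. The exponents come from a function \<open>m\<close> that may repeat values,
  because distinct frequencies on the torus can coincide along an orbit.\<close>

definition exp_sum :: "'a set \<Rightarrow> ('a \<Rightarrow> complex) \<Rightarrow> ('a \<Rightarrow> nat) \<Rightarrow> complex \<Rightarrow> complex" where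
  "exp_sum F c m z = (\<Sum>s\<in>F. c s * exp (of_nat (m s) * z))"

lemma exp_sum_has_field_derivative:
  "(exp_sum F c m has_field_derivative exp_sum F (\<lambda>s. of_nat (m s) * c s) m z) (at z)"
  unfolding exp_sum_def
  by (rule DERIV_cong, (rule derivative_intros)+) (auto intro!: sum.cong)

lemma continuous_on_exp_sum: "continuous_on S (exp_sum F c m)"
  unfolding exp_sum_def by (intro continuous_intros)

lemma exp_sum_periodic: "exp_sum F c m (z + 2 * pi * \<i>) = exp_sum F c m z"
  unfolding exp_sum_def
proof (intro sum.cong refl arg_cong2[where f = "(*)"])
  fix s
  have "exp (of_nat (m s) * (z + 2 * pi * \<i>)) = exp (of_nat (m s) * z + (2 * of_int (int (m s)) * pi) * \<i>)"
    by (simp add: algebra_simps)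
  also have "\<dots> = exp (of_nat (m s) * z)"
    by (subst exp_eq) (auto intro!: exI[of _ "int (m s)"])
  finally show "exp (of_nat (m s) * (z + 2 * pi * \<i>)) = exp (of_nat (m s) * z)" .
qed

text \<open>Each term has modulus \<open>norm (c s) * exp (m s * Re z)\<close>, which depends on
  \<open>Re z\<close> alone. In the variable \<open>exp z\<close> this is the vanishing of the
  polynomial at the origin.\<close>

lemma exp_sum_tendsto_0:
  assumes "\<And>s. s \<in> F \<Longrightarrow> 0 < m s"
  shows "(exp_sum F c m \<longlongrightarrow> 0) (filtercomap Re at_bot)"
  unfolding exp_sum_def
proof (intro tendsto_null_sum tendsto_mult_right_zero)
  fix s assume "s \<in> F"
  have "filterlim (\<lambda>x. real (m s) * x) at_bot at_bot"
    using assms[OF \<open>s \<in> F\<close>] by (intro filterlim_tendsto_pos_mult_at_bot[OF tendsto_const]) (auto intro: filterlim_ident)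
  then have "((\<lambda>x. exp (real (m s) * x)) \<longlongrightarrow> 0) at_bot"
    by (rule filterlim_compose[OF exp_at_bot])
  then have "((\<lambda>z. norm (exp (of_nat (m s) * z))) \<longlongrightarrow> 0) (filtercomap Re at_bot)"
    using filterlim_compose[OF _ filterlim_filtercomap[of Re]] by (simp add: norm_exp_eq_Re)
  then show "((\<lambda>z. exp (of_nat (m s) * z)) \<longlongrightarrow> 0) (filtercomap Re at_bot)"
    by (rule tendsto_norm_zero_cancel)
qed

text \<open>The sub-mean value property of \<Phi> composed with a polynomial in
  \<open>exp z\<close>, over the unit circle; the value at the centre is \<open>\<Phi> 0\<close>
  because all exponents are positive.\<close>

lemma subharmonic_exp_sum_mean_ge:
  assumes "subharmonic_C2 \<Phi>" and "\<And>s. s \<in> F \<Longrightarrow> 0 < m s"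
  shows "2 * pi * \<Phi> 0 \<le> integral {0..2*pi} (\<lambda>\<theta>. \<Phi> (exp_sum F c m (\<i> * of_real \<theta>)))"
proof -
  from assms(1) obtain \<Phi>x \<Phi>y \<Phi>xx \<Phi>xy \<Phi>yy where
    "\<And>z. (\<Phi> has_derivative (\<lambda>v. \<Phi>x z * Re v + \<Phi>y z * Im v)) (at z)"
    "\<And>z. (\<Phi>x has_derivative (\<lambda>v. \<Phi>xx z * Re v + \<Phi>xy z * Im v)) (at z)"
    "\<And>z. (\<Phi>y has_derivative (\<lambda>v. \<Phi>xy z * Re v + \<Phi>yy z * Im v)) (at z)"
    "continuous_on UNIV \<Phi>xx" "continuous_on UNIV \<Phi>xy" "continuous_on UNIV \<Phi>yy"
    "\<And>z. 0 \<le> \<Phi>xx z + \<Phi>yy z"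
    unfolding subharmonic_C2_def by blast
  from subharmonic_C2_mean_ge[OF this exp_sum_has_field_derivative exp_sum_has_field_derivative
      continuous_on_exp_sum exp_sum_periodic exp_sum_periodic exp_sum_tendsto_0[OF assms(2)]]
  show ?thesis .
qed

section \<open>Regularized comparison functions and their Laplacians\<close>

context
  fixes e :: real
  assumes e: "0 < e"
begin

lemma normsq_add_pos: "0 < (Re z)\<^sup>2 + (Im z)\<^sup>2 + e"
  using e by (simp add: add_nonneg_pos)

lemma Resq_add_pos: "0 < (Re z)\<^sup>2 + e"
  using e by (simp add: add_nonneg_pos)

lemma has_derivative_powr_normsq:
  "((\<lambda>z. ((Re z)\<^sup>2 + (Im z)\<^sup>2 + e) powr k) has_derivative
     (\<lambda>v. k * ((Re z)\<^sup>2 + (Im z)\<^sup>2 + e) powr (k - 1) * (2 * Re z * Re v + 2 * Im z * Im v))) (at z)"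
  using normsq_add_pos[of z]
  by (auto intro!: derivative_eq_intros simp: powr_diff fun_eq_iff field_simps)

lemma has_derivative_powr_Resq:
  "((\<lambda>z. ((Re z)\<^sup>2 + e) powr k) has_derivative
     (\<lambda>v. k * ((Re z)\<^sup>2 + e) powr (k - 1) * (2 * Re z * Re v))) (at z)"
  using Resq_add_pos[of z]
  by (auto intro!: derivative_eq_intros simp: powr_diff fun_eq_iff field_simps)

lemma continuous_on_powr_normsq: "continuous_on S (\<lambda>z. ((Re z)\<^sup>2 + (Im z)\<^sup>2 + e) powr k)"
  using normsq_add_pos by (intro continuous_intros) (metis less_irrefl)

lemma continuous_on_powr_Resq: "continuous_on S (\<lambda>z. ((Re z)\<^sup>2 + e) powr k)"
  using Resq_add_pos by (intro continuous_intros) (metis less_irrefl)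

text \<open>Here \<open>b\<close> stands for \<open>p / 2\<close>. With x = \<open>Re z\<close>, the
  Laplacian of \<open>(x\<^sup>2 + e) powr b\<close> is at least
  \<open>2 * b * (2 * b - 1) * (x\<^sup>2 + e) powr (b - 1)\<close>, and that of the other power is
  at most \<open>4 * b\<close> times its base to the power \<open>b - 1\<close>. Since
  \<open>b - 1 \<le> 0\<close>, the smaller base has the larger power, and the ratio of the
  constants is \<open>2 / (2 * b - 1)\<close>.\<close>

lemma subharmonic_C2_powr_le_2:
  assumes b: "1 / 2 < b" "b \<le> 1"
  shows "subharmonic_C2 (\<lambda>z. 2 / (2 * b - 1) * ((Re z)\<^sup>2 + e) powr b - ((Re z)\<^sup>2 + (Im z)\<^sup>2 + e) powr b)"
proof -
  define A where "A = 2 / (2 * b - 1)"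
  define X where "X k z = ((Re z)\<^sup>2 + e) powr k" for k z
  define s where "s k z = ((Re z)\<^sup>2 + (Im z)\<^sup>2 + e) powr k" for k z
  have DX: "(X k has_derivative (\<lambda>v. k * X (k - 1) z * (2 * Re z * Re v))) (at z)" for k z
    unfolding X_def by (rule has_derivative_powr_Resq)
  have Ds: "(s k has_derivative (\<lambda>v. k * s (k - 1) z * (2 * Re z * Re v + 2 * Im z * Im v))) (at z)" for k z
    unfolding s_def by (rule has_derivative_powr_normsq)
  have Cs: "continuous_on S (X k)" "continuous_on S (s k)" for S k
    unfolding X_def s_def by (rule continuous_on_powr_Resq continuous_on_powr_normsq)+
  have lap: "0 \<le> 2 * b * (A * X (b - 1) z - s (b - 1) z) + 4 * b * (b - 1) * (Re z)\<^sup>2 * (A * X (b - 2) z - s (b - 2) z)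
     + (- 2 * b * s (b - 1) z - 4 * b * (b - 1) * (Im z)\<^sup>2 * s (b - 2) z)" for z
  proof -
    have X1: "X (b - 1) z = X (b - 2) z * ((Re z)\<^sup>2 + e)"
      using Resq_add_pos[of z] powr_add[of "(Re z)\<^sup>2 + e" "b - 2" 1] by (simp add: X_def)
    have "0 \<le> X (b - 2) z" "0 \<le> s (b - 2) z"
      by (simp_all add: X_def s_def)
    have "s (b - 1) z \<le> X (b - 1) z"
      unfolding X_def s_def using b Resq_add_pos[of z] by (intro powr_mono2') auto
    then have "4 * b * s (b - 1) z \<le> 2 * b * (2 * X (b - 1) z)"
      using b by simp
    also have "2 * X (b - 1) z = A * (X (b - 2) z * ((2 * b - 1) * ((Re z)\<^sup>2 + e)))"
      using b by (simp add: A_def X1 field_simps)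
    also have "\<dots> \<le> A * (X (b - 2) z * ((2 * b - 1) * (Re z)\<^sup>2 + e))"
      using b e \<open>0 \<le> X (b - 2) z\<close> mult_right_mono[of "2 * b - 1" 1 e]
      by (intro mult_left_mono) (auto simp: A_def algebra_simps)
    finally have 1: "4 * b * s (b - 1) z \<le> 2 * b * (A * (X (b - 2) z * ((2 * b - 1) * (Re z)\<^sup>2 + e)))"
      using b by (simp add: mult_left_mono)
    \<comment> \<open>For \<open>b \<le> 1\<close> the second-order part of the Laplacian of the
      subtracted power is nonpositive, so subtracting it helps.\<close>
    have 2: "0 \<le> 4 * b * (1 - b) * ((Re z)\<^sup>2 + (Im z)\<^sup>2) * s (b - 2) z"
      using b \<open>0 \<le> s (b - 2) z\<close> by simp
    show ?thesis
      using 1 2 unfolding X1 by (simp add: algebra_simps)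
  qed
  show ?thesis
    unfolding subharmonic_C2_def A_def[symmetric] X_def[symmetric] s_def[symmetric]
    apply (rule exI[of _ "\<lambda>z. 2 * b * Re z * (A * X (b - 1) z - s (b - 1) z)"])
    apply (rule exI[of _ "\<lambda>z. - 2 * b * Im z * s (b - 1) z"])
    apply (rule exI[of _ "\<lambda>z. 2 * b * (A * X (b - 1) z - s (b - 1) z) + 4 * b * (b - 1) * (Re z)\<^sup>2 * (A * X (b - 2) z - s (b - 2) z)"])
    apply (rule exI[of _ "\<lambda>z. - 4 * b * (b - 1) * Re z * Im z * s (b - 2) z"])
    apply (rule exI[of _ "\<lambda>z. - 2 * b * s (b - 1) z - 4 * b * (b - 1) * (Im z)\<^sup>2 * s (b - 2) z"])
    apply (intro conjI allI lap)
         apply (rule has_derivative_eq_rhs, (rule derivative_intros DX Ds)+)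
         apply (simp add: algebra_simps fun_eq_iff)
        apply (rule has_derivative_eq_rhs, (rule derivative_intros DX Ds)+)
        apply (simp add: algebra_simps fun_eq_iff power2_eq_square)
       apply (rule has_derivative_eq_rhs, (rule derivative_intros DX Ds)+)
       apply (simp add: algebra_simps fun_eq_iff power2_eq_square)
      apply (intro continuous_intros Cs)+
    done
qed

text \<open>Here \<open>a\<close> stands for \<open>p / 2 - 1\<close>. Let s be the common base. The
  term with both derivatives on \<open>(Re z)\<^sup>2\<close> contributes
  \<open>2 * C * s powr a\<close>, and the Laplacian of \<open>s powr (a + 1)\<close> is
  \<open>4 * (a + 1)\<^sup>2 * s powr a\<close> up to a term in \<open>e\<close> of favourable sign.
  The constant \<open>C = 2 * (a + 1)\<^sup>2\<close> makes these cancel exactly.\<close>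

lemma subharmonic_C2_powr_ge_2:
  assumes a: "0 \<le> a"
  shows "subharmonic_C2 (\<lambda>z. 2 * (a + 1)\<^sup>2 * ((Re z)\<^sup>2 * ((Re z)\<^sup>2 + (Im z)\<^sup>2 + e) powr a)
           - ((Re z)\<^sup>2 + (Im z)\<^sup>2 + e) powr (a + 1))"
proof -
  define C where "C = 2 * (a + 1)\<^sup>2"
  define s where "s k z = ((Re z)\<^sup>2 + (Im z)\<^sup>2 + e) powr k" for k z
  have Ds: "(s k has_derivative (\<lambda>v. k * s (k - 1) z * (2 * Re z * Re v + 2 * Im z * Im v))) (at z)" for k z
    unfolding s_def by (rule has_derivative_powr_normsq)
  have Cs: "continuous_on S (s k)" for S k
    unfolding s_def by (rule continuous_on_powr_normsq)
  define Pxx where "Pxx z = 2 * C * s a z + 10 * a * C * (Re z)\<^sup>2 * s (a - 1) z + 4 * a * (a - 1) * C * (Re z)^4 * s (a - 2) z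
     - 2 * (a + 1) * s a z - 4 * a * (a + 1) * (Re z)\<^sup>2 * s (a - 1) z" for z
  define Pyy where "Pyy z = 2 * a * C * (Re z)\<^sup>2 * s (a - 1) z + 4 * a * (a - 1) * C * (Re z)\<^sup>2 * (Im z)\<^sup>2 * s (a - 2) z
     - 2 * (a + 1) * s a z - 4 * a * (a + 1) * (Im z)\<^sup>2 * s (a - 1) z" for z
  have lap: "0 \<le> Pxx z + Pyy z" for z
  proof -
    let ?r = "(Re z)\<^sup>2 + (Im z)\<^sup>2"
    have s1: "s a z = s (a - 1) z * (?r + e)" "s (a - 1) z = s (a - 2) z * (?r + e)"
      using normsq_add_pos[of z] powr_add[of "?r + e" "a - 1" 1] powr_add[of "?r + e" "a - 2" 1] by (simp_all add: s_def)
    have s0: "0 \<le> s (a - 2) z" "0 \<le> s (a - 1) z"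
      by (simp_all add: s_def)
    \<comment> \<open>The coefficient \<open>a - 1\<close> may be negative, but it is at least -1
      and \<open>3 * (?r + e)\<close> outweighs \<open>?r\<close>.\<close>
    have "0 \<le> 3 * (?r + e) + (a - 1) * ?r"
      using a e by (simp add: algebra_simps add_nonneg_nonneg)
    then have 1: "0 \<le> 4 * a * C * (Re z)\<^sup>2 * s (a - 2) z * (3 * (?r + e) + (a - 1) * ?r)"
      using a s0 by (simp add: C_def)
    have 2: "0 \<le> 4 * (a + 1) * a * e * s (a - 1) z"
      using a e s0 by simp
    have "Pxx z + Pyy z = 4 * a * C * (Re z)\<^sup>2 * s (a - 2) z * (3 * (?r + e) + (a - 1) * ?r) + 4 * (a + 1) * a * e * s (a - 1) z"
      unfolding Pxx_def Pyy_def s1 C_def by (simp add: algebra_simps power2_eq_square power4_eq_xxxx)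
    then show ?thesis
      using 1 2 by simp
  qed
  show ?thesis
    unfolding subharmonic_C2_def C_def[symmetric] s_def[symmetric]
    apply (rule exI[of _ "\<lambda>z. 2 * C * Re z * s a z + 2 * a * C * (Re z)^3 * s (a - 1) z - 2 * (a + 1) * Re z * s a z"])
    apply (rule exI[of _ "\<lambda>z. 2 * a * C * (Re z)\<^sup>2 * Im z * s (a - 1) z - 2 * (a + 1) * Im z * s a z"])
    apply (rule exI[of _ Pxx])
    apply (rule exI[of _ "\<lambda>z. 4 * a * C * Re z * Im z * s (a - 1) z + 4 * a * (a - 1) * C * (Re z)^3 * Im z * s (a - 2) z
        - 4 * a * (a + 1) * Re z * Im z * s (a - 1) z"])
    apply (rule exI[of _ Pyy])
    apply (intro conjI allI lap)
         apply (rule has_derivative_eq_rhs, (rule derivative_intros Ds)+)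
         apply (simp add: algebra_simps fun_eq_iff power2_eq_square power3_eq_cube)
        apply (rule has_derivative_eq_rhs, (rule derivative_intros Ds)+)
        apply (simp add: algebra_simps fun_eq_iff power2_eq_square power3_eq_cube power4_eq_xxxx Pxx_def)
       apply (rule has_derivative_eq_rhs, (rule derivative_intros Ds)+)
       apply (simp add: algebra_simps fun_eq_iff power2_eq_square power3_eq_cube Pyy_def)
      apply (unfold Pxx_def Pyy_def)
      apply (intro continuous_intros Cs)+
    done
qed

end

section \<open>Riesz's inequality on the circle\<close>

text \<open>Removes the regularization: the values of the comparison functions at 0 leave error
  terms of order \<open>e powr (p / 2)\<close>.\<close>

lemma le_of_le_add_powr:
  fixes x y :: real
  assumes "0 < b" and "\<And>e. 0 < e \<Longrightarrow> x \<le> y + K * e powr b"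
  shows "x \<le> y"
proof (rule tendsto_lowerbound)
  have "((\<lambda>e. y + K * e powr b) \<longlongrightarrow> y + K * 0 powr b) (at_right 0)"
    using assms(1) eventually_at_right_less[of 0]
    by (intro tendsto_intros tendsto_powr') (auto elim: eventually_mono)
  then show "((\<lambda>e. y + K * e powr b) \<longlongrightarrow> y) (at_right 0)"
    using assms(1) by simp
  show "\<forall>\<^sub>F e in at_right 0. x \<le> y + K * e powr b"
    using eventually_at_right_less[of 0] by eventually_elim (rule assms(2))
qed simp

lemma continuous_on_norm_powr:
  fixes f :: "'a::topological_space \<Rightarrow> 'b::real_normed_vector"
  assumes "continuous_on S f" and "0 < p"
  shows "continuous_on S (\<lambda>x. norm (f x) powr p)"
  using assms by (intro continuous_on_powr' continuous_intros) auto

lemma powr_half_normsq: "((Re z)\<^sup>2 + (Im z)\<^sup>2) powr (p / 2) = norm z powr p"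
proof -
  have "((norm z) powr 2) powr (p / 2) = norm z powr p"
    by (subst powr_powr) simp
  then show ?thesis
    by (simp flip: cmod_power2)
qed

lemma powr_half_sq: "(x\<^sup>2) powr (p / 2) = \<bar>x\<bar> powr p" for x :: real
  using powr_half_normsq[of "of_real x" p] by simp

text \<open>Equivalent in content to boundedness of the conjugate function: the real part controls
  an analytic function with mean 0. Integrating a comparison function along the sum and using the
  mean value inequality gives the bound, with a constant that depends on \<open>p\<close>
  only.\<close>

lemma exp_sum_powr_le:
  assumes p: "1 < p"
  obtains C where "0 \<le> C" and "\<And>F c m. (\<And>s. s \<in> F \<Longrightarrow> 0 < m s) \<Longrightarrow>
    integral {0..2*pi} (\<lambda>\<theta>. norm (exp_sum F c m (\<i> * of_real \<theta>)) powr p)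
      \<le> C * integral {0..2*pi} (\<lambda>\<theta>. \<bar>Re (exp_sum F c m (\<i> * of_real \<theta>))\<bar> powr p)"
proof (cases "p \<le> 2")
  case True
  define A where "A = 2 / (p - 1)"
  have A: "2 \<le> A"
    using p True by (simp add: A_def field_simps)
  show ?thesis
  proof
    show "0 \<le> 2 * A"
      using A by simp
    fix F :: "'a set" and c and m :: "'a \<Rightarrow> nat"
    assume m: "\<And>s. s \<in> F \<Longrightarrow> 0 < m s"
    define H where "H = (\<lambda>\<theta>. exp_sum F c m (\<i> * of_real \<theta>))"
    have cH: "continuous_on S H" for S
      unfolding H_def by (intro continuous_on_compose2[OF continuous_on_exp_sum[of UNIV]] continuous_intros) auto
    show "integral {0..2*pi} (\<lambda>\<theta>. norm (H \<theta>) powr p)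
      \<le> 2 * A * integral {0..2*pi} (\<lambda>\<theta>. \<bar>Re (H \<theta>)\<bar> powr p)"
    proof (rule le_of_le_add_powr[of "p / 2"])
      fix e :: real assume e: "0 < e"
      define X where "X \<theta> = ((Re (H \<theta>))\<^sup>2 + e) powr (p / 2)" for \<theta>
      define s where "s \<theta> = ((Re (H \<theta>))\<^sup>2 + (Im (H \<theta>))\<^sup>2 + e) powr (p / 2)" for \<theta>
      have cont: "continuous_on S X" "continuous_on S s" for S
        unfolding X_def s_def
        by (rule continuous_on_compose2[OF continuous_on_powr_Resq[OF e] cH subset_UNIV]
            continuous_on_compose2[OF continuous_on_powr_normsq[OF e] cH subset_UNIV])+
      \<comment> \<open>At 0 the comparison function equals \<open>(A - 1) * e powr (p / 2)\<close>.
        This is nonnegative because \<open>A \<ge> 2\<close>, so the mean value inequality loses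
        nothing here; the error in \<open>e\<close> comes only from replacing \<open>X\<close> by
        \<open>\<bar>Re H\<bar> powr p\<close>.\<close>
      have "0 \<le> 2 * pi * ((A - 1) * e powr (p / 2))"
        using A by simp
      also have "\<dots> \<le> integral {0..2*pi} (\<lambda>\<theta>. A * X \<theta> - s \<theta>)"
        using subharmonic_exp_sum_mean_ge[OF subharmonic_C2_powr_le_2[OF e, of "p / 2"] m] p True
        by (simp add: A_def X_def s_def H_def algebra_simps)
      also have "\<dots> = integral {0..2*pi} (\<lambda>\<theta>. A * X \<theta>) - integral {0..2*pi} s"
        by (intro integral_diff integrable_continuous_interval cont continuous_intros)
      finally have 2: "integral {0..2*pi} s \<le> integral {0..2*pi} (\<lambda>\<theta>. A * X \<theta>)"
        by simp
      \<comment> \<open>A sum is at most twice the maximum, and \<open>p \<le> 2\<close> keeps the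
        resulting factor \<open>2 powr (p / 2)\<close> at most 2.\<close>
      have X: "X \<theta> \<le> 2 * (\<bar>Re (H \<theta>)\<bar> powr p + e powr (p / 2))" for \<theta>
      proof -
        have "X \<theta> \<le> (2 * max ((Re (H \<theta>))\<^sup>2) e) powr (p / 2)"
          unfolding X_def using p e by (intro powr_mono2) auto
        also have "\<dots> = 2 powr (p / 2) * max ((Re (H \<theta>))\<^sup>2) e powr (p / 2)"
          using e by (intro powr_mult)
        also have "\<dots> \<le> 2 powr 1 * (((Re (H \<theta>))\<^sup>2) powr (p / 2) + e powr (p / 2))"
          using True by (intro mult_mono powr_mono) (auto simp: max_def)
        finally show ?thesis
          by (simp add: powr_half_sq)
      qed
      have "norm (H \<theta>) powr p \<le> s \<theta>" for \<theta>
        unfolding s_def powr_half_normsq[symmetric] using p e by (intro powr_mono2) auto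
      then have "integral {0..2*pi} (\<lambda>\<theta>. norm (H \<theta>) powr p) \<le> integral {0..2*pi} s"
        using p by (intro integral_le integrable_continuous_interval cont continuous_on_norm_powr cH) auto
      also note 2
      also have "integral {0..2*pi} (\<lambda>\<theta>. A * X \<theta>)
          \<le> integral {0..2*pi} (\<lambda>\<theta>. 2 * A * (\<bar>Re (H \<theta>)\<bar> powr p) + 2 * A * e powr (p / 2))"
        using p A mult_left_mono[OF X, of A]
        by (intro integral_le integrable_continuous_interval continuous_intros cont
            continuous_on_norm_powr[where 'b = real, unfolded real_norm_def] cH) (auto simp: algebra_simps)
      also have "\<dots> = 2 * A * integral {0..2*pi} (\<lambda>\<theta>. \<bar>Re (H \<theta>)\<bar> powr p) + 4 * pi * A * e powr (p / 2)"
        using p by (subst integral_add)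
          (auto intro!: integrable_continuous_interval continuous_intros
            continuous_on_norm_powr[where 'b = real, unfolded real_norm_def] cH)
      finally show "integral {0..2*pi} (\<lambda>\<theta>. norm (H \<theta>) powr p)
        \<le> 2 * A * integral {0..2*pi} (\<lambda>\<theta>. \<bar>Re (H \<theta>)\<bar> powr p) + 4 * pi * A * e powr (p / 2)" .
    qed (use p in simp)
  qed
next
  case False
  define a where "a = p / 2 - 1"
  define C where "C = 2 * (a + 1)\<^sup>2"
  \<comment> \<open>\<open>K\<close> comes from splitting at
    \<open>2 * C * (Re H)\<^sup>2 = s\<close>. Below, \<open>C * (Re H)\<^sup>2 * s powr a\<close>
    is at most half of \<open>s powr (a + 1)\<close>; above, replacing \<open>s\<close> by
    \<open>2 * C * (Re H)\<^sup>2\<close> gives \<open>K * \<bar>Re H\<bar> powr p\<close>.\<close>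
  define K where "K = C * (2 * C) powr a"
  have a: "0 < a" and C: "0 < C" and pa: "a + 1 = p / 2"
    using False by (auto simp: a_def C_def)
  show ?thesis
  proof
    show "0 \<le> 2 * K"
      using C by (simp add: K_def)
    fix F :: "'a set" and c and m :: "'a \<Rightarrow> nat"
    assume m: "\<And>s. s \<in> F \<Longrightarrow> 0 < m s"
    define H where "H = (\<lambda>\<theta>. exp_sum F c m (\<i> * of_real \<theta>))"
    have cH: "continuous_on S H" for S
      unfolding H_def by (intro continuous_on_compose2[OF continuous_on_exp_sum[of UNIV]] continuous_intros) auto
    show "integral {0..2*pi} (\<lambda>\<theta>. norm (H \<theta>) powr p)
      \<le> 2 * K * integral {0..2*pi} (\<lambda>\<theta>. \<bar>Re (H \<theta>)\<bar> powr p)"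
    proof (rule le_of_le_add_powr[of "p / 2"])
      fix e :: real assume e: "0 < e"
      define s where "s \<theta> = (Re (H \<theta>))\<^sup>2 + (Im (H \<theta>))\<^sup>2 + e" for \<theta>
      have s: "0 < s \<theta>" for \<theta>
        unfolding s_def by (rule normsq_add_pos[OF e])
      have cont: "continuous_on S (\<lambda>\<theta>. s \<theta> powr k)" for S k
        unfolding s_def
        by (rule continuous_on_compose2[OF continuous_on_powr_normsq[OF e] cH subset_UNIV])
      have cx: "continuous_on S (\<lambda>\<theta>. \<bar>Re (H \<theta>)\<bar> powr p)" for S
        using p by (intro continuous_on_norm_powr[where 'b = real, unfolded real_norm_def] continuous_intros cH) auto
      have "C * (Re (H \<theta>))\<^sup>2 * s \<theta> powr a \<le> 1 / 2 * s \<theta> powr (p / 2) + K * \<bar>Re (H \<theta>)\<bar> powr p" for \<theta>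
      proof (cases "2 * C * (Re (H \<theta>))\<^sup>2 \<le> s \<theta>")
        case True
        then have "2 * C * (Re (H \<theta>))\<^sup>2 * s \<theta> powr a \<le> s \<theta> * s \<theta> powr a"
          by (intro mult_right_mono) auto
        also have "\<dots> = s \<theta> powr (p / 2)"
          using s[of \<theta>] powr_add[of "s \<theta>" a 1] by (simp add: pa)
        finally have "C * (Re (H \<theta>))\<^sup>2 * s \<theta> powr a \<le> 1 / 2 * s \<theta> powr (p / 2)"
          by simp
        moreover have "0 \<le> K * \<bar>Re (H \<theta>)\<bar> powr p"
          using C by (simp add: K_def)
        ultimately show ?thesis
          by linarith
      next
        case False
        then have "0 < (Re (H \<theta>))\<^sup>2"
          using s[of \<theta>] by (metis le_less_trans less_eq_real_def mult_zero_right not_le zero_le_power2)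
        have "s \<theta> powr a \<le> (2 * C * (Re (H \<theta>))\<^sup>2) powr a"
          using False a s[of \<theta>] by (intro powr_mono2) auto
        also have "\<dots> = (2 * C) powr a * ((Re (H \<theta>))\<^sup>2) powr a"
          using C by (intro powr_mult)
        finally have "C * (Re (H \<theta>))\<^sup>2 * s \<theta> powr a \<le> C * (Re (H \<theta>))\<^sup>2 * ((2 * C) powr a * ((Re (H \<theta>))\<^sup>2) powr a)"
          using C by (intro mult_left_mono) auto
        also have "\<dots> = K * ((Re (H \<theta>))\<^sup>2) powr (a + 1)"
          using \<open>0 < (Re (H \<theta>))\<^sup>2\<close> by (subst powr_add) (simp add: K_def)
        also have "\<dots> = K * \<bar>Re (H \<theta>)\<bar> powr p"
          by (simp add: pa powr_half_sq)
        finally have "C * (Re (H \<theta>))\<^sup>2 * s \<theta> powr a \<le> K * \<bar>Re (H \<theta>)\<bar> powr p" .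
        moreover have "0 \<le> 1 / 2 * s \<theta> powr (p / 2)"
          by simp
        ultimately show ?thesis
          by linarith
      qed
      then have 1: "integral {0..2*pi} (\<lambda>\<theta>. C * ((Re (H \<theta>))\<^sup>2 * s \<theta> powr a))
          \<le> integral {0..2*pi} (\<lambda>\<theta>. 1 / 2 * s \<theta> powr (p / 2) + K * \<bar>Re (H \<theta>)\<bar> powr p)"
        by (intro integral_le integrable_continuous_interval continuous_intros cont cx cH) (auto simp: mult.assoc)
      have 2: "integral {0..2*pi} (\<lambda>\<theta>. 1 / 2 * s \<theta> powr (p / 2) + K * \<bar>Re (H \<theta>)\<bar> powr p)
          = 1 / 2 * integral {0..2*pi} (\<lambda>\<theta>. s \<theta> powr (p / 2)) + K * integral {0..2*pi} (\<lambda>\<theta>. \<bar>Re (H \<theta>)\<bar> powr p)"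
        by (subst integral_add) (auto intro!: integrable_continuous_interval continuous_intros cont cx)
      \<comment> \<open>The comparison function is \<open>- (e powr (p / 2))\<close> at 0, since the
        factor \<open>(Re z)\<^sup>2\<close> vanishes there. Absorbing half of the integral of
        \<open>s powr (p / 2)\<close> on the left doubles the rest, whence \<open>2 * K\<close> and
        \<open>4 * pi\<close>.\<close>
      have "2 * pi * (- (e powr (p / 2))) \<le> integral {0..2*pi} (\<lambda>\<theta>. C * ((Re (H \<theta>))\<^sup>2 * s \<theta> powr a) - s \<theta> powr (p / 2))"
        using subharmonic_exp_sum_mean_ge[OF subharmonic_C2_powr_ge_2[OF e, of a] m] a
        by (simp add: C_def s_def H_def pa exp_sum_def)
      also have "\<dots> = integral {0..2*pi} (\<lambda>\<theta>. C * ((Re (H \<theta>))\<^sup>2 * s \<theta> powr a)) - integral {0..2*pi} (\<lambda>\<theta>. s \<theta> powr (p / 2))"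
        by (intro integral_diff integrable_continuous_interval continuous_intros cont cH)
      finally have 3: "integral {0..2*pi} (\<lambda>\<theta>. s \<theta> powr (p / 2))
          \<le> 2 * K * integral {0..2*pi} (\<lambda>\<theta>. \<bar>Re (H \<theta>)\<bar> powr p) + 4 * pi * e powr (p / 2)"
        using 1 2 by (simp add: algebra_simps)
      have "norm (H \<theta>) powr p \<le> s \<theta> powr (p / 2)" for \<theta>
        unfolding s_def powr_half_normsq[symmetric] using p e by (intro powr_mono2) auto
      then have "integral {0..2*pi} (\<lambda>\<theta>. norm (H \<theta>) powr p) \<le> integral {0..2*pi} (\<lambda>\<theta>. s \<theta> powr (p / 2))"
        using p by (intro integral_le integrable_continuous_interval cont continuous_on_norm_powr cH) auto
      also note 3
      finally show "integral {0..2*pi} (\<lambda>\<theta>. norm (H \<theta>) powr p)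
        \<le> 2 * K * integral {0..2*pi} (\<lambda>\<theta>. \<bar>Re (H \<theta>)\<bar> powr p) + 4 * pi * e powr (p / 2)" .
    qed (use p in simp)
  qed
qed

text \<open>
  Write the sum as \<open>Q + cnj R\<close> with \<open>Q\<close> and \<open>R\<close> analytic. Then \<open>Q + R\<close> and \<open>- \<i> (Q - R)\<close> are analytic
  with real parts \<open>Re (Q + cnj R)\<close> and \<open>Im (Q + cnj R)\<close>.
\<close>

lemma riesz_projection_circle:
  assumes p: "1 < p"
  obtains C where "0 \<le> C" and "\<And>(F :: 'a set) b (n :: 'a \<Rightarrow> int). finite F \<Longrightarrow> (\<And>s. s \<in> F \<Longrightarrow> n s \<noteq> 0) \<Longrightarrow>
    integral {0..2*pi} (\<lambda>\<theta>. norm (\<Sum>s\<in>F \<inter> {s. 0 < n s}. b s * cis (of_int (n s) * \<theta>)) powr p)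
      \<le> C * integral {0..2*pi} (\<lambda>\<theta>. norm (\<Sum>s\<in>F. b s * cis (of_int (n s) * \<theta>)) powr p)"
proof -
  obtain C where C: "0 \<le> C" and le: "\<And>(F :: 'a set) c m. (\<And>s. s \<in> F \<Longrightarrow> 0 < m s) \<Longrightarrow>
    integral {0..2*pi} (\<lambda>\<theta>. norm (exp_sum F c m (\<i> * of_real \<theta>)) powr p)
      \<le> C * integral {0..2*pi} (\<lambda>\<theta>. \<bar>Re (exp_sum F c m (\<i> * of_real \<theta>))\<bar> powr p)"
    using exp_sum_powr_le[OF p] by blast
  show ?thesis
  proof
    show "0 \<le> 2 * C"
      using C by simp
    fix F :: "'a set" and b :: "'a \<Rightarrow> complex" and n :: "'a \<Rightarrow> int"
    assume F: "finite F" and n: "\<And>s. s \<in> F \<Longrightarrow> n s \<noteq> 0"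
    define Q where "Q \<theta> = (\<Sum>s\<in>F \<inter> {s. 0 < n s}. b s * cis (of_int (n s) * \<theta>))" for \<theta>
    \<comment> \<open>This is the part with negative frequencies, so the analytic function called R
      in the remark above is the conjugate of \<open>R \<theta>\<close>.\<close>
    define R where "R \<theta> = (\<Sum>s\<in>F \<inter> - {s. 0 < n s}. b s * cis (of_int (n s) * \<theta>))" for \<theta>
    define g where "g \<theta> = (\<Sum>s\<in>F. b s * cis (of_int (n s) * \<theta>))" for \<theta>
    define m where "m s = nat \<bar>n s\<bar>" for s
    \<comment> \<open>Conjugation turns the frequency \<open>n s\<close> into its negative, so after
      conjugating the negative part all exponents are \<open>m s\<close>. \<open>c1\<close> and
      \<open>c2\<close> are chosen so that \<open>Re H1 = Re g\<close> and
      \<open>Re H2 = Im g\<close>.\<close>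
    define c1 where "c1 s = (if 0 < n s then b s else cnj (b s))" for s
    define c2 where "c2 s = (if 0 < n s then - \<i> * b s else \<i> * cnj (b s))" for s
    define H1 where "H1 = (\<lambda>\<theta>. exp_sum F c1 m (\<i> * of_real \<theta>))"
    define H2 where "H2 = (\<lambda>\<theta>. exp_sum F c2 m (\<i> * of_real \<theta>))"
    have m: "0 < m s" if "s \<in> F" for s
      using n[OF that] by (simp add: m_def)
    have g: "g \<theta> = Q \<theta> + R \<theta>" for \<theta>
      unfolding g_def Q_def R_def by (subst sum.If_cases[OF F, symmetric]) simp
    have e: "exp (of_nat (m s) * (\<i> * complex_of_real \<theta>)) = (if 0 < n s then cis (of_int (n s) * \<theta>) else cnj (cis (of_int (n s) * \<theta>)))" for s and \<theta> :: real
      by (simp add: m_def cis_conv_exp exp_cnj mult_ac)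
    have H1: "H1 \<theta> = Q \<theta> + cnj (R \<theta>)" for \<theta>
    proof -
      have "H1 \<theta> = (\<Sum>s\<in>F. if 0 < n s then b s * cis (of_int (n s) * \<theta>) else cnj (b s * cis (of_int (n s) * \<theta>)))"
        unfolding H1_def exp_sum_def c1_def e by (intro sum.cong) auto
      then show ?thesis
        by (simp add: sum.If_cases[OF F] Q_def R_def)
    qed
    have H2: "H2 \<theta> = - \<i> * Q \<theta> + \<i> * cnj (R \<theta>)" for \<theta>
    proof -
      have "H2 \<theta> = (\<Sum>s\<in>F. if 0 < n s then - \<i> * (b s * cis (of_int (n s) * \<theta>)) else \<i> * cnj (b s * cis (of_int (n s) * \<theta>)))"
        unfolding H2_def exp_sum_def c2_def e by (intro sum.cong) auto
      then show ?thesis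
        by (simp add: sum.If_cases[OF F] Q_def R_def sum_distrib_left sum_negf)
    qed
    have cH: "continuous_on S H1" "continuous_on S H2" for S
      unfolding H1_def H2_def
      by (intro continuous_on_compose2[OF continuous_on_exp_sum[of UNIV]] continuous_intros; auto)+
    have cQg: "continuous_on S Q" "continuous_on S g" for S
      unfolding Q_def g_def by (intro continuous_intros)+
    have "norm (Q \<theta>) powr p \<le> norm (H1 \<theta>) powr p + norm (H2 \<theta>) powr p" for \<theta>
    proof -
      \<comment> \<open>The conjugated part cancels in this combination, so the wanted projection is
        an average of two functions that are already controlled by \<open>g\<close>.\<close>
      have "2 * Q \<theta> = H1 \<theta> + \<i> * H2 \<theta>"
        by (simp add: H1 H2 algebra_simps)
      then have "2 * norm (Q \<theta>) \<le> norm (H1 \<theta>) + norm (H2 \<theta>)"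
        by (metis norm_ii mult_1 norm_mult norm_numeral norm_triangle_ineq)
      then have "norm (Q \<theta>) \<le> max (norm (H1 \<theta>)) (norm (H2 \<theta>))"
        by linarith
      then have "norm (Q \<theta>) powr p \<le> max (norm (H1 \<theta>)) (norm (H2 \<theta>)) powr p"
        using p by (intro powr_mono2) auto
      then show ?thesis
        by (smt (verit) powr_ge_zero)
    qed
    then have "integral {0..2*pi} (\<lambda>\<theta>. norm (Q \<theta>) powr p)
        \<le> integral {0..2*pi} (\<lambda>\<theta>. norm (H1 \<theta>) powr p + norm (H2 \<theta>) powr p)"
      using p by (intro integral_le integrable_continuous_interval continuous_intros continuous_on_norm_powr cH cQg) auto
    also have "\<dots> = integral {0..2*pi} (\<lambda>\<theta>. norm (H1 \<theta>) powr p) + integral {0..2*pi} (\<lambda>\<theta>. norm (H2 \<theta>) powr p)"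
      using p by (intro integral_add integrable_continuous_interval continuous_on_norm_powr cH) auto
    also have "integral {0..2*pi} (\<lambda>\<theta>. norm (H1 \<theta>) powr p) \<le> C * integral {0..2*pi} (\<lambda>\<theta>. norm (g \<theta>) powr p)"
    proof -
      have "integral {0..2*pi} (\<lambda>\<theta>. norm (H1 \<theta>) powr p) \<le> C * integral {0..2*pi} (\<lambda>\<theta>. \<bar>Re (H1 \<theta>)\<bar> powr p)"
        unfolding H1_def by (rule le[OF m])
      also have "\<dots> \<le> C * integral {0..2*pi} (\<lambda>\<theta>. norm (g \<theta>) powr p)"
        using p abs_Re_le_cmod[of "g _"]
        by (intro mult_left_mono C integral_le integrable_continuous_interval continuous_on_norm_powr[where 'b = real, unfolded real_norm_def]
            continuous_on_norm_powr continuous_intros cH cQg powr_mono2) (auto simp: H1 g)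
      finally show ?thesis .
    qed
    also have "integral {0..2*pi} (\<lambda>\<theta>. norm (H2 \<theta>) powr p) \<le> C * integral {0..2*pi} (\<lambda>\<theta>. norm (g \<theta>) powr p)"
    proof -
      have "integral {0..2*pi} (\<lambda>\<theta>. norm (H2 \<theta>) powr p) \<le> C * integral {0..2*pi} (\<lambda>\<theta>. \<bar>Re (H2 \<theta>)\<bar> powr p)"
        unfolding H2_def by (rule le[OF m])
      also have "\<dots> \<le> C * integral {0..2*pi} (\<lambda>\<theta>. norm (g \<theta>) powr p)"
        using p abs_Im_le_cmod[of "g _"]
        by (intro mult_left_mono C integral_le integrable_continuous_interval continuous_on_norm_powr[where 'b = real, unfolded real_norm_def]
            continuous_on_norm_powr continuous_intros cH cQg powr_mono2) (auto simp: H2 g add.commute)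
      finally show ?thesis .
    qed
    finally show "integral {0..2*pi} (\<lambda>\<theta>. norm (Q \<theta>) powr p)
      \<le> 2 * C * integral {0..2*pi} (\<lambda>\<theta>. norm (g \<theta>) powr p)"
      by simp
  qed
qed

section \<open>Lebesgue spaces\<close>

text \<open>The p-th power of the norm. It satisfies a triangle inequality with factor
  \<open>2 powr p\<close> that follows pointwise for every \<open>p > 0\<close>. That is enough for
  limits and for boundedness with some constant, and Minkowski's inequality is avoided.\<close>

definition Lp_modular :: "'a measure \<Rightarrow> real \<Rightarrow> ('a \<Rightarrow> complex) \<Rightarrow> real" where
  "Lp_modular M p f = (\<integral>x. norm (f x) powr p \<partial>M)"

lemma Lp_norm_eq_modular: "Lp_norm M p f = Lp_modular M p f powr (1 / p)"
  by (simp add: Lp_norm_def Lp_modular_def)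

lemma Lp_modular_nonneg: "0 \<le> Lp_modular M p f"
  by (simp add: Lp_modular_def)

lemma norm_add_powr_le:
  fixes a b :: complex
  assumes "0 < p"
  shows "norm (a + b) powr p \<le> 2 powr p * (norm a powr p + norm b powr p)"
proof -
  have "norm (a + b) powr p \<le> (2 * max (norm a) (norm b)) powr p"
    using assms norm_triangle_ineq[of a b] by (intro powr_mono2) auto
  also have "\<dots> = 2 powr p * max (norm a) (norm b) powr p"
    by (intro powr_mult)
  also have "\<dots> \<le> 2 powr p * (norm a powr p + norm b powr p)"
    by (intro mult_left_mono) (auto simp: max_def)
  finally show ?thesis .
qed

lemma Lp_spaceD:
  assumes "f \<in> Lp_space M p"
  shows "f \<in> borel_measurable M" "integrable M (\<lambda>x. norm (f x) powr p)"
  using assms by (auto simp: Lp_space_def)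

lemma Lp_space_add:
  assumes "0 < p" "f \<in> Lp_space M p" "g \<in> Lp_space M p"
  shows "(\<lambda>x. f x + g x) \<in> Lp_space M p"
proof -
  note [measurable] = assms(2,3)[THEN Lp_spaceD(1)]
  have "integrable M (\<lambda>x. 2 powr p * (norm (f x) powr p + norm (g x) powr p))"
    using assms by (intro integrable_mult_right Bochner_Integration.integrable_add Lp_spaceD)
  then have "integrable M (\<lambda>x. norm (f x + g x) powr p)"
    using norm_add_powr_le[OF assms(1)] by (elim Bochner_Integration.integrable_bound) auto
  then show ?thesis
    by (simp add: Lp_space_def)
qed

lemma Lp_space_cmult:
  assumes "f \<in> Lp_space M p"
  shows "(\<lambda>x. c * f x) \<in> Lp_space M p"
  using assms by (auto simp: Lp_space_def norm_mult powr_mult)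

lemma Lp_space_diff:
  assumes "0 < p" "f \<in> Lp_space M p" "g \<in> Lp_space M p"
  shows "(\<lambda>x. f x - g x) \<in> Lp_space M p"
  using Lp_space_add[OF assms(1,2) Lp_space_cmult[OF assms(3), of "-1"]] by simp

lemma Lp_modular_add_le:
  assumes "0 < p" "f \<in> Lp_space M p" "g \<in> Lp_space M p"
  shows "Lp_modular M p (\<lambda>x. f x + g x) \<le> 2 powr p * (Lp_modular M p f + Lp_modular M p g)"
proof -
  have "Lp_modular M p (\<lambda>x. f x + g x) \<le> (\<integral>x. 2 powr p * (norm (f x) powr p + norm (g x) powr p) \<partial>M)"
    unfolding Lp_modular_def
    using assms Lp_space_add[OF assms]
    by (intro integral_mono norm_add_powr_le integrable_mult_right Bochner_Integration.integrable_add Lp_spaceD)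
  also have "\<dots> = 2 powr p * (Lp_modular M p f + Lp_modular M p g)"
    using assms by (simp add: Lp_modular_def Lp_spaceD)
  finally show ?thesis .
qed

lemma Lp_modular_cmult: "Lp_modular M p (\<lambda>x. c * f x) = norm c powr p * Lp_modular M p f"
  by (simp add: Lp_modular_def norm_mult powr_mult)

lemma Lp_modular_minus_commute: "Lp_modular M p (\<lambda>x. f x - g x) = Lp_modular M p (\<lambda>x. g x - f x)"
  by (simp add: Lp_modular_def norm_minus_commute)

lemma Lp_modular_triangle:
  assumes "0 < p" "f \<in> Lp_space M p" "g \<in> Lp_space M p" "h \<in> Lp_space M p"
  shows "Lp_modular M p (\<lambda>x. f x - h x)
    \<le> 2 powr p * (Lp_modular M p (\<lambda>x. f x - g x) + Lp_modular M p (\<lambda>x. g x - h x))"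
  using Lp_modular_add_le[OF assms(1) Lp_space_diff[OF assms(1,2,3)] Lp_space_diff[OF assms(1,3,4)]]
  by simp

lemma Lp_modular_cong_AE:
  assumes "f \<in> borel_measurable M" "g \<in> borel_measurable M" "AE x in M. f x = g x"
  shows "Lp_modular M p f = Lp_modular M p g"
  unfolding Lp_modular_def using assms by (intro integral_cong_AE) auto

lemma Lp_modular_cong: "(\<And>x. x \<in> space M \<Longrightarrow> f x = g x) \<Longrightarrow> Lp_modular M p f = Lp_modular M p g"
  unfolding Lp_modular_def by (intro Bochner_Integration.integral_cong) auto

lemma Lp_modular_eq_0_imp_AE:
  assumes "f \<in> Lp_space M p" "Lp_modular M p f = 0"
  shows "AE x in M. f x = 0"
  using assms integral_nonneg_eq_0_iff_AE[of M "\<lambda>x. norm (f x) powr p"]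
  by (auto simp: Lp_modular_def Lp_spaceD)

lemma Lp_modular_limit_unique:
  assumes p: "0 < p" and L: "g \<in> Lp_space M p" "g' \<in> Lp_space M p" "\<And>n. u n \<in> Lp_space M p"
    and lim: "(\<lambda>n. Lp_modular M p (\<lambda>x. g x - u n x)) \<longlonglongrightarrow> 0"
      "(\<lambda>n. Lp_modular M p (\<lambda>x. g' x - u n x)) \<longlonglongrightarrow> 0"
  shows "AE x in M. g x = g' x"
proof -
  have "(\<lambda>n. 2 powr p * (Lp_modular M p (\<lambda>x. g x - u n x) + Lp_modular M p (\<lambda>x. g' x - u n x)))
      \<longlonglongrightarrow> 2 powr p * (0 + 0)"
    by (intro tendsto_intros lim)
  then have lim0: "(\<lambda>n. 2 powr p * (Lp_modular M p (\<lambda>x. g x - u n x) + Lp_modular M p (\<lambda>x. g' x - u n x))) \<longlonglongrightarrow> 0"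
    by simp
  have "Lp_modular M p (\<lambda>x. g x - g' x)
      \<le> 2 powr p * (Lp_modular M p (\<lambda>x. g x - u n x) + Lp_modular M p (\<lambda>x. g' x - u n x))" for n
    using Lp_modular_triangle[OF p L(1) L(3)[of n] L(2)] Lp_modular_minus_commute[of M p g' "u n"] by simp
  then have "Lp_modular M p (\<lambda>x. g x - g' x) \<le> 0"
    by (intro LIMSEQ_le_const[OF lim0]) blast
  then have "Lp_modular M p (\<lambda>x. g x - g' x) = 0"
    using Lp_modular_nonneg[of M p "\<lambda>x. g x - g' x"] by simp
  from Lp_modular_eq_0_imp_AE[OF Lp_space_diff[OF p L(1,2)] this] show ?thesis
    by simp
qed

text \<open>Split at the level \<open>h\<close>: below it the first term dominates, above it
  \<open>t powr (r - q) \<le> h powr (r - q)\<close>. On a finite measure space the free parameter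
  \<open>h\<close> takes over the role of Hoelder's inequality.\<close>

lemma powr_le_powr_of_larger_exponent:
  fixes t r q h :: real
  assumes "0 < r" "r \<le> q" "0 \<le> t" "0 < h"
  shows "t powr r \<le> h powr r + h powr (r - q) * t powr q"
proof (cases "t \<le> h")
  case True
  then have "t powr r \<le> h powr r"
    using assms by (intro powr_mono2) auto
  moreover have "0 \<le> h powr (r - q) * t powr q"
    by simp
  ultimately show ?thesis
    by linarith
next
  case False
  have "t powr r = t powr (r - q) * t powr q"
    by (simp flip: powr_add)
  also have "\<dots> \<le> h powr (r - q) * t powr q"
    using False assms by (intro mult_right_mono powr_mono2') auto
  finally show ?thesis
    using powr_ge_zero[of h r] by linarith
qed

section \<open>Comparison of exponents and completeness on a finite measure space\<close>

context finite_measure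
begin

lemma Lp_space_bounded:
  assumes "0 < p" "f \<in> borel_measurable M" "\<And>x. x \<in> space M \<Longrightarrow> norm (f x) \<le> B"
  shows "f \<in> Lp_space M p"
proof -
  note [measurable] = assms(2)
  have "integrable M (\<lambda>x. norm (f x) powr p)"
    using assms by (intro integrable_const_bound[of _ "B powr p"]) (auto intro!: AE_I2 powr_mono2)
  then show ?thesis
    using assms by (simp add: Lp_space_def)
qed

lemma Lp_space_antimono:
  assumes "0 < r" "r \<le> q"
  shows "Lp_space M q \<subseteq> Lp_space M r"
proof
  fix f assume f: "f \<in> Lp_space M q"
  note [measurable] = Lp_spaceD(1)[OF f]
  have "integrable M (\<lambda>x. 1 + norm (f x) powr q)"
    using f by (intro Bochner_Integration.integrable_add Lp_spaceD) auto
  moreover have "norm (f x) powr r \<le> 1 + norm (f x) powr q" for x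
    using powr_le_powr_of_larger_exponent[OF assms, of "norm (f x)" 1] by simp
  ultimately have "integrable M (\<lambda>x. norm (f x) powr r)"
    by (elim Bochner_Integration.integrable_bound) (auto intro!: AE_I2)
  then show "f \<in> Lp_space M r"
    by (simp add: Lp_space_def)
qed

lemma Lp_modular_tendsto_antimono:
  assumes rq: "0 < r" "r \<le> q" and u: "\<And>n. u n \<in> Lp_space M q"
    and lim: "(\<lambda>n. Lp_modular M q (u n)) \<longlonglongrightarrow> 0"
  shows "(\<lambda>n. Lp_modular M r (u n)) \<longlonglongrightarrow> 0"
proof (rule LIMSEQ_I)
  fix e :: real assume "0 < e"
  define m where "m = measure M (space M)"
  \<comment> \<open>The level with \<open>h powr r * (m + 1) = e / 2\<close>. Once the
    \<open>q\<close>-modular is below \<open>h powr q\<close>, its term is at most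
    \<open>h powr r\<close>, which is what the summand 1 in \<open>m + 1\<close> pays for.\<close>
  define h where "h = (e / (2 * (m + 1))) powr (1 / r)"
  have "0 \<le> m"
    by (simp add: m_def)
  then have h: "0 < h" "h powr r * (m + 1) = e / 2"
    using \<open>0 < e\<close> \<open>0 < r\<close> by (auto simp: h_def powr_powr divide_simps)
  have le: "Lp_modular M r (u n) \<le> h powr r * m + h powr (r - q) * Lp_modular M q (u n)" for n
  proof -
    have "Lp_modular M r (u n) \<le> (\<integral>x. h powr r + h powr (r - q) * norm (u n x) powr q \<partial>M)"
      unfolding Lp_modular_def
      using Lp_space_antimono[OF rq] u[of n] rq h
      by (intro integral_mono powr_le_powr_of_larger_exponent Bochner_Integration.integrable_add integrable_mult_right Lp_spaceD) auto
    also have "\<dots> = h powr r * m + h powr (r - q) * Lp_modular M q (u n)"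
      using u[of n] by (simp add: Lp_modular_def Lp_spaceD m_def mult.commute)
    finally show ?thesis .
  qed
  have "0 < h powr q"
    using h by simp
  then obtain N where N: "\<And>n. N \<le> n \<Longrightarrow> Lp_modular M q (u n) < h powr q"
    using LIMSEQ_D[OF lim, of "h powr q"] by (auto simp: Lp_modular_nonneg)
  have "Lp_modular M r (u n) < e" if "N \<le> n" for n
  proof -
    have "Lp_modular M r (u n) \<le> h powr r * m + h powr (r - q) * h powr q"
      using le[of n] N[OF that] by (intro order_trans[OF le] add_left_mono mult_left_mono) auto
    also have "\<dots> = h powr r * (m + 1)"
      by (simp add: powr_add[symmetric] algebra_simps)
    finally show ?thesis
      using h \<open>0 < e\<close> by simp
  qed
  then show "\<exists>N. \<forall>n\<ge>N. norm (Lp_modular M r (u n) - 0) < e"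
    by (auto simp: Lp_modular_nonneg)
qed

lemma Lp_modular_dominated_convergence:
  assumes p: "0 < p" and f: "f \<in> borel_measurable M" and u: "\<And>n. u n \<in> borel_measurable M"
    and w: "integrable M (\<lambda>x. w x powr p)"
    and bound: "\<And>n x. x \<in> space M \<Longrightarrow> norm (u n x) \<le> w x"
    and lim: "\<And>x. x \<in> space M \<Longrightarrow> (\<lambda>n. u n x) \<longlonglongrightarrow> f x"
  shows "f \<in> Lp_space M p" "\<And>n. u n \<in> Lp_space M p" "(\<lambda>n. Lp_modular M p (\<lambda>x. f x - u n x)) \<longlonglongrightarrow> 0"
proof -
  note [measurable] = f u
  have bf: "norm (f x) \<le> w x" if "x \<in> space M" for x
    using tendsto_upperbound[OF tendsto_norm[OF lim[OF that]]] bound[OF that] by simp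
  have b: "norm (v x) powr p \<le> w x powr p" if "norm (v x) \<le> w x" for v :: "_ \<Rightarrow> complex" and x
    using that p by (simp add: powr_mono2)
  have "integrable M (\<lambda>x. norm (f x) powr p)"
    by (rule Bochner_Integration.integrable_bound[OF w]) (auto intro!: AE_I2 b bf)
  then show L: "f \<in> Lp_space M p"
    by (simp add: Lp_space_def)
  have "integrable M (\<lambda>x. norm (u n x) powr p)" for n
    by (rule Bochner_Integration.integrable_bound[OF w]) (auto intro!: AE_I2 b bound)
  then show "u n \<in> Lp_space M p" for n
    by (simp add: Lp_space_def)
  have "(\<lambda>n. \<integral>x. norm (f x - u n x) powr p \<partial>M) \<longlonglongrightarrow> (\<integral>x. 0 \<partial>M)"
  proof (rule integral_dominated_convergence)
    show "integrable M (\<lambda>x. 2 powr p * w x powr p)"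
      using w by simp
    show "AE x in M. (\<lambda>n. norm (f x - u n x) powr p) \<longlonglongrightarrow> 0"
    proof (rule AE_I2)
      fix x assume "x \<in> space M"
      then have "(\<lambda>n. norm (f x - u n x)) \<longlonglongrightarrow> 0"
        using tendsto_norm[OF tendsto_diff[OF tendsto_const[of "f x"] lim[of x]]] by simp
      then have "(\<lambda>n. norm (f x - u n x) powr p) \<longlonglongrightarrow> 0 powr p"
        using p by (intro tendsto_powr' tendsto_intros) auto
      then show "(\<lambda>n. norm (f x - u n x) powr p) \<longlonglongrightarrow> 0"
        using p by simp
    qed
    show "AE x in M. norm (norm (f x - u n x) powr p) \<le> 2 powr p * w x powr p" for n
    proof (rule AE_I2)
      fix x assume x: "x \<in> space M"
      have "norm (f x - u n x) \<le> 2 * w x"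
        using norm_triangle_ineq4[of "f x" "u n x"] bf[OF x] bound[OF x, of n] by linarith
      moreover have "0 \<le> w x"
        using bf[OF x] norm_ge_zero order_trans by blast
      ultimately show "norm (norm (f x - u n x) powr p) \<le> 2 powr p * w x powr p"
        using p by (simp flip: powr_mult add: powr_mono2)
    qed
  qed auto
  then show "(\<lambda>n. Lp_modular M p (\<lambda>x. f x - u n x)) \<longlonglongrightarrow> 0"
    by (simp add: Lp_modular_def)
qed

text \<open>
  The rate of the Cauchy condition makes the sets where \<open>norm (u (n + 1) - u n) \<ge> 2 ^ -n\<close> summable,
  so that the sequence converges almost everywhere by Borel--Cantelli.
\<close>

lemma Lp_fast_Cauchy_convergent:
  assumes p: "0 < p" and u: "\<And>n. u n \<in> Lp_space M p" and K: "0 \<le> K"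
    and Cauchy: "\<And>m n. n \<le> m \<Longrightarrow> Lp_modular M p (\<lambda>x. u m x - u n x) \<le> K * ((1/2)^n * ((1/2)^n) powr p)"
  obtains g where "g \<in> Lp_space M p" "(\<lambda>n. Lp_modular M p (\<lambda>x. g x - u n x)) \<longlonglongrightarrow> 0"
proof -
  have [measurable]: "u n \<in> borel_measurable M" for n
    using u by (rule Lp_spaceD)
  \<comment> \<open>Stated with p-th powers so that Markov's inequality applies to the modular. The
    factor \<open>((1/2)^n) powr p\<close> of the Cauchy rate cancels against the level, and the
    other factor \<open>(1/2)^n\<close> is left to be summed.\<close>
  define A where "A n = {x \<in> space M. ((1/2)^n) powr p \<le> norm (u (Suc n) x - u n x) powr p}" for n
  have [measurable]: "A n \<in> sets M" for n
    unfolding A_def by measurable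
  have "measure M (A n) \<le> K * (1/2)^n" for n
  proof -
    have "measure M (A n) \<le> Lp_modular M p (\<lambda>x. u (Suc n) x - u n x) / ((1/2)^n) powr p"
      unfolding A_def Lp_modular_def
      using p Lp_spaceD(2)[OF Lp_space_diff[OF p u u]] by (intro integral_Markov_inequality_measure[where A = "{}"]) auto
    also have "\<dots> \<le> K * ((1/2)^n * ((1/2)^n) powr p) / ((1/2)^n) powr p"
      using Cauchy[of n "Suc n"] by (intro divide_right_mono) auto
    finally show ?thesis
      by simp
  qed
  moreover have "summable (\<lambda>n. K * (1/2::real)^n)"
    by (intro summable_mult summable_geometric) auto
  ultimately have "summable (\<lambda>n. measure M (A n))"
    by (intro summable_comparison_test[of "\<lambda>n. measure M (A n)" "\<lambda>n. K * (1/2)^n"]) auto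
  then have "AE x in M. eventually (\<lambda>n. x \<in> space M - A n) sequentially"
    by (intro borel_cantelli_AE1) (auto simp: less_top[symmetric])
  then have conv: "AE x in M. convergent (\<lambda>n. u n x)"
  proof eventually_elim
    case (elim x)
    have "\<forall>\<^sub>F n in sequentially. norm (u (Suc n) x - u n x) \<le> (1/2)^n"
      using elim
    proof eventually_elim
      case (elim n)
      then have "\<not> ((1/2)^n) powr p \<le> norm (u (Suc n) x - u n x) powr p"
        by (auto simp: A_def)
      then show ?case
        using p powr_mono2[of p "(1/2)^n" "norm (u (Suc n) x - u n x)"] by force
    qed
    then have "summable (\<lambda>n. u (Suc n) x - u n x)"
      by (rule summable_comparison_test_ev) (intro summable_geometric, simp)
    then have "convergent (\<lambda>n. \<Sum>i<n. u (Suc i) x - u i x)"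
      by (simp add: summable_iff_convergent)
    then have "convergent (\<lambda>n. u n x - u 0 x)"
      unfolding sum_lessThan_telescope[of "\<lambda>n. u n x"] .
    then show ?case
      by (simp add: convergent_diff_const_right_iff)
  qed
  \<comment> \<open>\<open>lim\<close> is total, so \<open>g\<close> is defined and measurable
    everywhere; its value is arbitrary on the null set where the sequence diverges.\<close>
  define g where "g x = lim (\<lambda>n. u n x)" for x
  have [measurable]: "g \<in> borel_measurable M"
    unfolding g_def by measurable
  have g: "AE x in M. (\<lambda>n. u n x) \<longlonglongrightarrow> g x"
    using conv unfolding g_def by eventually_elim (simp add: convergent_LIMSEQ_iff)
  define d where "d n = K * ((1/2)^n * ((1/2)^n) powr p)" for n :: nat
  have d_nonneg: "0 \<le> d n" for n
    using K by (simp add: d_def)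
  \<comment> \<open>Fatou's lemma: letting the larger index tend to infinity in the Cauchy condition
    carries the same rate over to the limit.\<close>
  have nn: "(\<integral>\<^sup>+x. ennreal (norm (g x - u n x) powr p) \<partial>M) \<le> ennreal (d n)" for n
  proof -
    have "(\<integral>\<^sup>+x. ennreal (norm (g x - u n x) powr p) \<partial>M)
        = (\<integral>\<^sup>+x. liminf (\<lambda>m. ennreal (norm (u m x - u n x) powr p)) \<partial>M)"
    proof (rule nn_integral_cong_AE, use g in eventually_elim)
      case (elim x)
      have "(\<lambda>m. norm (u m x - u n x) powr p) \<longlonglongrightarrow> norm (g x - u n x) powr p"
        using elim p by (intro tendsto_powr' tendsto_intros) auto
      then have "(\<lambda>m. ennreal (norm (u m x - u n x) powr p)) \<longlonglongrightarrow> ennreal (norm (g x - u n x) powr p)"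
        by (rule tendsto_ennrealI)
      then show ?case
        by (rule lim_imp_Liminf[symmetric, rotated]) simp
    qed
    also have "\<dots> \<le> liminf (\<lambda>m. \<integral>\<^sup>+x. ennreal (norm (u m x - u n x) powr p) \<partial>M)"
      by (rule nn_integral_liminf) measurable
    also have "\<dots> \<le> ennreal (d n)"
    proof (rule Liminf_le)
      show "\<forall>\<^sub>F m in sequentially. (\<integral>\<^sup>+x. ennreal (norm (u m x - u n x) powr p) \<partial>M) \<le> ennreal (d n)"
        using eventually_ge_at_top[of n]
      proof eventually_elim
        case (elim m)
        then show ?case
          using Cauchy[OF elim] Lp_spaceD(2)[OF Lp_space_diff[OF p u u]] d_nonneg
          by (subst nn_integral_eq_integral) (auto simp: Lp_modular_def d_def ennreal_le_iff2)
      qed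
    qed simp
    finally show ?thesis .
  qed
  have diff: "(\<lambda>x. g x - u n x) \<in> Lp_space M p" for n
  proof -
    have "integrable M (\<lambda>x. norm (g x - u n x) powr p)"
      using nn[of n] by (intro integrableI_nonneg) (auto simp: less_top[symmetric] top_unique)
    then show ?thesis
      by (simp add: Lp_space_def)
  qed
  have "Lp_modular M p (\<lambda>x. g x - u n x) \<le> d n" for n
    using nn[of n] Lp_spaceD(2)[OF diff[of n]] d_nonneg
    by (subst (asm) nn_integral_eq_integral) (auto simp: Lp_modular_def)
  moreover have "d \<longlonglongrightarrow> 0"
  proof -
    have "d n \<le> K * (1/2)^n" for n
    proof -
      have "((1/2::real)^n) powr p \<le> 1"
        using p by (intro powr_le1) (auto simp: power_le_one)
      then have "(1/2)^n * ((1/2)^n) powr p \<le> (1/2)^n * (1::real)"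
        by (intro mult_left_mono) auto
      then show ?thesis
        unfolding d_def using K by (intro mult_left_mono) auto
    qed
    moreover have *: "(\<lambda>n. K * (1/2::real)^n) \<longlonglongrightarrow> 0"
      by (intro tendsto_mult_right_zero LIMSEQ_power_zero) simp
    ultimately show ?thesis
      using d_nonneg
      by (intro tendsto_sandwich[OF always_eventually always_eventually tendsto_const *] allI)
  qed
  ultimately have "(\<lambda>n. Lp_modular M p (\<lambda>x. g x - u n x)) \<longlonglongrightarrow> 0"
    by (intro tendsto_sandwich[OF always_eventually always_eventually tendsto_const \<open>d \<longlonglongrightarrow> 0\<close>] allI Lp_modular_nonneg)
  moreover have "g \<in> Lp_space M p"
    using Lp_space_add[OF p diff[of 0] u[of 0]] by simp
  ultimately show ?thesis
    using that by blast
qed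

end

text \<open>Extension by density, for an operator given as a linear relation \<open>R\<close>.
  Linearity and the bound make \<open>R\<close> single valued up to null sets, since two pairs with
  the same first entry have second entries at modular distance 0. The second conclusion says that
  \<open>T\<close> is computed along every approximating sequence, which is how \<open>T\<close> is
  later identified.\<close>

lemma (in finite_measure) bounded_Lp_operator_extension:
  fixes R :: "(('a \<Rightarrow> complex) \<times> ('a \<Rightarrow> complex)) set"
  assumes p: "0 < p" and C: "0 \<le> C"
    and R_Lp: "\<And>f g. (f, g) \<in> R \<Longrightarrow> f \<in> Lp_space M p \<and> g \<in> Lp_space M p"
    and R_add: "\<And>f g f' g'. (f, g) \<in> R \<Longrightarrow> (f', g') \<in> R \<Longrightarrow> (\<lambda>x. f x + f' x, \<lambda>x. g x + g' x) \<in> R"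
    and R_cmult: "\<And>c f g. (f, g) \<in> R \<Longrightarrow> (\<lambda>x. c * f x, \<lambda>x. c * g x) \<in> R"
    and R_bound: "\<And>f g. (f, g) \<in> R \<Longrightarrow> Lp_modular M p g \<le> C * Lp_modular M p f"
    and R_dense: "\<And>f e. f \<in> Lp_space M p \<Longrightarrow> 0 < e \<Longrightarrow> \<exists>(f', g')\<in>R. Lp_modular M p (\<lambda>x. f x - f' x) < e"
  obtains T where "bounded_Lp_operator M p T"
    and "\<And>f fn gn. f \<in> Lp_space M p \<Longrightarrow> (\<And>n. (fn n, gn n) \<in> R) \<Longrightarrow>
      (\<lambda>n. Lp_modular M p (\<lambda>x. f x - fn n x)) \<longlonglongrightarrow> 0 \<Longrightarrow>
      (\<lambda>n. Lp_modular M p (\<lambda>x. T f x - gn n x)) \<longlonglongrightarrow> 0"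
proof -
  define N where "N = Lp_modular M p"
  define approx where "approx f fn gn \<longleftrightarrow> (\<forall>n. (fn n, gn n) \<in> R) \<and> (\<lambda>n. N (\<lambda>x. f x - fn n x)) \<longlonglongrightarrow> 0"
    for f :: "'a \<Rightarrow> complex" and fn gn :: "nat \<Rightarrow> 'a \<Rightarrow> complex"
  \<comment> \<open>Convergence is demanded along all approximating sequences rather than one. The
    element picked by \<open>SOME\<close> below can then be compared with any sequence at hand, in
    particular with sums and multiples of sequences.\<close>
  define ext where "ext f g \<longleftrightarrow> g \<in> Lp_space M p \<and> (\<forall>fn gn. approx f fn gn \<longrightarrow> (\<lambda>n. N (\<lambda>x. g x - gn n x)) \<longlonglongrightarrow> 0)"
    for f g :: "'a \<Rightarrow> complex"
  note tri = Lp_modular_triangle[OF p, where M = M, folded N_def]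
  note comm = Lp_modular_minus_commute[of M p, folded N_def]
  note add_le = Lp_modular_add_le[OF p, where M = M, folded N_def]
  have N_nonneg: "0 \<le> N f" for f
    by (simp add: N_def Lp_modular_nonneg)
  have R_diff: "(\<lambda>x. f x - f' x, \<lambda>x. g x - g' x) \<in> R" if "(f, g) \<in> R" "(f', g') \<in> R" for f g f' g'
    using R_add[OF that(1) R_cmult[OF that(2), of "-1"]] by simp
  have approx_fast: "\<exists>fn gn. approx f fn gn \<and> (\<forall>n. N (\<lambda>x. f x - fn n x) < (1/2)^n * ((1/2)^n) powr p)"
    if f: "f \<in> Lp_space M p" for f
  proof -
    have "\<exists>s. s \<in> R \<and> N (\<lambda>x. f x - fst s x) < (1/2)^n * ((1/2)^n) powr p" for n :: nat
    proof -
      have "0 < (1/2)^n * ((1/2::real)^n) powr p"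
        by simp
      from R_dense[OF f this] show ?thesis
        unfolding N_def by force
    qed
    then obtain s where s: "\<And>n. s n \<in> R" "\<And>n. N (\<lambda>x. f x - fst (s n) x) < (1/2)^n * ((1/2)^n) powr p"
      by metis
    have "N (\<lambda>x. f x - fst (s n) x) \<le> (1/2)^n" for n
    proof -
      have "((1/2::real)^n) powr p \<le> 1"
        using p by (intro powr_le1) (auto simp: power_le_one)
      then have "(1/2)^n * ((1/2)^n) powr p \<le> (1/2)^n * (1::real)"
        by (intro mult_left_mono) auto
      then show ?thesis
        using s(2)[of n] by linarith
    qed
    moreover have *: "(\<lambda>n. (1/2::real)^n) \<longlonglongrightarrow> 0"
      by (intro LIMSEQ_power_zero) simp
    ultimately have "(\<lambda>n. N (\<lambda>x. f x - fst (s n) x)) \<longlonglongrightarrow> 0"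
      by (intro tendsto_sandwich[OF always_eventually always_eventually tendsto_const *] allI N_nonneg)
    then have "approx f (\<lambda>n. fst (s n)) (\<lambda>n. snd (s n))"
      using s(1) by (simp add: approx_def)
    then show ?thesis
      using s(2) by blast
  qed
  have N_R_diff: "N (\<lambda>x. gn x - gn' x) \<le> C * (2 powr p * (N (\<lambda>x. f x - fn x) + N (\<lambda>x. f x - fn' x)))"
    if "(fn, gn) \<in> R" "(fn', gn') \<in> R" "f \<in> Lp_space M p" for f fn gn fn' gn'
  proof -
    have "N (\<lambda>x. gn x - gn' x) \<le> C * N (\<lambda>x. fn x - fn' x)"
      using R_bound[OF R_diff[OF that(1,2)]] by (simp add: N_def)
    also have "\<dots> \<le> C * (2 powr p * (N (\<lambda>x. f x - fn x) + N (\<lambda>x. f x - fn' x)))"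
      using tri[of fn f fn'] R_Lp[OF that(1)] R_Lp[OF that(2)] that(3) comm[of fn f]
      by (intro mult_left_mono C) simp
    finally show ?thesis .
  qed
  have ext_ex: "\<exists>g. ext f g" if f: "f \<in> Lp_space M p" for f
  proof -
    obtain fn gn where fast: "approx f fn gn" "\<And>n. N (\<lambda>x. f x - fn n x) < (1/2)^n * ((1/2)^n) powr p"
      using approx_fast[OF f] by blast
    then have R: "(fn n, gn n) \<in> R" for n
      by (simp add: approx_def)
    have cau: "N (\<lambda>x. gn m x - gn n x) \<le> (C * (2 powr p * 2)) * ((1/2)^n * ((1/2)^n) powr p)" if "n \<le> m" for m n
    proof -
      have "(1/2::real)^m * ((1/2)^m) powr p \<le> (1/2)^n * ((1/2)^n) powr p"
        using that p by (intro mult_mono powr_mono2) (auto intro: power_decreasing)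
      then have "N (\<lambda>x. f x - fn m x) + N (\<lambda>x. f x - fn n x) \<le> 2 * ((1/2)^n * ((1/2)^n) powr p)"
        using fast(2)[of m] fast(2)[of n] by linarith
      then have "C * (2 powr p * (N (\<lambda>x. f x - fn m x) + N (\<lambda>x. f x - fn n x)))
          \<le> C * (2 powr p * (2 * ((1/2)^n * ((1/2)^n) powr p)))"
        by (intro mult_left_mono C) auto
      with N_R_diff[OF R[of m] R[of n] f] show ?thesis
        by (simp add: mult.assoc)
    qed
    have gn: "gn n \<in> Lp_space M p" for n
      using R_Lp[OF R[of n]] by simp
    have "0 \<le> C * (2 powr p * 2)"
      using C by simp
    from Lp_fast_Cauchy_convergent[OF p gn this cau[unfolded N_def]]
    obtain g where g: "g \<in> Lp_space M p" "(\<lambda>n. N (\<lambda>x. g x - gn n x)) \<longlonglongrightarrow> 0"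
      unfolding N_def by blast
    \<comment> \<open>Two approximating sequences of the same \<open>f\<close> have images that come
      together, by the bound on \<open>R\<close> applied to their difference; so the limit of the
      fast sequence serves for every other one.\<close>
    have "(\<lambda>n. N (\<lambda>x. g x - gn' n x)) \<longlonglongrightarrow> 0" if "approx f fn' gn'" for fn' gn'
    proof -
      have R': "(fn' n, gn' n) \<in> R" for n
        using that by (simp add: approx_def)
      have le: "N (\<lambda>x. g x - gn' n x) \<le> 2 powr p * (N (\<lambda>x. g x - gn n x)
          + C * (2 powr p * (N (\<lambda>x. f x - fn n x) + N (\<lambda>x. f x - fn' n x))))" for n
        using tri[OF g(1), of "gn n" "gn' n"] R_Lp[OF R[of n]] R_Lp[OF R'[of n]] N_R_diff[OF R[of n] R'[of n] f]
        by (smt (verit) mult_left_mono powr_ge_zero)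
      have "(\<lambda>n. 2 powr p * (N (\<lambda>x. g x - gn n x) + C * (2 powr p * (N (\<lambda>x. f x - fn n x) + N (\<lambda>x. f x - fn' n x)))))
          \<longlonglongrightarrow> 2 powr p * (0 + C * (2 powr p * (0 + 0)))"
        using fast(1) that g(2) by (intro tendsto_intros) (auto simp: approx_def)
      then have *: "(\<lambda>n. 2 powr p * (N (\<lambda>x. g x - gn n x) + C * (2 powr p * (N (\<lambda>x. f x - fn n x) + N (\<lambda>x. f x - fn' n x)))))
          \<longlonglongrightarrow> 0"
        by simp
      show ?thesis
        by (rule tendsto_sandwich[OF always_eventually always_eventually tendsto_const *]) (auto intro: le N_nonneg)
    qed
    then show ?thesis
      unfolding ext_def using g by blast
  qed
  define T where "T f = (SOME g. ext f g)" for f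
  have ext_T: "ext f (T f)" if "f \<in> Lp_space M p" for f
    unfolding T_def using ext_ex[OF that] by (rule someI_ex)
  have T_Lp: "T f \<in> Lp_space M p" if "f \<in> Lp_space M p" for f
    using ext_T[OF that] by (simp add: ext_def)
  have T_lim: "(\<lambda>n. N (\<lambda>x. T f x - gn n x)) \<longlonglongrightarrow> 0" if "f \<in> Lp_space M p" "approx f fn gn" for f fn gn
    using ext_T[OF that(1)] that(2) by (auto simp: ext_def)
  have T_eq: "AE x in M. T f x = g x"
    if "f \<in> Lp_space M p" "approx f fn gn" "g \<in> Lp_space M p" "(\<lambda>n. N (\<lambda>x. g x - gn n x)) \<longlonglongrightarrow> 0" for f fn gn g
    using that R_Lp T_Lp T_lim[OF that(1,2)] unfolding N_def approx_def
    by (intro Lp_modular_limit_unique[OF p, of "T f" M g gn]) blast+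
  have approx_ex: "\<exists>fn gn. approx f fn gn" if "f \<in> Lp_space M p" for f
    using approx_fast[OF that] by blast
  have sum_lim: "(\<lambda>n. N (\<lambda>x. (f x + g x) - (fn n x + gn n x))) \<longlonglongrightarrow> 0"
    if L: "f \<in> Lp_space M p" "g \<in> Lp_space M p" "\<And>n. fn n \<in> Lp_space M p" "\<And>n. gn n \<in> Lp_space M p"
      and lim: "(\<lambda>n. N (\<lambda>x. f x - fn n x)) \<longlonglongrightarrow> 0" "(\<lambda>n. N (\<lambda>x. g x - gn n x)) \<longlonglongrightarrow> 0" for f g fn gn
  proof -
    have le: "N (\<lambda>x. (f x + g x) - (fn n x + gn n x)) \<le> 2 powr p * (N (\<lambda>x. f x - fn n x) + N (\<lambda>x. g x - gn n x))" for n
      using add_le[OF Lp_space_diff[OF p L(1) L(3)[of n]] Lp_space_diff[OF p L(2) L(4)[of n]]]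
      by (simp add: algebra_simps)
    have "(\<lambda>n. 2 powr p * (N (\<lambda>x. f x - fn n x) + N (\<lambda>x. g x - gn n x))) \<longlonglongrightarrow> 2 powr p * (0 + 0)"
      by (intro tendsto_intros lim)
    then have *: "(\<lambda>n. 2 powr p * (N (\<lambda>x. f x - fn n x) + N (\<lambda>x. g x - gn n x))) \<longlonglongrightarrow> 0"
      by simp
    show ?thesis
      by (rule tendsto_sandwich[OF always_eventually always_eventually tendsto_const *]) (auto intro: le N_nonneg)
  qed
  have cmult_lim: "(\<lambda>n. N (\<lambda>x. c * f x - c * fn n x)) \<longlonglongrightarrow> 0"
    if lim: "(\<lambda>n. N (\<lambda>x. f x - fn n x)) \<longlonglongrightarrow> 0" for c f fn
    using tendsto_mult_right_zero[OF lim, of "norm c powr p"]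
    by (simp add: N_def Lp_modular_cmult flip: right_diff_distrib)
  have "bounded_Lp_operator M p T"
    unfolding bounded_Lp_operator_def
  proof (intro conjI ballI allI impI)
    fix f assume f: "f \<in> Lp_space M p"
    show "T f \<in> Lp_space M p"
      using f by (rule T_Lp)
  next
    fix f g assume f: "f \<in> Lp_space M p" and g: "g \<in> Lp_space M p" and eq: "AE x in M. f x = g x"
    obtain fn gn where a: "approx f fn gn"
      using approx_ex[OF f] by blast
    have "N (\<lambda>x. f x - fn n x) = N (\<lambda>x. g x - fn n x)" for n
      unfolding N_def
    proof (rule Lp_modular_cong_AE)
      have "fn n \<in> Lp_space M p"
        using a R_Lp by (auto simp: approx_def)
      then show "(\<lambda>x. f x - fn n x) \<in> borel_measurable M" "(\<lambda>x. g x - fn n x) \<in> borel_measurable M"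
        using Lp_space_diff[OF p] f g Lp_spaceD(1) by blast+
    qed (use eq in auto)
    then have "approx g fn gn"
      using a by (simp add: approx_def)
    then show "AE x in M. T f x = T g x"
      by (intro T_eq[OF f a] T_Lp T_lim g)
  next
    fix f g assume f: "f \<in> Lp_space M p" and g: "g \<in> Lp_space M p"
    obtain fn fn' where a: "approx f fn fn'"
      using approx_ex[OF f] by blast
    obtain gn gn' where b: "approx g gn gn'"
      using approx_ex[OF g] by blast
    have L: "fn n \<in> Lp_space M p" "fn' n \<in> Lp_space M p" "gn n \<in> Lp_space M p" "gn' n \<in> Lp_space M p" for n
      using a b R_Lp by (auto simp: approx_def)
    have "approx (\<lambda>x. f x + g x) (\<lambda>n x. fn n x + gn n x) (\<lambda>n x. fn' n x + gn' n x)"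
      unfolding approx_def using a b by (auto intro!: R_add sum_lim f g L simp: approx_def)
    then show "AE x in M. T (\<lambda>y. f y + g y) x = T f x + T g x"
      by (rule T_eq[OF Lp_space_add[OF p f g]])
        (intro Lp_space_add p T_Lp f g sum_lim L T_lim[OF f a] T_lim[OF g b])+
  next
    fix c f assume f: "f \<in> Lp_space M p"
    obtain fn fn' where a: "approx f fn fn'"
      using approx_ex[OF f] by blast
    have "approx (\<lambda>x. c * f x) (\<lambda>n x. c * fn n x) (\<lambda>n x. c * fn' n x)"
      unfolding approx_def using a by (auto intro!: R_cmult cmult_lim simp: approx_def)
    then show "AE x in M. T (\<lambda>y. c * f y) x = c * T f x"
      by (rule T_eq[OF Lp_space_cmult[OF f]]) (intro Lp_space_cmult T_Lp f cmult_lim T_lim[OF f a])+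
  next
    \<comment> \<open>One factor \<open>2 powr p\<close> is the cost of passing from
      \<open>T f\<close> to \<open>gn n\<close>, the other of passing from \<open>fn n\<close> back
      to \<open>f\<close>; the two errors vanish in the limit.\<close>
    define B where "B = 2 powr p * (C * 2 powr p)"
    have B: "0 \<le> B"
      using C by (simp add: B_def)
    have "Lp_norm M p (T f) \<le> B powr (1 / p) * Lp_norm M p f" if f: "f \<in> Lp_space M p" for f
    proof -
      obtain fn gn where a: "approx f fn gn"
        using approx_ex[OF f] by blast
      then have R: "(fn n, gn n) \<in> R" for n
        by (simp add: approx_def)
      have le: "N (T f) \<le> 2 powr p * (N (\<lambda>x. T f x - gn n x) + C * (2 powr p * (N (\<lambda>x. f x - fn n x) + N f)))" for n
      proof -
        have "N (fn n) \<le> 2 powr p * (N (\<lambda>x. f x - fn n x) + N f)"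
          using add_le[of "\<lambda>x. fn n x - f x" f] Lp_space_diff[OF p, of "fn n" _ f] R_Lp[OF R[of n]] f
          by (simp add: comm[of "fn n" f])
        then have "C * N (fn n) \<le> C * (2 powr p * (N (\<lambda>x. f x - fn n x) + N f))"
          by (rule mult_left_mono[OF _ C])
        moreover have "N (gn n) \<le> C * N (fn n)"
          using R_bound[OF R[of n]] by (simp add: N_def)
        moreover have "N (T f) \<le> 2 powr p * (N (\<lambda>x. T f x - gn n x) + N (gn n))"
          using add_le[of "\<lambda>x. T f x - gn n x" "gn n"] Lp_space_diff[OF p T_Lp[OF f], of "gn n"] R_Lp[OF R[of n]]
          by simp
        ultimately show ?thesis
          by (smt (verit) mult_left_mono powr_ge_zero)
      qed
      have lim: "(\<lambda>n. 2 powr p * (N (\<lambda>x. T f x - gn n x) + C * (2 powr p * (N (\<lambda>x. f x - fn n x) + N f))))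
          \<longlonglongrightarrow> 2 powr p * (0 + C * (2 powr p * (0 + N f)))"
        using a by (intro tendsto_intros T_lim[OF f a]) (auto simp: approx_def)
      have "N (T f) \<le> 2 powr p * (0 + C * (2 powr p * (0 + N f)))"
        by (rule LIMSEQ_le_const[OF lim]) (use le in blast)
      then have "N (T f) \<le> B * N f"
        by (simp add: B_def)
      then have "N (T f) powr (1 / p) \<le> (B * N f) powr (1 / p)"
        using p N_nonneg by (intro powr_mono2) auto
      also have "\<dots> = B powr (1 / p) * N f powr (1 / p)"
        by (rule powr_mult)
      finally show ?thesis
        by (simp add: Lp_norm_eq_modular N_def)
    qed
    then show "\<exists>C. \<forall>f\<in>Lp_space M p. Lp_norm M p (T f) \<le> C * Lp_norm M p f"
      by blast
  qed
  then show ?thesis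
    by (rule that) (use T_lim in \<open>auto simp: approx_def N_def\<close>)
qed

section \<open>Trigonometric polynomials on the torus\<close>

abbreviation mu :: "(complex \<times> complex) measure" where
  "mu \<equiv> hartogs_db_measure"

lemma in_hartogs_db_iff: "(z, w) \<in> hartogs_db \<longleftrightarrow> norm z = 1 \<and> norm w = 1"
  by (simp add: hartogs_db_def)

lemma compact_hartogs_db: "compact hartogs_db"
  unfolding hartogs_db_def by (intro compact_Times compact_sphere)

interpretation mu: finite_measure mu
  by standard (simp add: space_hartogs_db_measure emeasure_hartogs_db)

lemma measure_hartogs_db: "measure mu hartogs_db = 4 * pi\<^sup>2"
  by (simp add: measure_def emeasure_hartogs_db)

lemma borel_measurable_mu_continuous:
  fixes f :: "complex \<times> complex \<Rightarrow> 'b::topological_space"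
  assumes "continuous_on hartogs_db f"
  shows "f \<in> borel_measurable mu"
  using borel_measurable_continuous_on_restrict[OF assms]
  by (simp add: measurable_cong_sets[OF sets_hartogs_db_measure refl])

lemma integrable_mu_continuous:
  fixes f :: "complex \<times> complex \<Rightarrow> 'b::{banach, second_countable_topology}"
  assumes "continuous_on hartogs_db f"
  shows "integrable mu f"
proof -
  have "bounded (f ` hartogs_db)"
    using assms compact_hartogs_db by (intro compact_imp_bounded compact_continuous_image)
  then obtain B where "\<And>x. x \<in> hartogs_db \<Longrightarrow> norm (f x) \<le> B"
    by (auto simp: bounded_iff)
  then show ?thesis
    using assms by (intro mu.integrable_const_bound[of _ B] borel_measurable_mu_continuous)
      (auto simp: space_hartogs_db_measure)
qed

lemma continuous_on_torus_char: "continuous_on hartogs_db (torus_char j k)"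
  unfolding torus_char_def case_prod_beta
  by (intro continuous_intros) (auto simp: hartogs_db_def)

lemma norm_torus_char: "x \<in> hartogs_db \<Longrightarrow> norm (torus_char j k x) = 1"
  by (cases x) (simp add: in_hartogs_db_iff torus_char_def norm_mult norm_power_int)

lemma torus_char_mult:
  "x \<in> hartogs_db \<Longrightarrow> torus_char j k x * torus_char l m x = torus_char (j + l) (k + m) x"
proof (cases x)
  case (Pair z w)
  assume "x \<in> hartogs_db"
  then have "z \<noteq> 0" "w \<noteq> 0"
    using Pair by (auto simp: in_hartogs_db_iff)
  then show ?thesis
    by (simp add: Pair torus_char_def power_int_add)
qed

lemma inverse_unit_complex: "norm z = 1 \<Longrightarrow> inverse z = cnj z"
  using complex_norm_square[of z] by (intro inverse_unique) simp

lemma cnj_torus_char: "x \<in> hartogs_db \<Longrightarrow> cnj (torus_char j k x) = torus_char (- j) (- k) x"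
  using inverse_unit_complex[OF norm_torus_char, of x j k]
  by (simp add: torus_char_def case_prod_beta power_int_minus)

lemma set_integral_cis:
  "(\<integral>\<theta>. indicator {0..<2*pi} \<theta> *\<^sub>R cis (of_int j * \<theta>) \<partial>lborel) = (if j = 0 then 2 * pi else 0)"
proof -
  have [measurable]: "(\<lambda>\<theta>. cis (of_int j * \<theta>)) \<in> borel_measurable borel"
    by (intro borel_measurable_continuous_onI continuous_intros)
  have "(\<integral>\<theta>. indicator {0..<2*pi} \<theta> *\<^sub>R cis (of_int j * \<theta>) \<partial>lborel)
      = (\<integral>\<theta>. indicator {0..2*pi} \<theta> *\<^sub>R cis (of_int j * \<theta>) \<partial>lborel)"
    using AE_lborel_singleton[of "2*pi"]
    by (intro integral_cong_AE) (auto elim!: eventually_mono split: split_indicator)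
  also have "\<dots> = (if j = 0 then 2 * pi else 0)"
  proof (cases "j = 0")
    case False
    have "(\<integral>\<theta>. indicator {0..2*pi} \<theta> *\<^sub>R cis (of_int j * \<theta>) \<partial>lborel)
        = cis (of_int j * (2 * pi)) / (\<i> * of_int j) - cis (of_int j * 0) / (\<i> * of_int j)"
      using False
      by (intro integral_FTC_Icc)
        (auto intro!: derivative_eq_intros continuous_intros simp: has_vector_derivative_def field_simps scaleR_conv_of_real)
    moreover have "cis (of_int j * (2 * pi)) = 1"
      using cis_multiple_2pi[of "of_int j"] by (simp add: mult_ac)
    ultimately show ?thesis
      using False by simp
  qed (auto simp: scaleR_conv_of_real)
  finally show ?thesis .
qed

lemma integral_torus_char:
  "(\<integral>x. torus_char j k x \<partial>mu) = (if j = 0 \<and> k = 0 then 4 * pi\<^sup>2 else 0)"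
proof -
  let ?Q = "{0..<2*pi} \<times> {0..<2*pi}"
  let ?f = "\<lambda>(\<theta>, \<gamma>). cis (of_int j * \<theta>) * cis (of_int k * \<gamma>)"
  have Q: "?Q \<in> sets borel"
    by (simp add: borel_prod[symmetric])
  have mf: "?f \<in> borel_measurable borel"
    unfolding case_prod_beta by (intro borel_measurable_continuous_onI continuous_intros)
  have fin: "emeasure lborel ?Q < \<infinity>"
    by (subst lborel_prod[symmetric]) (simp add: lborel.emeasure_pair_measure_Times ennreal_mult_less_top)
  have int: "integrable (lborel \<Otimes>\<^sub>M lborel) (\<lambda>x. indicator ?Q x *\<^sub>R ?f x)"
    unfolding lborel_prod using Q mf fin
    by (intro integrableI_bounded_set_indicator[where B = 1]) (auto simp: norm_mult)
  have "(\<integral>x. torus_char j k x \<partial>mu) = (\<integral>x. torus_char j k (case x of (\<theta>, \<gamma>) \<Rightarrow> (cis \<theta>, cis \<gamma>)) \<partial>restrict_space lborel ?Q)"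
    unfolding hartogs_db_measure_def
    by (rule integral_distr[OF measurable_cis_pair borel_measurable_continuous_on_restrict[OF continuous_on_torus_char]])
  also have "\<dots> = (\<integral>x. ?f x \<partial>restrict_space lborel ?Q)"
    by (intro Bochner_Integration.integral_cong) (auto simp: torus_char_def cis_power_int)
  also have "\<dots> = (\<integral>x. indicator ?Q x *\<^sub>R ?f x \<partial>lborel)"
    using Q by (subst integral_restrict_space) auto
  also have "\<dots> = (\<integral>x. indicator ?Q x *\<^sub>R ?f x \<partial>(lborel \<Otimes>\<^sub>M lborel))"
    by (simp only: lborel_prod)
  also have "\<dots> = (\<integral>\<theta>. \<integral>\<gamma>. indicator ?Q (\<theta>, \<gamma>) *\<^sub>R ?f (\<theta>, \<gamma>) \<partial>lborel \<partial>lborel)"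
    by (rule lborel_pair.integral_fst'[OF int, symmetric])
  also have "\<dots> = (\<integral>\<theta>. \<integral>\<gamma>. (indicator {0..<2*pi} \<theta> *\<^sub>R cis (of_int j * \<theta>)) * (indicator {0..<2*pi} \<gamma> *\<^sub>R cis (of_int k * \<gamma>)) \<partial>lborel \<partial>lborel)"
    by (intro Bochner_Integration.integral_cong refl) (auto split: split_indicator)
  also have "\<dots> = (if j = 0 then 2 * pi else 0) * (if k = 0 then 2 * pi else 0)"
    by (simp only: integral_mult_right_zero integral_mult_left_zero set_integral_cis of_real_mult)
  also have "\<dots> = (if j = 0 \<and> k = 0 then 4 * pi\<^sup>2 else 0)"
    by (simp add: power2_eq_square)
  finally show ?thesis .
qed

section \<open>The algebra of trigonometric polynomials\<close>

definition trig_sum :: "(int \<times> int) set \<Rightarrow> (int \<times> int \<Rightarrow> complex) \<Rightarrow> complex \<times> complex \<Rightarrow> complex" where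
  "trig_sum F a x = (\<Sum>s\<in>F. a s * torus_char (fst s) (snd s) x)"

text \<open>Equality is required on the torus only: the real coordinates are Laurent polynomials
  just where \<open>inverse z = cnj z\<close>, and characters multiply like exponentials only away
  from zero coordinates.\<close>

definition trig_polys :: "(complex \<times> complex \<Rightarrow> complex) set" where
  "trig_polys = {f. \<exists>F a. finite F \<and> (\<forall>x\<in>hartogs_db. f x = trig_sum F a x)}"

lemma trig_sum_restrict: "finite F \<Longrightarrow> trig_sum (F \<inter> H) a = trig_sum F (\<lambda>s. if s \<in> H then a s else 0)"
  by (auto simp: trig_sum_def sum.inter_restrict fun_eq_iff intro!: sum.cong)

text \<open>Both sums are padded with zeros on the union of the index sets. The cut-off
  \<open>H\<close> is a parameter so that the same coefficients give additivity of the sums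
  (\<open>UNIV\<close>) and of their projections (\<open>hardy_index\<close>).\<close>

lemma trig_sum_Un_restrict:
  assumes "finite F" "finite G"
  shows "trig_sum ((F \<union> G) \<inter> H) (\<lambda>s. (if s \<in> F then a s else 0) + (if s \<in> G then b s else 0)) x
    = trig_sum (F \<inter> H) a x + trig_sum (G \<inter> H) b x"
proof -
  have sets: "(F \<union> G) \<inter> H \<inter> F = F \<inter> H" "(F \<union> G) \<inter> H \<inter> G = G \<inter> H"
    by auto
  have "trig_sum (F \<inter> H) a = trig_sum ((F \<union> G) \<inter> H) (\<lambda>s. if s \<in> F then a s else 0)"
    using assms trig_sum_restrict[of "(F \<union> G) \<inter> H" F a] by (simp only: sets finite_Un finite_Int simp_thms)
  moreover have "trig_sum (G \<inter> H) b = trig_sum ((F \<union> G) \<inter> H) (\<lambda>s. if s \<in> G then b s else 0)"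
    using assms trig_sum_restrict[of "(F \<union> G) \<inter> H" G b] by (simp only: sets finite_Un finite_Int simp_thms)
  ultimately show ?thesis
    by (simp add: trig_sum_def sum.distrib distrib_right)
qed

lemma trig_sum_scale: "trig_sum F (\<lambda>s. c * a s) x = c * trig_sum F a x"
  by (simp add: trig_sum_def sum_distrib_left mult.assoc)

lemma continuous_on_trig_sum: "continuous_on hartogs_db (trig_sum F a)"
  unfolding trig_sum_def by (intro continuous_intros continuous_on_torus_char)

lemma trig_polys_continuous: "f \<in> trig_polys \<Longrightarrow> continuous_on hartogs_db f"
  using continuous_on_trig_sum by (auto simp: trig_polys_def cong: continuous_on_cong)

lemma trig_polys_cmult:
  assumes "f \<in> trig_polys"
  shows "(\<lambda>x. c * f x) \<in> trig_polys"
proof -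
  from assms obtain F a where "finite F" "\<forall>x\<in>hartogs_db. f x = trig_sum F a x"
    by (auto simp: trig_polys_def)
  then show ?thesis
    unfolding trig_polys_def mem_Collect_eq
    by (intro exI[of _ F] exI[of _ "\<lambda>s. c * a s"]) (auto simp: trig_sum_scale)
qed

lemma trig_polys_add:
  assumes "f \<in> trig_polys" "g \<in> trig_polys"
  shows "(\<lambda>x. f x + g x) \<in> trig_polys"
proof -
  from assms obtain F a G b where "finite F" "\<forall>x\<in>hartogs_db. f x = trig_sum F a x"
    "finite G" "\<forall>x\<in>hartogs_db. g x = trig_sum G b x"
    by (auto simp: trig_polys_def)
  then show ?thesis
    unfolding trig_polys_def mem_Collect_eq
    using trig_sum_Un_restrict[of F G UNIV a b]
    by (intro exI[of _ "F \<union> G"] exI[of _ "\<lambda>s. (if s \<in> F then a s else 0) + (if s \<in> G then b s else 0)"]) simp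
qed

lemma trig_polys_char: "torus_char j k \<in> trig_polys"
  unfolding trig_polys_def by (auto intro!: exI[of _ "{(j, k)}"] exI[of _ "\<lambda>_. 1"] simp: trig_sum_def)

lemma trig_polys_sum: "(\<And>s. s \<in> F \<Longrightarrow> f s \<in> trig_polys) \<Longrightarrow> (\<lambda>x. \<Sum>s\<in>F. f s x) \<in> trig_polys"
proof (induction F rule: infinite_finite_induct)
  case (insert s F)
  then show ?case
    using trig_polys_add[of "f s" "\<lambda>x. \<Sum>s\<in>F. f s x"] by auto
qed (use trig_polys_cmult[OF trig_polys_char, of 0] in auto)

lemma trig_polys_cong: "f \<in> trig_polys \<Longrightarrow> (\<And>x. x \<in> hartogs_db \<Longrightarrow> f x = g x) \<Longrightarrow> g \<in> trig_polys"
  by (auto simp: trig_polys_def)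

lemma trig_polys_mult:
  assumes "f \<in> trig_polys" "g \<in> trig_polys"
  shows "(\<lambda>x. f x * g x) \<in> trig_polys"
proof -
  from assms obtain F a G b where fg: "\<And>x. x \<in> hartogs_db \<Longrightarrow> f x = trig_sum F a x"
    "\<And>x. x \<in> hartogs_db \<Longrightarrow> g x = trig_sum G b x"
    by (auto simp: trig_polys_def)
  have "(\<lambda>x. \<Sum>s\<in>F. \<Sum>t\<in>G. (a s * b t) * torus_char (fst s + fst t) (snd s + snd t) x) \<in> trig_polys"
    by (intro trig_polys_sum trig_polys_cmult trig_polys_char)
  then show ?thesis
    by (rule trig_polys_cong)
      (simp add: fg trig_sum_def sum_product torus_char_mult[symmetric] mult_ac)
qed

lemma trig_polys_const: "(\<lambda>x. c) \<in> trig_polys"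
  using trig_polys_cmult[OF trig_polys_char[of 0 0], of c] by (simp add: torus_char_def case_prod_beta)

lemma unit_circle_Re_Im:
  assumes "norm z = 1"
  shows "of_real (Re z) = (1 / 2) * z + (1 / 2) * inverse z"
    and "of_real (Im z) = (- \<i> / 2) * z + (\<i> / 2) * inverse z"
proof -
  have "inverse z = cnj z"
    using assms by (rule inverse_unit_complex)
  then show "of_real (Re z) = (1 / 2) * z + (1 / 2) * inverse z"
    "of_real (Im z) = (- \<i> / 2) * z + (\<i> / 2) * inverse z"
    by (auto simp: complex_eq_iff)
qed

lemma trig_polys_coordinates:
  "(\<lambda>x. of_real (Re (fst x))) \<in> trig_polys" "(\<lambda>x. of_real (Im (fst x))) \<in> trig_polys"
  "(\<lambda>x. of_real (Re (snd x))) \<in> trig_polys" "(\<lambda>x. of_real (Im (snd x))) \<in> trig_polys"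
proof -
  have lin: "(\<lambda>x. c * torus_char j k x + d * torus_char j' k' x) \<in> trig_polys" for c d j k j' k'
    by (intro trig_polys_add trig_polys_cmult trig_polys_char)
  show "(\<lambda>x. of_real (Re (fst x))) \<in> trig_polys"
    by (rule trig_polys_cong[OF lin[of "1/2" 1 0 "1/2" "-1" 0]])
      (auto simp: torus_char_def hartogs_db_def unit_circle_Re_Im power_int_minus)
  show "(\<lambda>x. of_real (Im (fst x))) \<in> trig_polys"
    by (rule trig_polys_cong[OF lin[of "- \<i> / 2" 1 0 "\<i> / 2" "-1" 0]])
      (auto simp: torus_char_def hartogs_db_def unit_circle_Re_Im power_int_minus)
  show "(\<lambda>x. of_real (Re (snd x))) \<in> trig_polys"
    by (rule trig_polys_cong[OF lin[of "1/2" 0 1 "1/2" 0 "-1"]])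
      (auto simp: torus_char_def hartogs_db_def unit_circle_Re_Im power_int_minus)
  show "(\<lambda>x. of_real (Im (snd x))) \<in> trig_polys"
    by (rule trig_polys_cong[OF lin[of "- \<i> / 2" 0 1 "\<i> / 2" 0 "-1"]])
      (auto simp: torus_char_def hartogs_db_def unit_circle_Re_Im power_int_minus)
qed

text \<open>The input to Stone-Weierstrass. Real polynomials on the ambient four-dimensional real
  space are generated by the four real coordinates, which are trigonometric polynomials on the
  torus, and these form an algebra.\<close>

lemma trig_polys_real_polynomial:
  "real_polynomial_function g \<Longrightarrow> (\<lambda>x. of_real (g x)) \<in> trig_polys"
proof (induction g rule: real_polynomial_function.induct)
  case (linear g)
  interpret bounded_linear g by fact
  have g: "g x = g (1, 0) * Re (fst x) + g (\<i>, 0) * Im (fst x) + g (0, 1) * Re (snd x) + g (0, \<i>) * Im (snd x)" for x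
  proof -
    have "x = Re (fst x) *\<^sub>R (1, 0) + Im (fst x) *\<^sub>R (\<i>, 0) + Re (snd x) *\<^sub>R (0, 1) + Im (snd x) *\<^sub>R (0, \<i>)"
      by (simp add: prod_eq_iff complex_eq_iff)
    then have "g x = g (Re (fst x) *\<^sub>R (1, 0) + Im (fst x) *\<^sub>R (\<i>, 0) + Re (snd x) *\<^sub>R (0, 1) + Im (snd x) *\<^sub>R (0, \<i>))"
      by (rule arg_cong)
    then show ?thesis
      by (simp only: add scaleR) simp
  qed
  have "(\<lambda>x. of_real (g (1, 0)) * of_real (Re (fst x)) + of_real (g (\<i>, 0)) * of_real (Im (fst x))
      + of_real (g (0, 1)) * of_real (Re (snd x)) + of_real (g (0, \<i>)) * of_real (Im (snd x))) \<in> trig_polys"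
    by (intro trig_polys_add trig_polys_cmult trig_polys_coordinates)
  then show ?case
    by (rule trig_polys_cong) (subst g, simp)
qed (auto intro: trig_polys_const trig_polys_add trig_polys_mult)

section \<open>Density of trigonometric polynomials, uniformly and in L^p\<close>

lemma trig_polys_uniformly_dense:
  assumes f: "continuous_on hartogs_db f" and "0 < e"
  obtains g where "g \<in> trig_polys" and "\<And>x. x \<in> hartogs_db \<Longrightarrow> norm (f x - g x) < e"
proof -
  obtain u where u: "real_polynomial_function u" "\<And>x. x \<in> hartogs_db \<Longrightarrow> \<bar>Re (f x) - u x\<bar> < e / 2"
    using Stone_Weierstrass_real_polynomial_function[OF compact_hartogs_db, of "\<lambda>x. Re (f x)" "e / 2"] f \<open>0 < e\<close>
    by (auto intro: continuous_intros)
  obtain v where v: "real_polynomial_function v" "\<And>x. x \<in> hartogs_db \<Longrightarrow> \<bar>Im (f x) - v x\<bar> < e / 2"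
    using Stone_Weierstrass_real_polynomial_function[OF compact_hartogs_db, of "\<lambda>x. Im (f x)" "e / 2"] f \<open>0 < e\<close>
    by (auto intro: continuous_intros)
  show ?thesis
  proof
    show "(\<lambda>x. of_real (u x) + \<i> * of_real (v x)) \<in> trig_polys"
      using u v by (intro trig_polys_add trig_polys_cmult trig_polys_real_polynomial)
    fix x assume x: "x \<in> hartogs_db"
    show "norm (f x - (of_real (u x) + \<i> * of_real (v x))) < e"
      using cmod_le[of "f x - (of_real (u x) + \<i> * of_real (v x))"] u(2)[OF x] v(2)[OF x] by simp
  qed
qed

lemma Lp_space_mu_continuous:
  assumes "0 < p" "continuous_on hartogs_db f"
  shows "f \<in> Lp_space mu p"
proof -
  have "bounded (f ` hartogs_db)"
    using assms(2) compact_hartogs_db by (intro compact_imp_bounded compact_continuous_image)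
  then obtain B where "\<And>x. x \<in> hartogs_db \<Longrightarrow> norm (f x) \<le> B"
    by (auto simp: bounded_iff)
  then show ?thesis
    using assms by (intro mu.Lp_space_bounded[of _ _ B] borel_measurable_mu_continuous)
      (auto simp: space_hartogs_db_measure)
qed

lemma Lp_space_trig_sum: "0 < p \<Longrightarrow> trig_sum F a \<in> Lp_space mu p"
  by (intro Lp_space_mu_continuous continuous_on_trig_sum)

definition trig_closure :: "real \<Rightarrow> (complex \<times> complex \<Rightarrow> complex) set" where
  "trig_closure p = {f \<in> Lp_space mu p. \<forall>e>0. \<exists>g\<in>trig_polys. Lp_modular mu p (\<lambda>x. f x - g x) < e}"

lemma trig_polys_Lp: "0 < p \<Longrightarrow> f \<in> trig_polys \<Longrightarrow> f \<in> Lp_space mu p"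
  by (intro Lp_space_mu_continuous trig_polys_continuous)

context
  fixes p :: real
  assumes p: "0 < p"
begin

lemma trig_closure_limit:
  assumes f: "f \<in> Lp_space mu p" and u: "\<And>n. u n \<in> trig_closure p"
    and lim: "(\<lambda>n. Lp_modular mu p (\<lambda>x. f x - u n x)) \<longlonglongrightarrow> 0"
  shows "f \<in> trig_closure p"
  unfolding trig_closure_def
proof (intro CollectI conjI f allI impI)
  fix e :: real assume "0 < e"
  define d where "d = e / (2 * 2 powr p)"
  have d: "0 < d" "2 powr p * (d + d) = e"
    using \<open>0 < e\<close> by (simp_all add: d_def)
  obtain n where n: "Lp_modular mu p (\<lambda>x. f x - u n x) < d"
    using LIMSEQ_D[OF lim \<open>0 < d\<close>] by (auto simp: Lp_modular_nonneg)
  obtain g where g: "g \<in> trig_polys" "Lp_modular mu p (\<lambda>x. u n x - g x) < d"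
    using u[of n] \<open>0 < d\<close> by (auto simp: trig_closure_def)
  have "Lp_modular mu p (\<lambda>x. f x - g x)
      \<le> 2 powr p * (Lp_modular mu p (\<lambda>x. f x - u n x) + Lp_modular mu p (\<lambda>x. u n x - g x))"
    using u[of n] trig_polys_Lp[OF p g(1)] by (intro Lp_modular_triangle p f) (auto simp: trig_closure_def)
  also have "\<dots> < 2 powr p * (d + d)"
    using n g by (intro mult_strict_left_mono) auto
  finally show "\<exists>g\<in>trig_polys. Lp_modular mu p (\<lambda>x. f x - g x) < e"
    using g d by auto
qed

lemma trig_closure_continuous:
  assumes f: "continuous_on hartogs_db f"
  shows "f \<in> trig_closure p"
  unfolding trig_closure_def
proof (intro CollectI conjI allI impI)
  show "f \<in> Lp_space mu p"
    by (rule Lp_space_mu_continuous[OF p f])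
  fix e :: real assume "0 < e"
  \<comment> \<open>Chosen so that \<open>d powr p\<close> times the total mass
    \<open>4 * pi\<^sup>2\<close> is \<open>e / 2\<close>.\<close>
  define d where "d = (e / (8 * pi\<^sup>2)) powr (1 / p)"
  have d: "0 < d" "d powr p * (4 * pi\<^sup>2) < e"
    using \<open>0 < e\<close> p by (simp_all add: d_def powr_powr)
  obtain g where g: "g \<in> trig_polys" "\<And>x. x \<in> hartogs_db \<Longrightarrow> norm (f x - g x) < d"
    using trig_polys_uniformly_dense[OF f d(1)] by blast
  have "Lp_modular mu p (\<lambda>x. f x - g x) \<le> (\<integral>x. d powr p \<partial>mu)"
    unfolding Lp_modular_def
  proof (rule integral_mono)
    show "integrable mu (\<lambda>x. norm (f x - g x) powr p)"
      by (rule Lp_spaceD(2)[OF Lp_space_diff[OF p Lp_space_mu_continuous[OF p f] trig_polys_Lp[OF p g(1)]]])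
    show "norm (f x - g x) powr p \<le> d powr p" if "x \<in> space mu" for x
      using g(2)[of x] that p by (intro powr_mono2) (auto simp: space_hartogs_db_measure)
  qed simp
  also have "\<dots> = d powr p * (4 * pi\<^sup>2)"
    by (simp add: measure_hartogs_db space_hartogs_db_measure)
  finally show "\<exists>g\<in>trig_polys. Lp_modular mu p (\<lambda>x. f x - g x) < e"
    using g d by force
qed

lemma trig_closure_cong:
  assumes f: "f \<in> trig_closure p" and eq: "\<And>x. x \<in> hartogs_db \<Longrightarrow> f x = g x"
  shows "g \<in> trig_closure p"
proof (rule trig_closure_limit[of g "\<lambda>_. f"])
  have L: "f \<in> Lp_space mu p"
    using f by (simp add: trig_closure_def)
  have "g \<in> borel_measurable mu"
    using Lp_spaceD(1)[OF L] eq by (subst measurable_cong[of _ g f]) (auto simp: space_hartogs_db_measure)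
  moreover have "integrable mu (\<lambda>x. norm (g x) powr p)"
    using Lp_spaceD(2)[OF L] eq
    by (subst Bochner_Integration.integrable_cong[of _ _ _ "\<lambda>x. norm (f x) powr p"]) (auto simp: space_hartogs_db_measure)
  ultimately show "g \<in> Lp_space mu p"
    by (simp add: Lp_space_def)
  have "Lp_modular mu p (\<lambda>x. g x - f x) = Lp_modular mu p (\<lambda>x. 0)"
    using eq by (intro Lp_modular_cong) (auto simp: space_hartogs_db_measure)
  then show "(\<lambda>n. Lp_modular mu p (\<lambda>x. g x - f x)) \<longlonglongrightarrow> 0"
    by (simp add: Lp_modular_def)
qed (rule f)

lemma trig_closure_add:
  assumes "f \<in> trig_closure p" "g \<in> trig_closure p"
  shows "(\<lambda>x. f x + g x) \<in> trig_closure p"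
  unfolding trig_closure_def
proof (intro CollectI conjI allI impI)
  have L: "f \<in> Lp_space mu p" "g \<in> Lp_space mu p"
    using assms by (auto simp: trig_closure_def)
  show "(\<lambda>x. f x + g x) \<in> Lp_space mu p"
    by (rule Lp_space_add[OF p L])
  fix e :: real assume "0 < e"
  define d where "d = e / (2 * 2 powr p)"
  have d: "0 < d" "2 powr p * (d + d) = e"
    using \<open>0 < e\<close> by (simp_all add: d_def)
  obtain f' where f': "f' \<in> trig_polys" "Lp_modular mu p (\<lambda>x. f x - f' x) < d"
    using assms(1) d(1) by (auto simp: trig_closure_def)
  obtain g' where g': "g' \<in> trig_polys" "Lp_modular mu p (\<lambda>x. g x - g' x) < d"
    using assms(2) d(1) by (auto simp: trig_closure_def)
  have "Lp_modular mu p (\<lambda>x. (f x - f' x) + (g x - g' x))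
      \<le> 2 powr p * (Lp_modular mu p (\<lambda>x. f x - f' x) + Lp_modular mu p (\<lambda>x. g x - g' x))"
    by (intro Lp_modular_add_le Lp_space_diff p L trig_polys_Lp f' g')
  also have "\<dots> < 2 powr p * (d + d)"
    using f' g' by (intro mult_strict_left_mono) auto
  also note d(2)
  also have "(\<lambda>x. (f x - f' x) + (g x - g' x)) = (\<lambda>x. f x + g x - (f' x + g' x))"
    by (simp add: fun_eq_iff)
  finally have "Lp_modular mu p (\<lambda>x. f x + g x - (f' x + g' x)) < e" .
  then show "\<exists>h\<in>trig_polys. Lp_modular mu p (\<lambda>x. f x + g x - h x) < e"
    by (intro bexI[OF _ trig_polys_add[OF f'(1) g'(1)]])
qed

lemma trig_closure_cmult:
  assumes "f \<in> trig_closure p"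
  shows "(\<lambda>x. c * f x) \<in> trig_closure p"
proof (cases "c = 0")
  case True
  then show ?thesis
    using trig_closure_continuous[of "\<lambda>_. 0"] by simp
next
  case False
  show ?thesis
    unfolding trig_closure_def
  proof (intro CollectI conjI allI impI)
    show "(\<lambda>x. c * f x) \<in> Lp_space mu p"
      using assms by (intro Lp_space_cmult) (simp add: trig_closure_def)
    fix e :: real assume "0 < e"
    then have "0 < e / norm c powr p"
      using False by simp
    then obtain g where g: "g \<in> trig_polys" "Lp_modular mu p (\<lambda>x. f x - g x) < e / norm c powr p"
      using assms by (auto simp: trig_closure_def)
    have "Lp_modular mu p (\<lambda>x. c * f x - c * g x) = norm c powr p * Lp_modular mu p (\<lambda>x. f x - g x)"
      by (simp add: Lp_modular_cmult flip: right_diff_distrib)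
    also have "\<dots> < e"
      using g False by (simp add: pos_less_divide_eq mult.commute)
    finally show "\<exists>h\<in>trig_polys. Lp_modular mu p (\<lambda>x. c * f x - h x) < e"
      by (intro bexI[OF _ trig_polys_cmult[OF g(1), of c]])
  qed
qed

lemma trig_closure_sum: "(\<And>i. i \<in> I \<Longrightarrow> f i \<in> trig_closure p) \<Longrightarrow> (\<lambda>x. \<Sum>i\<in>I. f i x) \<in> trig_closure p"
proof (induction I rule: infinite_finite_induct)
  case (insert i I)
  then show ?case
    using trig_closure_add[of "f i" "\<lambda>x. \<Sum>i\<in>I. f i x"] by auto
qed (use trig_closure_continuous[of "\<lambda>_. 0"] in auto)

lemma trig_closure_dominated:
  assumes u: "\<And>n. u n \<in> trig_closure p" and f: "f \<in> borel_measurable mu"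
    and w: "integrable mu (\<lambda>x. w x powr p)" "\<And>n x. x \<in> hartogs_db \<Longrightarrow> norm (u n x) \<le> w x"
    and lim: "\<And>x. x \<in> hartogs_db \<Longrightarrow> (\<lambda>n. u n x) \<longlonglongrightarrow> f x"
  shows "f \<in> trig_closure p"
proof -
  have "u n \<in> borel_measurable mu" for n
    using u[of n] by (auto simp: trig_closure_def intro: Lp_spaceD)
  note dom = mu.Lp_modular_dominated_convergence[OF p f this w(1), unfolded space_hartogs_db_measure, OF w(2) lim]
  show ?thesis
    by (rule trig_closure_limit[OF dom(1) u dom(3)])
qed

text \<open>Dynkin's argument in the ambient space: open sets are stable under intersection, and the
  sets with indicator in the closure are stable under complements and countable disjoint unions. The
  indicator of an open \<open>U\<close> is the limit of the continuous functions
  \<open>min 1 (n * infdist x (- U))\<close>.\<close>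

lemma trig_closure_indicator_borel:
  assumes "B \<in> sets borel"
  shows "(\<lambda>x. indicator B x) \<in> trig_closure p"
proof -
  have meas: "(\<lambda>x. indicator A x :: complex) \<in> borel_measurable mu" if "A \<in> sets borel" for A
  proof -
    have "(\<lambda>x. x) \<in> measurable mu borel"
      by (intro borel_measurable_mu_continuous continuous_intros)
    then show ?thesis
      by (rule measurable_compose) (use that in measurable)
  qed
  have "Int_stable {S :: (complex \<times> complex) set. open S}" "{S. open S} \<subseteq> Pow UNIV"
    "B \<in> sigma_sets UNIV {S. open S}"
    using assms by (auto simp: Int_stable_def borel_def)
  then show ?thesis
  proof (induction B rule: sigma_sets_induct_disjoint)
    case (basic U)
    then have U: "open U"
      by simp
    show ?case
    \<comment> \<open>The whole space is separate because \<open>infdist\<close> to the empty set is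
      0 by convention, so the approximating functions would vanish.\<close>
    proof (cases "U = UNIV")
      case True
      then show ?thesis
        using trig_closure_continuous[of "\<lambda>_. 1"] by (simp add: indicator_def)
    next
      case False
      show ?thesis
      proof (rule trig_closure_dominated[of "\<lambda>n x. of_real (min 1 (real n * infdist x (- U)))" _ "\<lambda>_. 1"])
        fix n
        show "(\<lambda>x. complex_of_real (min 1 (real n * infdist x (- U)))) \<in> trig_closure p"
          by (intro trig_closure_continuous continuous_intros)
        show "norm (complex_of_real (min 1 (real n * infdist x (- U)))) \<le> 1" for x
          by (simp add: infdist_nonneg)
      next
        fix x
        show "(\<lambda>n. complex_of_real (min 1 (real n * infdist x (- U)))) \<longlonglongrightarrow> indicator U x"
        proof (cases "x \<in> U")
          case True
          then have "0 < infdist x (- U)"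
            using U False by (intro infdist_pos_not_in_closed) auto
          then obtain N where N: "1 < real N * infdist x (- U)"
            using reals_Archimedean3 by blast
          have "1 \<le> real n * infdist x (- U)" if "N \<le> n" for n
          proof -
            have "real N * infdist x (- U) \<le> real n * infdist x (- U)"
              using that by (intro mult_right_mono infdist_nonneg) simp
            with N show ?thesis by linarith
          qed
          then have "\<forall>\<^sub>F n in sequentially. complex_of_real (min 1 (real n * infdist x (- U))) = 1"
            unfolding eventually_sequentially by (intro exI[of _ N]) (simp add: min_def)
          then show ?thesis
            using True by (simp add: tendsto_eventually)
        qed simp
      qed (use U in \<open>auto intro: meas\<close>)
    qed
  next
    case empty
    then show ?case
      using trig_closure_continuous[of "\<lambda>_. 0"] by simp
  next
    case (compl A)
    have "(\<lambda>x. 1 + (- 1) * indicator A x) \<in> trig_closure p"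
      by (intro trig_closure_add trig_closure_cmult compl trig_closure_continuous continuous_intros)
    then show ?case
      by (rule trig_closure_cong) (auto split: split_indicator)
  next
    case (union A)
    show ?case
    proof (rule trig_closure_dominated[of "\<lambda>n x. indicator (\<Union>i<n. A i) x" _ "\<lambda>_. 1"])
      fix n
      have "(\<lambda>x. indicator (\<Union>i<n. A i) x :: complex) = (\<lambda>x. \<Sum>i<n. indicator (A i) x)"
        using union(1) by (intro ext indicator_UN_disjoint) (auto simp: disjoint_family_on_def)
      then show "(\<lambda>x. indicator (\<Union>i<n. A i) x) \<in> trig_closure p"
        using union by (auto intro: trig_closure_sum)
      show "norm (indicator (\<Union>i<n. A i) x :: complex) \<le> 1" for x
        by (simp split: split_indicator)
    next
      have "A i \<in> sets borel" for i
        using union(2) by (auto simp: borel_def)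
      then show "(\<lambda>x. indicator (\<Union> (range A)) x :: complex) \<in> borel_measurable mu"
        by (intro meas) auto
    qed (auto intro: LIMSEQ_indicator_UN)
  qed
qed

lemma trig_closure_eq_Lp: "trig_closure p = Lp_space mu p"
proof
  show "Lp_space mu p \<subseteq> trig_closure p"
  proof
    fix f assume f: "f \<in> Lp_space mu p"
    \<comment> \<open>With base point 0 the approximating simple functions are dominated by
      \<open>2 * norm (f x)\<close>, whose p-th power is integrable.\<close>
    from borel_measurable_implies_sequence_metric[OF Lp_spaceD(1)[OF f], of 0] obtain s where
      s: "\<And>i. simple_function mu (s i)" "\<And>i x. x \<in> hartogs_db \<Longrightarrow> norm (s i x) \<le> 2 * norm (f x)"
        "\<And>x. x \<in> hartogs_db \<Longrightarrow> (\<lambda>i. s i x) \<longlonglongrightarrow> f x"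
      unfolding space_hartogs_db_measure dist_0_norm dist_commute[of _ 0] by blast
    show "f \<in> trig_closure p"
    proof (rule trig_closure_dominated[of s _ "\<lambda>x. 2 * norm (f x)"])
      fix i
      have ind: "(\<lambda>x. indicator (s i -` {y} \<inter> space mu) x) \<in> trig_closure p" for y
      proof -
        have "s i -` {y} \<inter> space mu \<in> sets mu"
          using s(1)[of i] by (rule simple_functionD)
        then obtain B where "B \<in> sets borel" "s i -` {y} \<inter> space mu = B \<inter> hartogs_db"
          by (auto simp: sets_hartogs_db_measure sets_restrict_space)
        then show ?thesis
          by (intro trig_closure_cong[OF trig_closure_indicator_borel[of B]]) (auto split: split_indicator)
      qed
      have "(\<lambda>x. \<Sum>y\<in>s i ` space mu. y * indicator (s i -` {y} \<inter> space mu) x) \<in> trig_closure p"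
        by (intro trig_closure_sum trig_closure_cmult ind)
      then show "s i \<in> trig_closure p"
      proof (rule trig_closure_cong)
        fix x assume "x \<in> hartogs_db"
        then have "s i x = (\<Sum>y\<in>s i ` space mu. indicator (s i -` {y} \<inter> space mu) x *\<^sub>R y)"
          by (intro simple_function_indicator_representation_banach s(1)) (simp add: space_hartogs_db_measure)
        also have "\<dots> = (\<Sum>y\<in>s i ` space mu. y * indicator (s i -` {y} \<inter> space mu) x)"
          by (intro sum.cong refl) (simp split: split_indicator)
        finally show "(\<Sum>y\<in>s i ` space mu. y * indicator (s i -` {y} \<inter> space mu) x) = s i x" ..
      qed
    next
      show "f \<in> borel_measurable mu"
        by (rule Lp_spaceD[OF f])
      show "integrable mu (\<lambda>x. (2 * norm (f x)) powr p)"
        unfolding powr_mult by (intro integrable_mult_right Lp_spaceD[OF f])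
    qed (fact s)+
  qed
qed (auto simp: trig_closure_def)

lemma trig_sum_dense_Lp:
  assumes "f \<in> Lp_space mu p" "0 < e"
  obtains F a where "finite F" "Lp_modular mu p (\<lambda>x. f x - trig_sum F a x) < e"
proof -
  obtain g where g: "g \<in> trig_polys" "Lp_modular mu p (\<lambda>x. f x - g x) < e"
    using assms unfolding trig_closure_eq_Lp[symmetric] by (auto simp: trig_closure_def)
  then obtain F a where F: "finite F" "\<And>x. x \<in> hartogs_db \<Longrightarrow> g x = trig_sum F a x"
    by (auto simp: trig_polys_def)
  have "Lp_modular mu p (\<lambda>x. f x - g x) = Lp_modular mu p (\<lambda>x. f x - trig_sum F a x)"
    using F by (intro Lp_modular_cong) (simp add: space_hartogs_db_measure)
  then show ?thesis
    using that F g by simp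
qed

end

section \<open>Transference to the torus\<close>

definition torus_rotate :: "complex \<Rightarrow> complex \<Rightarrow> complex \<times> complex \<Rightarrow> complex \<times> complex" where
  "torus_rotate u v = (\<lambda>(z, w). (z * u, w * v))"

lemma torus_rotate_in_hartogs_db:
  "norm u = 1 \<Longrightarrow> norm v = 1 \<Longrightarrow> x \<in> hartogs_db \<Longrightarrow> torus_rotate u v x \<in> hartogs_db"
  by (cases x) (simp add: torus_rotate_def in_hartogs_db_iff norm_mult)

lemma continuous_on_torus_rotate: "continuous_on S (torus_rotate u v)"
  unfolding torus_rotate_def case_prod_beta by (intro continuous_intros)

lemma torus_char_rotate: "torus_char j k (torus_rotate u v x) = torus_char j k x * torus_char j k (u, v)"
  by (cases x) (simp add: torus_char_def torus_rotate_def power_int_mult_distrib)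

lemma integral_trig_sum: "finite F \<Longrightarrow> (\<integral>x. trig_sum F a x \<partial>mu) = (\<Sum>s\<in>F. if s = (0, 0) then a s * (4 * pi\<^sup>2) else 0)"
  unfolding trig_sum_def
  by (subst Bochner_Integration.integral_sum)
    (auto intro!: integrable_mult_right integrable_mu_continuous continuous_intros continuous_on_torus_char sum.cong
      simp: integral_torus_char prod_eq_iff)

text \<open>A rotation multiplies each character by a constant, and only the trivial character,
  whose constant is 1, has a nonzero integral. So the claim is immediate for trigonometric
  polynomials and passes to continuous functions by uniform density, with no change of variables in
  the angles.\<close>

lemma integral_rotate:
  assumes uv: "norm u = 1" "norm v = 1" and f: "continuous_on hartogs_db f"
  shows "(\<integral>x. f (torus_rotate u v x) \<partial>mu) = (\<integral>x. f x \<partial>mu :: complex)"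
proof -
  have cr: "continuous_on hartogs_db (\<lambda>x. g (torus_rotate u v x))" if "continuous_on hartogs_db g" for g :: "_ \<Rightarrow> complex"
    using continuous_on_compose2[OF that continuous_on_torus_rotate] uv by (auto intro: torus_rotate_in_hartogs_db)
  have trig: "(\<integral>x. g (torus_rotate u v x) \<partial>mu) = (\<integral>x. g x \<partial>mu)" if g: "g \<in> trig_polys" for g
  proof -
    from g obtain F a where F: "finite F" "\<And>x. x \<in> hartogs_db \<Longrightarrow> g x = trig_sum F a x"
      by (auto simp: trig_polys_def)
    have "(\<integral>x. g (torus_rotate u v x) \<partial>mu) = (\<integral>x. trig_sum F (\<lambda>s. a s * torus_char (fst s) (snd s) (u, v)) x \<partial>mu)"
      using uv F by (intro Bochner_Integration.integral_cong)
        (auto simp: space_hartogs_db_measure torus_rotate_in_hartogs_db trig_sum_def torus_char_rotate mult_ac)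
    also have "\<dots> = (\<integral>x. trig_sum F a x \<partial>mu)"
      unfolding integral_trig_sum[OF F(1)] by (intro sum.cong) (auto simp: torus_char_def)
    also have "\<dots> = (\<integral>x. g x \<partial>mu)"
      using F by (intro Bochner_Integration.integral_cong) (auto simp: space_hartogs_db_measure)
    finally show ?thesis .
  qed
  have "norm ((\<integral>x. f (torus_rotate u v x) \<partial>mu) - (\<integral>x. f x \<partial>mu)) \<le> 0 + e" if "0 < e" for e
  proof -
    have "0 < e / (8 * pi\<^sup>2)"
      using that by simp
    then obtain g where g: "g \<in> trig_polys" "\<And>x. x \<in> hartogs_db \<Longrightarrow> norm (f x - g x) < e / (8 * pi\<^sup>2)"
      using trig_polys_uniformly_dense[OF f] by blast
    have cg: "continuous_on hartogs_db g"
      by (rule trig_polys_continuous[OF g(1)])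
    have bound: "norm (\<integral>x. h x \<partial>mu) \<le> e / 2"
      if h: "\<And>x. x \<in> hartogs_db \<Longrightarrow> norm (h x) < e / (8 * pi\<^sup>2)" "continuous_on hartogs_db h" for h :: "_ \<Rightarrow> complex"
    proof -
      have "norm (\<integral>x. h x \<partial>mu) \<le> (\<integral>x. norm (h x) \<partial>mu)"
        by (rule integral_norm_bound)
      also have "\<dots> \<le> (\<integral>x. e / (8 * pi\<^sup>2) \<partial>mu)"
        using h by (intro integral_mono integrable_mu_continuous continuous_intros)
          (auto simp: space_hartogs_db_measure intro: less_imp_le)
      also have "\<dots> = e / 2"
        by (simp add: measure_hartogs_db space_hartogs_db_measure)
      finally show ?thesis .
    qed
    have "(\<integral>x. f (torus_rotate u v x) \<partial>mu) - (\<integral>x. f x \<partial>mu)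
        = (\<integral>x. f (torus_rotate u v x) - g (torus_rotate u v x) \<partial>mu) - (\<integral>x. f x - g x \<partial>mu)"
      using trig[OF g(1)] by (simp add: integrable_mu_continuous cr f cg)
    also have "norm \<dots> \<le> norm (\<integral>x. f (torus_rotate u v x) - g (torus_rotate u v x) \<partial>mu) + norm (\<integral>x. f x - g x \<partial>mu)"
      by (rule norm_triangle_ineq4)
    also have "\<dots> \<le> e / 2 + e / 2"
      by (intro add_mono bound continuous_intros cr f cg g(2) torus_rotate_in_hartogs_db uv)
    finally show ?thesis
      by simp
  qed
  then have "norm ((\<integral>x. f (torus_rotate u v x) \<partial>mu) - (\<integral>x. f x \<partial>mu)) \<le> 0"
    by (rule field_le_epsilon)
  then show ?thesis
    by simp
qed

lemma Lp_modular_rotate: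
  assumes uv: "norm u = 1" "norm v = 1" and p: "0 < p" and f: "continuous_on hartogs_db f"
  shows "Lp_modular mu p (\<lambda>x. f (torus_rotate u v x)) = Lp_modular mu p f"
proof -
  have "continuous_on hartogs_db (\<lambda>x. complex_of_real (norm (f x) powr p))"
    by (intro continuous_intros continuous_on_norm_powr f p)
  from integral_rotate[OF uv this] show ?thesis
    by (simp add: Lp_modular_def)
qed

text \<open>
  Restricting \<open>f\<close> to the orbits of the one-parameter group of rotations \<open>(e\<^bsup>i \<alpha> \<theta>\<^esup>, e\<^bsup>i \<beta> \<theta>\<^esup>)\<close> turns
  the projection onto a half-plane of frequencies into the one-dimensional Riesz projection.
\<close>

lemma half_plane_projection_bound:
  fixes n :: "int \<times> int \<Rightarrow> int"
  assumes p: "1 < p" and n: "\<And>j k. n (j, k) = \<alpha> * j + \<beta> * k + \<kappa>" and n0: "\<And>s. n s \<noteq> 0"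
  obtains C where "0 \<le> C" and "\<And>F a. finite F \<Longrightarrow>
    Lp_modular mu p (trig_sum (F \<inter> {s. 0 < n s}) a) \<le> C * Lp_modular mu p (trig_sum F a)"
proof -
  obtain C where C: "0 \<le> C" and riesz: "\<And>(F :: (int \<times> int) set) b m. finite F \<Longrightarrow> (\<And>s. s \<in> F \<Longrightarrow> (m s :: int) \<noteq> 0) \<Longrightarrow>
    integral {0..2*pi} (\<lambda>\<theta>. norm (\<Sum>s\<in>F \<inter> {s. 0 < m s}. b s * cis (of_int (m s) * \<theta>)) powr p)
      \<le> C * integral {0..2*pi} (\<lambda>\<theta>. norm (\<Sum>s\<in>F. b s * cis (of_int (m s) * \<theta>)) powr p)"
    using riesz_projection_circle[OF p] by blast
  define L where "L = restrict_space lborel {0..2*pi::real}"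
  have mL: "(\<lambda>\<theta>. cis (c * \<theta>)) \<in> borel_measurable L" for c
  proof -
    have "(\<lambda>\<theta>. cis (c * \<theta>)) \<in> borel_measurable borel"
      by (intro borel_measurable_continuous_onI continuous_intros)
    then show ?thesis
      unfolding L_def by (intro measurable_restrict_space1) simp
  qed
  interpret L: finite_measure L
    by (rule finite_measureI) (simp add: L_def emeasure_restrict_space space_restrict_space)
  have measure_L: "measure L (space L) = 2 * pi"
    by (simp add: L_def space_restrict_space measure_restrict_space)
  interpret pair: pair_sigma_finite mu L ..
  interpret pair: finite_measure "mu \<Otimes>\<^sub>M L"
    by (rule finite_measure_pair_measure) unfold_locales
  have integral_L: "(\<integral>\<theta>. h \<theta> \<partial>L) = integral {0..2*pi} h" if "continuous_on {0..2*pi} h" for h :: "real \<Rightarrow> real"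
    using set_borel_integral_eq_integral(2)[OF borel_integrable_atLeastAtMost'[OF that]]
    by (simp add: L_def integral_restrict_space set_lebesgue_integral_def)
  \<comment> \<open>Up to the factor \<open>cis (\<kappa> * \<theta>)\<close>, this is the
    trigonometric sum along the orbit of \<open>x\<close>: a one-variable sum with coefficients
    \<open>a s * torus_char (fst s) (snd s) x\<close> and frequencies \<open>n s\<close>.\<close>
  define G where "G F a x \<theta> = (\<Sum>s\<in>F. (a s * torus_char (fst s) (snd s) x) * cis (of_int (n s) * \<theta>))"
    for F and a :: "int \<times> int \<Rightarrow> complex" and x and \<theta> :: real
  have contG: "continuous_on S (\<lambda>\<theta>. norm (G F a x \<theta>) powr p)" for S F a x
    unfolding G_def using p by (intro continuous_on_norm_powr continuous_intros) auto
  have intG: "integrable (mu \<Otimes>\<^sub>M L) (\<lambda>(x, \<theta>). norm (G F a x \<theta>) powr p)" for F a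
  proof (rule pair.integrable_const_bound[of _ "(\<Sum>s\<in>F. norm (a s)) powr p"])
    have "norm (G F a x \<theta>) \<le> (\<Sum>s\<in>F. norm (a s))" if "x \<in> hartogs_db" for x \<theta>
      unfolding G_def by (rule order_trans[OF norm_sum]) (simp add: norm_mult norm_torus_char[OF that])
    then show "AE y in mu \<Otimes>\<^sub>M L. norm (case y of (x, \<theta>) \<Rightarrow> norm (G F a x \<theta>) powr p) \<le> (\<Sum>s\<in>F. norm (a s)) powr p"
      using p by (auto intro!: AE_I2 powr_mono2 simp: space_pair_measure space_hartogs_db_measure)
    have [measurable]: "torus_char j k \<in> borel_measurable mu" for j k
      by (intro borel_measurable_mu_continuous continuous_on_torus_char)
    note [measurable] = mL
    show "(\<lambda>(x, \<theta>). norm (G F a x \<theta>) powr p) \<in> borel_measurable (mu \<Otimes>\<^sub>M L)"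
      unfolding G_def by measurable
  qed
  \<comment> \<open>For fixed \<theta> the shift \<kappa> contributes a factor of modulus 1 and the
    rest is a rotation of the torus, so the value is independent of \<theta>.\<close>
  have slice: "(\<integral>x. norm (G F a x \<theta>) powr p \<partial>mu) = Lp_modular mu p (trig_sum F a)" for F a \<theta>
  proof -
    have "norm (G F a x \<theta>) = norm (trig_sum F a (torus_rotate (cis (of_int \<alpha> * \<theta>)) (cis (of_int \<beta> * \<theta>)) x))" for x
    proof -
      have "G F a x \<theta> = cis (of_int \<kappa> * \<theta>) * trig_sum F a (torus_rotate (cis (of_int \<alpha> * \<theta>)) (cis (of_int \<beta> * \<theta>)) x)"
        unfolding G_def trig_sum_def sum_distrib_left
      proof (intro sum.cong refl)
        fix s :: "int \<times> int"
        obtain j k where s: "s = (j, k)"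
          by (cases s)
        have "cis (of_int (n s) * \<theta>) = cis (of_int \<kappa> * \<theta>) * torus_char j k (cis (of_int \<alpha> * \<theta>), cis (of_int \<beta> * \<theta>))"
          by (simp add: s n torus_char_def cis_power_int cis_mult algebra_simps)
        then show "a s * torus_char (fst s) (snd s) x * cis (of_int (n s) * \<theta>) =
          cis (of_int \<kappa> * \<theta>) * (a s * torus_char (fst s) (snd s) (torus_rotate (cis (of_int \<alpha> * \<theta>)) (cis (of_int \<beta> * \<theta>)) x))"
          by (simp add: s torus_char_rotate)
      qed
      then show ?thesis
        by (simp add: norm_mult)
    qed
    then have "(\<integral>x. norm (G F a x \<theta>) powr p \<partial>mu)
        = Lp_modular mu p (\<lambda>x. trig_sum F a (torus_rotate (cis (of_int \<alpha> * \<theta>)) (cis (of_int \<beta> * \<theta>)) x))"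
      by (simp add: Lp_modular_def)
    also have "\<dots> = Lp_modular mu p (trig_sum F a)"
      using p by (intro Lp_modular_rotate continuous_on_trig_sum) auto
    finally show ?thesis .
  qed
  \<comment> \<open>Averaging over \<theta> trades the norm on the torus for an integral of
    one-variable norms, to which the circle inequality applies for each \<open>x\<close> with the
    same constant.\<close>
  have fubini: "2 * pi * Lp_modular mu p (trig_sum F a) = (\<integral>x. integral {0..2*pi} (\<lambda>\<theta>. norm (G F a x \<theta>) powr p) \<partial>mu)" for F a
  proof -
    have "(\<integral>\<theta>. (\<integral>x. norm (G F a x \<theta>) powr p \<partial>mu) \<partial>L) = 2 * pi * Lp_modular mu p (trig_sum F a)"
      unfolding slice by (simp add: measure_L)
    then show ?thesis
      using pair.Fubini_integral[OF intG[of F a]] by (simp add: integral_L[OF contG])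
  qed
  have int: "integrable mu (\<lambda>x. integral {0..2*pi} (\<lambda>\<theta>. norm (G F a x \<theta>) powr p))" for F a
    using pair.integrable_fst'[OF intG[of F a]] by (simp add: integral_L[OF contG])
  show ?thesis
  proof (rule that[OF C])
    fix F a assume F: "finite (F :: (int \<times> int) set)"
    have "2 * pi * Lp_modular mu p (trig_sum (F \<inter> {s. 0 < n s}) a)
        \<le> (\<integral>x. C * integral {0..2*pi} (\<lambda>\<theta>. norm (G F a x \<theta>) powr p) \<partial>mu)"
      unfolding fubini using riesz[OF F, of n] n0
      by (intro integral_mono int integrable_mult_right) (simp add: G_def)
    also have "\<dots> = 2 * pi * (C * Lp_modular mu p (trig_sum F a))"
      using fubini[of F a] by simp
    finally show "Lp_modular mu p (trig_sum (F \<inter> {s. 0 < n s}) a) \<le> C * Lp_modular mu p (trig_sum F a)"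
      by simp
  qed
qed

text \<open>Cutting by one form and then by the other keeps the coefficients, so the second
  half-plane bound applies to the sum already cut by the first, and the constants multiply.\<close>

lemma hardy_projection_bound:
  assumes p: "1 < p"
  obtains C where "0 \<le> C" and "\<And>F a. finite F \<Longrightarrow>
    Lp_modular mu p (trig_sum (F \<inter> hardy_index) a) \<le> C * Lp_modular mu p (trig_sum F a)"
proof -
  define n1 n2 :: "int \<times> int \<Rightarrow> int" where "n1 = (\<lambda>(j, k). 2 * j + 1)" and "n2 = (\<lambda>(j, k). 2 * j + 2 * k + 3)"
  obtain C1 where C1: "0 \<le> C1" "\<And>F a. finite F \<Longrightarrow>
    Lp_modular mu p (trig_sum (F \<inter> {s. 0 < n1 s}) a) \<le> C1 * Lp_modular mu p (trig_sum F a)"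
    by (rule half_plane_projection_bound[OF p, of n1 2 0 1]) (auto simp: n1_def, presburger)
  obtain C2 where C2: "0 \<le> C2" "\<And>F a. finite F \<Longrightarrow>
    Lp_modular mu p (trig_sum (F \<inter> {s. 0 < n2 s}) a) \<le> C2 * Lp_modular mu p (trig_sum F a)"
    by (rule half_plane_projection_bound[OF p, of n2 2 2 3]) (auto simp: n2_def, presburger)
  have H: "F \<inter> hardy_index = (F \<inter> {s. 0 < n1 s}) \<inter> {s. 0 < n2 s}" for F
    by (auto simp: hardy_index_def n1_def n2_def)
  show ?thesis
  proof
    show "0 \<le> C2 * C1"
      using C1 C2 by simp
    fix F a assume F: "finite (F :: (int \<times> int) set)"
    have "Lp_modular mu p (trig_sum (F \<inter> hardy_index) a) \<le> C2 * Lp_modular mu p (trig_sum (F \<inter> {s. 0 < n1 s}) a)"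
      unfolding H using F by (intro C2) auto
    also have "\<dots> \<le> C2 * (C1 * Lp_modular mu p (trig_sum F a))"
      by (intro mult_left_mono C1 C2 F)
    finally show "Lp_modular mu p (trig_sum (F \<inter> hardy_index) a) \<le> C2 * C1 * Lp_modular mu p (trig_sum F a)"
      by (simp add: mult.assoc)
  qed
qed

section \<open>The Szego projection\<close>

text \<open>The graph of the frequency cut-off, kept as a relation because \<open>F\<close> and
  \<open>a\<close> are not determined by the function: zero coefficients may be added at
  will.\<close>

definition hardy_pairs :: "((complex \<times> complex \<Rightarrow> complex) \<times> (complex \<times> complex \<Rightarrow> complex)) set" where
  "hardy_pairs = {(f, g). \<exists>F a. finite F \<and> f = trig_sum F a \<and> g = trig_sum (F \<inter> hardy_index) a}"

text \<open>The limit clause pins \<open>T\<close> down up to null sets, and it refers to the same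
  pairs for every exponent; this lets operators for different exponents be compared along one
  sequence.\<close>

lemma hardy_operator:
  assumes p: "1 < p"
  obtains T where "bounded_Lp_operator mu p T"
    and "\<And>f fn gn. f \<in> Lp_space mu p \<Longrightarrow> (\<And>n. (fn n, gn n) \<in> hardy_pairs) \<Longrightarrow>
      (\<lambda>n. Lp_modular mu p (\<lambda>x. f x - fn n x)) \<longlonglongrightarrow> 0 \<Longrightarrow>
      (\<lambda>n. Lp_modular mu p (\<lambda>x. T f x - gn n x)) \<longlonglongrightarrow> 0"
proof -
  have p0: "0 < p"
    using p by simp
  obtain C where C: "0 \<le> C" "\<And>F a. finite F \<Longrightarrow>
    Lp_modular mu p (trig_sum (F \<inter> hardy_index) a) \<le> C * Lp_modular mu p (trig_sum F a)"
    using hardy_projection_bound[OF p] by blast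
  show ?thesis
  proof (rule mu.bounded_Lp_operator_extension[OF p0 C(1), of hardy_pairs])
    show "f \<in> Lp_space mu p \<and> g \<in> Lp_space mu p" if "(f, g) \<in> hardy_pairs" for f g
      using that by (auto simp: hardy_pairs_def intro: Lp_space_trig_sum[OF p0])
    show "(\<lambda>x. f x + f' x, \<lambda>x. g x + g' x) \<in> hardy_pairs"
      if fg: "(f, g) \<in> hardy_pairs" "(f', g') \<in> hardy_pairs" for f g f' g'
    proof -
      from fg obtain F a G b where F: "finite F" "f = trig_sum F a" "g = trig_sum (F \<inter> hardy_index) a"
        and G: "finite G" "f' = trig_sum G b" "g' = trig_sum (G \<inter> hardy_index) b"
        by (auto simp: hardy_pairs_def)
      let ?c = "\<lambda>s. (if s \<in> F then a s else 0) + (if s \<in> G then b s else 0)"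
      have "(\<lambda>x. f x + f' x) = trig_sum (F \<union> G) ?c"
        using trig_sum_Un_restrict[OF F(1) G(1), of UNIV a b] by (simp add: F G fun_eq_iff)
      moreover have "(\<lambda>x. g x + g' x) = trig_sum ((F \<union> G) \<inter> hardy_index) ?c"
        by (intro ext) (simp only: F G trig_sum_Un_restrict)
      ultimately show ?thesis
        unfolding hardy_pairs_def using F(1) G(1) by blast
    qed
    show "(\<lambda>x. c * f x, \<lambda>x. c * g x) \<in> hardy_pairs" if fg: "(f, g) \<in> hardy_pairs" for c f g
    proof -
      from fg obtain F a where F: "finite F" "f = trig_sum F a" "g = trig_sum (F \<inter> hardy_index) a"
        by (auto simp: hardy_pairs_def)
      have "(\<lambda>x. c * f x) = trig_sum F (\<lambda>s. c * a s)" "(\<lambda>x. c * g x) = trig_sum (F \<inter> hardy_index) (\<lambda>s. c * a s)"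
        by (simp_all add: F trig_sum_scale fun_eq_iff)
      then show ?thesis
        unfolding hardy_pairs_def using F(1) by blast
    qed
    show "Lp_modular mu p g \<le> C * Lp_modular mu p f" if "(f, g) \<in> hardy_pairs" for f g
      using that C(2) by (auto simp: hardy_pairs_def)
    show "\<exists>(f', g')\<in>hardy_pairs. Lp_modular mu p (\<lambda>x. f x - f' x) < e"
      if f: "f \<in> Lp_space mu p" and e: "0 < e" for f and e :: real
    proof -
      obtain F a where F: "finite F" "Lp_modular mu p (\<lambda>x. f x - trig_sum F a x) < e"
        by (rule trig_sum_dense_Lp[OF p0 f e])
      then have "(trig_sum F a, trig_sum (F \<inter> hardy_index) a) \<in> hardy_pairs"
        by (auto simp: hardy_pairs_def)
      then show ?thesis
        using F by blast
    qed
  next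
    fix T
    assume "bounded_Lp_operator mu p T"
      and "\<And>f fn gn. f \<in> Lp_space mu p \<Longrightarrow> (\<And>n. (fn n, gn n) \<in> hardy_pairs) \<Longrightarrow>
        (\<lambda>n. Lp_modular mu p (\<lambda>x. f x - fn n x)) \<longlonglongrightarrow> 0 \<Longrightarrow>
        (\<lambda>n. Lp_modular mu p (\<lambda>x. T f x - gn n x)) \<longlonglongrightarrow> 0"
    then show thesis
      by (rule that)
  qed
qed

lemma approximating_hardy_pairs:
  assumes p: "0 < p" and f: "f \<in> Lp_space mu p"
  obtains fn gn where "\<And>n. (fn n, gn n) \<in> hardy_pairs" "(\<lambda>n. Lp_modular mu p (\<lambda>x. f x - fn n x)) \<longlonglongrightarrow> 0"
proof -
  have "\<exists>s. finite (fst s) \<and> Lp_modular mu p (\<lambda>x. f x - trig_sum (fst s) (snd s) x) < inverse (real (Suc n))" for n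
  proof -
    have "0 < inverse (real (Suc n))"
      by simp
    from trig_sum_dense_Lp[OF p f this] show ?thesis
      by (metis fst_conv snd_conv)
  qed
  then obtain s where s: "\<And>n. finite (fst (s n))"
    "\<And>n. Lp_modular mu p (\<lambda>x. f x - trig_sum (fst (s n)) (snd (s n)) x) < inverse (real (Suc n))"
    by metis
  show ?thesis
  proof
    show "(trig_sum (fst (s n)) (snd (s n)), trig_sum (fst (s n) \<inter> hardy_index) (snd (s n))) \<in> hardy_pairs" for n
      using s(1) by (auto simp: hardy_pairs_def)
    show "(\<lambda>n. Lp_modular mu p (\<lambda>x. f x - trig_sum (fst (s n)) (snd (s n)) x)) \<longlonglongrightarrow> 0"
      using s(2)
      by (intro tendsto_sandwich[OF always_eventually always_eventually tendsto_const LIMSEQ_inverse_real_of_nat] allI Lp_modular_nonneg)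
        (rule less_imp_le)
  qed
qed

lemma hardy_pairs_Lp: "0 < p \<Longrightarrow> (f, g) \<in> hardy_pairs \<Longrightarrow> f \<in> Lp_space mu p" "0 < p \<Longrightarrow> (f, g) \<in> hardy_pairs \<Longrightarrow> g \<in> Lp_space mu p"
  by (auto simp: hardy_pairs_def intro: Lp_space_trig_sum)

text \<open>Expand \<open>(h * norm a - norm b)\<^sup>2 \<ge> 0\<close>. The weight \<open>h\<close>
  is free, so the inequality does the work of Cauchy-Schwarz in limits.\<close>

lemma norm_mult_le_squares:
  fixes a b :: complex
  assumes "0 < h"
  shows "norm (a * cnj b) \<le> h * norm a powr 2 + norm b powr 2 / h"
proof -
  have "0 \<le> (h * norm a - norm b)\<^sup>2"
    by simp
  then have "2 * (h * (norm a * norm b)) \<le> h * (h * (norm a)\<^sup>2) + (norm b)\<^sup>2"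
    by (simp add: power2_eq_square algebra_simps)
  moreover have "0 \<le> h * (norm a * norm b)"
    using assms by simp
  ultimately have "h * (norm a * norm b) \<le> h * (h * (norm a)\<^sup>2) + (norm b)\<^sup>2"
    by linarith
  then show ?thesis
    using assms by (simp add: norm_mult field_simps power2_eq_square powr_numeral)
qed

section \<open>Inner products in L^2\<close>

context
  fixes M :: "'a measure"
begin

lemma L2_integrable_mult_cnj:
  assumes "u \<in> Lp_space M 2" "v \<in> Lp_space M 2"
  shows "integrable M (\<lambda>x. u x * cnj (v x))"
proof (rule Bochner_Integration.integrable_bound)
  show "integrable M (\<lambda>x. 1 * norm (u x) powr 2 + norm (v x) powr 2 / 1)"
    using assms by (intro Bochner_Integration.integrable_add integrable_mult_right integrable_divide_zero impI Lp_spaceD)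
  note [measurable] = assms[THEN Lp_spaceD(1)]
  have [measurable]: "cnj \<in> borel_measurable borel"
    by (intro borel_measurable_continuous_onI continuous_intros)
  show "(\<lambda>x. u x * cnj (v x)) \<in> borel_measurable M"
    by measurable
  show "AE x in M. norm (u x * cnj (v x)) \<le> norm (1 * norm (u x) powr 2 + norm (v x) powr 2 / 1)"
    using norm_mult_le_squares[of 1] by (intro AE_I2) (smt (verit) real_norm_def)
qed

lemma L2_inner_le:
  assumes "u \<in> Lp_space M 2" "v \<in> Lp_space M 2" "0 < h"
  shows "norm (\<integral>x. u x * cnj (v x) \<partial>M) \<le> h * Lp_modular M 2 u + Lp_modular M 2 v / h"
proof -
  have "norm (\<integral>x. u x * cnj (v x) \<partial>M) \<le> (\<integral>x. norm (u x * cnj (v x)) \<partial>M)"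
    by (rule integral_norm_bound)
  also have "\<dots> \<le> (\<integral>x. h * norm (u x) powr 2 + norm (v x) powr 2 / h \<partial>M)"
    using assms
    by (intro integral_mono integrable_norm L2_integrable_mult_cnj norm_mult_le_squares
        Bochner_Integration.integrable_add integrable_mult_right integrable_divide_zero impI Lp_spaceD)
  also have "\<dots> = h * Lp_modular M 2 u + Lp_modular M 2 v / h"
    using assms by (simp add: Lp_modular_def Lp_spaceD del: powr_numeral)
  finally show ?thesis .
qed

lemma L2_inner_tendsto_0:
  assumes u: "u \<in> Lp_space M 2" and v: "\<forall>\<^sub>F n in A. v n \<in> Lp_space M 2"
    and lim: "((\<lambda>n. Lp_modular M 2 (v n)) \<longlongrightarrow> 0) A"
  shows "((\<lambda>n. \<integral>x. u x * cnj (v n x) \<partial>M) \<longlongrightarrow> 0) A"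
proof (rule tendstoI)
  fix e :: real assume e: "0 < e"
  \<comment> \<open>The weight makes the contribution of the fixed \<open>u\<close>, plus a spare
    \<open>h\<close>, equal to \<open>e / 2\<close>; the other half comes from \<open>v n\<close>,
    once its modular is below \<open>h * (e / 2)\<close>.\<close>
  define h where "h = e / (2 * (Lp_modular M 2 u + 1))"
  have m: "0 \<le> Lp_modular M 2 u"
    by (rule Lp_modular_nonneg)
  then have h: "0 < h" "h * (Lp_modular M 2 u + 1) = e / 2"
    using e by (auto simp: h_def divide_simps)
  then have "0 < h * (e / 2)"
    using e by simp
  with lim have "\<forall>\<^sub>F n in A. Lp_modular M 2 (v n) < h * (e / 2)"
    by (rule order_tendstoD)
  with v show "\<forall>\<^sub>F n in A. dist (\<integral>x. u x * cnj (v n x) \<partial>M) 0 < e"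
  proof eventually_elim
    case (elim n)
    have "norm (\<integral>x. u x * cnj (v n x) \<partial>M) \<le> h * Lp_modular M 2 u + Lp_modular M 2 (v n) / h"
      by (rule L2_inner_le[OF u elim(1) h(1)])
    also have "\<dots> < h * Lp_modular M 2 u + h + e / 2"
    proof -
      have "Lp_modular M 2 (v n) / h < e / 2"
        using elim(2) h(1) by (simp add: pos_divide_less_eq mult.commute)
      then show ?thesis
        using h(1) by linarith
    qed
    also have "\<dots> = e"
      using h(2) by (simp add: algebra_simps)
    finally show ?case
      by simp
  qed
qed

lemma L2_inner_self: "u \<in> Lp_space M 2 \<Longrightarrow> (\<integral>x. u x * cnj (u x) \<partial>M) = of_real (Lp_modular M 2 u)"
  by (simp add: Lp_modular_def complex_norm_square[symmetric] powr_numeral flip: integral_complex_of_real)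

lemma L2_inner_cnj: "(\<integral>x. v x * cnj (u x) \<partial>M) = cnj (\<integral>x. u x * cnj (v x) \<partial>M)"
  by (subst Bochner_Integration.integral_cnj[symmetric]) (simp add: mult.commute)

lemma L2_inner_add_left:
  assumes "u \<in> Lp_space M 2" "v \<in> Lp_space M 2" "w \<in> Lp_space M 2"
  shows "(\<integral>x. (u x + v x) * cnj (w x) \<partial>M) = (\<integral>x. u x * cnj (w x) \<partial>M) + (\<integral>x. v x * cnj (w x) \<partial>M)"
  using assms by (simp add: distrib_right L2_integrable_mult_cnj)

lemma L2_inner_diff_left:
  assumes "u \<in> Lp_space M 2" "v \<in> Lp_space M 2" "w \<in> Lp_space M 2"
  shows "(\<integral>x. (u x - v x) * cnj (w x) \<partial>M) = (\<integral>x. u x * cnj (w x) \<partial>M) - (\<integral>x. v x * cnj (w x) \<partial>M)"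
  using assms by (simp add: left_diff_distrib L2_integrable_mult_cnj)

lemma L2_inner_diff_right:
  assumes "u \<in> Lp_space M 2" "v \<in> Lp_space M 2" "w \<in> Lp_space M 2"
  shows "(\<integral>x. u x * cnj (v x - w x) \<partial>M) = (\<integral>x. u x * cnj (v x) \<partial>M) - (\<integral>x. u x * cnj (w x) \<partial>M)"
  using assms by (simp add: right_diff_distrib L2_integrable_mult_cnj)

lemma L2_pythagoras:
  assumes u: "u \<in> Lp_space M 2" and v: "v \<in> Lp_space M 2" and orth: "(\<integral>x. u x * cnj (v x) \<partial>M) = 0"
  shows "Lp_modular M 2 (\<lambda>x. u x + v x) = Lp_modular M 2 u + Lp_modular M 2 v"
proof -
  have s: "(\<lambda>x. u x + v x) \<in> Lp_space M 2"
    by (rule Lp_space_add[OF _ u v]) simp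
  have "(\<integral>x. w x * cnj (u x + v x) \<partial>M) = (\<integral>x. w x * cnj (u x) \<partial>M) + (\<integral>x. w x * cnj (v x) \<partial>M)"
    if "w \<in> Lp_space M 2" for w
    using that u v by (simp add: distrib_left L2_integrable_mult_cnj)
  then have "complex_of_real (Lp_modular M 2 (\<lambda>x. u x + v x)) = of_real (Lp_modular M 2 u) + of_real (Lp_modular M 2 v)"
    using orth L2_inner_cnj[of v u] u v
    by (simp only: L2_inner_self[OF s, symmetric] L2_inner_add_left[OF u v s] L2_inner_self) simp
  then show ?thesis
    by (metis of_real_add of_real_eq_iff)
qed

end

section \<open>Fourier coefficients and the Hardy space\<close>

lemma Lp_norm_2_tendsto_iff: "((\<lambda>n. Lp_norm M 2 (v n)) \<longlongrightarrow> 0) A \<longleftrightarrow> ((\<lambda>n. Lp_modular M 2 (v n)) \<longlongrightarrow> 0) A"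
proof
  assume lim: "((\<lambda>n. Lp_norm M 2 (v n)) \<longlongrightarrow> 0) A"
  have "((\<lambda>n. Lp_norm M 2 (v n) * Lp_norm M 2 (v n)) \<longlongrightarrow> 0) A"
    by (rule tendsto_mult_zero[OF lim lim])
  moreover have "Lp_norm M 2 (v n) * Lp_norm M 2 (v n) = Lp_modular M 2 (v n)" for n
    using Lp_modular_nonneg[of M 2 "v n"] by (simp add: Lp_norm_eq_modular flip: powr_add)
  ultimately show "((\<lambda>n. Lp_modular M 2 (v n)) \<longlongrightarrow> 0) A"
    by simp
next
  assume "((\<lambda>n. Lp_modular M 2 (v n)) \<longlongrightarrow> 0) A"
  then have "((\<lambda>n. Lp_modular M 2 (v n) powr (1 / 2)) \<longlongrightarrow> 0 powr (1 / 2)) A"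
    by (intro tendsto_powr' tendsto_const) (auto simp: Lp_modular_nonneg)
  moreover have "0 powr (1 / 2) = (0::real)"
    by simp
  ultimately show "((\<lambda>n. Lp_norm M 2 (v n)) \<longlongrightarrow> 0) A"
    by (simp only: Lp_norm_eq_modular)
qed

text \<open>The Fourier coefficient; the division by the total mass compensates for the measure not
  being normalized.\<close>

definition torus_coeff :: "(complex \<times> complex \<Rightarrow> complex) \<Rightarrow> int \<times> int \<Rightarrow> complex" where
  "torus_coeff f s = (\<integral>x. f x * cnj (torus_char (fst s) (snd s) x) \<partial>mu) / (4 * pi\<^sup>2)"

lemma L2_char: "torus_char j k \<in> Lp_space mu 2"
  by (intro Lp_space_mu_continuous continuous_on_torus_char) simp

lemma L2_trig_sum: "trig_sum F a \<in> Lp_space mu 2"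
  by (rule Lp_space_trig_sum) simp

lemma inner_trig_sum_right:
  assumes "u \<in> Lp_space mu 2"
  shows "(\<integral>x. u x * cnj (trig_sum F a x) \<partial>mu) = (\<Sum>s\<in>F. cnj (a s) * (\<integral>x. u x * cnj (torus_char (fst s) (snd s) x) \<partial>mu))"
proof -
  have "(\<integral>x. u x * cnj (trig_sum F a x) \<partial>mu) = (\<integral>x. (\<Sum>s\<in>F. cnj (a s) * (u x * cnj (torus_char (fst s) (snd s) x))) \<partial>mu)"
    by (simp add: trig_sum_def sum_distrib_left mult_ac)
  also have "\<dots> = (\<Sum>s\<in>F. cnj (a s) * (\<integral>x. u x * cnj (torus_char (fst s) (snd s) x) \<partial>mu))"
    by (subst Bochner_Integration.integral_sum)
      (auto intro!: integrable_mult_right L2_integrable_mult_cnj assms L2_char)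
  finally show ?thesis .
qed

lemma inner_chars:
  "(\<integral>x. torus_char j k x * cnj (torus_char l m x) \<partial>mu) = (if j = l \<and> k = m then 4 * pi\<^sup>2 else 0)"
proof -
  have "(\<integral>x. torus_char j k x * cnj (torus_char l m x) \<partial>mu) = (\<integral>x. torus_char (j - l) (k - m) x \<partial>mu)"
    by (intro Bochner_Integration.integral_cong)
      (simp_all add: space_hartogs_db_measure cnj_torus_char torus_char_mult)
  then show ?thesis
    by (simp add: integral_torus_char)
qed

lemma inner_trig_sum_char:
  assumes "finite F"
  shows "(\<integral>x. trig_sum F a x * cnj (torus_char (fst s) (snd s) x) \<partial>mu) = (if s \<in> F then a s * (4 * pi\<^sup>2) else 0)"
proof -
  have "(\<integral>x. trig_sum F a x * cnj (torus_char (fst s) (snd s) x) \<partial>mu)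
      = cnj (\<Sum>t\<in>F. cnj (a t) * (\<integral>x. torus_char (fst s) (snd s) x * cnj (torus_char (fst t) (snd t) x) \<partial>mu))"
    by (subst L2_inner_cnj) (simp only: inner_trig_sum_right[OF L2_char])
  also have "\<dots> = (\<Sum>t\<in>F. if t = s then a t * (4 * pi\<^sup>2) else 0)"
    unfolding inner_chars by (simp add: prod_eq_iff, intro sum.cong) auto
  finally show ?thesis
    using assms by simp
qed

text \<open>The remainder of the Fourier sum over \<open>F\<close> is orthogonal to the characters
  in \<open>F\<close>, so Pythagoras separates it from the error in the coefficients. With
  \<open>b = 0\<close> this yields Bessel's inequality; for general \<open>b\<close>, the optimality
  of Fourier sums.\<close>

lemma torus_coeff_best_approximation:
  assumes g: "g \<in> Lp_space mu 2" and F: "finite F"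
  shows "Lp_modular mu 2 (\<lambda>x. g x - trig_sum F b x)
    = Lp_modular mu 2 (\<lambda>x. g x - trig_sum F (torus_coeff g) x) + 4 * pi\<^sup>2 * (\<Sum>s\<in>F. (norm (torus_coeff g s - b s))\<^sup>2)"
proof -
  define r where "r = (\<lambda>x. g x - trig_sum F (torus_coeff g) x)"
  define t where "t = trig_sum F (\<lambda>s. torus_coeff g s - b s)"
  have r: "r \<in> Lp_space mu 2"
    unfolding r_def by (intro Lp_space_diff g L2_trig_sum) simp
  have t: "t \<in> Lp_space mu 2"
    unfolding t_def by (rule L2_trig_sum)
  have "(\<integral>x. r x * cnj (torus_char (fst s) (snd s) x) \<partial>mu) = 0" if "s \<in> F" for s
    unfolding r_def using that
    by (subst L2_inner_diff_left[OF g L2_trig_sum L2_char]) (simp add: inner_trig_sum_char[OF F] torus_coeff_def)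
  then have "(\<integral>x. r x * cnj (t x) \<partial>mu) = 0"
    unfolding t_def by (simp add: inner_trig_sum_right[OF r])
  from L2_pythagoras[OF r t this] have "Lp_modular mu 2 (\<lambda>x. r x + t x) = Lp_modular mu 2 r + Lp_modular mu 2 t" .
  moreover have "(\<lambda>x. r x + t x) = (\<lambda>x. g x - trig_sum F b x)"
    by (simp add: r_def t_def trig_sum_def left_diff_distrib sum_subtractf fun_eq_iff)
  moreover have "Lp_modular mu 2 t = 4 * pi\<^sup>2 * (\<Sum>s\<in>F. (norm (torus_coeff g s - b s))\<^sup>2)"
  proof -
    have "complex_of_real (Lp_modular mu 2 t) = (\<integral>x. t x * cnj (t x) \<partial>mu)"
      by (rule L2_inner_self[OF t, symmetric])
    also have "\<dots> = (\<Sum>s\<in>F. cnj (torus_coeff g s - b s) * (\<integral>x. t x * cnj (torus_char (fst s) (snd s) x) \<partial>mu))"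
      unfolding t_def by (rule inner_trig_sum_right[OF L2_trig_sum])
    also have "\<dots> = (\<Sum>s\<in>F. of_real (4 * pi\<^sup>2 * (norm (torus_coeff g s - b s))\<^sup>2))"
    proof (intro sum.cong refl)
      fix s assume "s \<in> F"
      then have "(\<integral>x. t x * cnj (torus_char (fst s) (snd s) x) \<partial>mu) = (torus_coeff g s - b s) * (4 * pi\<^sup>2)"
        unfolding t_def by (simp add: inner_trig_sum_char[OF F])
      then show "cnj (torus_coeff g s - b s) * (\<integral>x. t x * cnj (torus_char (fst s) (snd s) x) \<partial>mu)
          = of_real (4 * pi\<^sup>2 * (norm (torus_coeff g s - b s))\<^sup>2)"
        by (simp only: of_real_mult complex_norm_square mult_ac)
    qed
    finally have "complex_of_real (Lp_modular mu 2 t) = complex_of_real (\<Sum>s\<in>F. 4 * pi\<^sup>2 * (norm (torus_coeff g s - b s))\<^sup>2)"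
      by simp
    then show ?thesis
      by (simp only: of_real_eq_iff sum_distrib_left)
  qed
  ultimately show ?thesis
    by (simp add: r_def)
qed

lemma torus_coeff_summable:
  assumes g: "g \<in> Lp_space mu 2"
  shows "(\<lambda>s. (norm (torus_coeff g s))\<^sup>2) summable_on I"
proof (rule nonneg_bdd_above_summable_on)
  have "(\<Sum>s\<in>F. (norm (torus_coeff g s))\<^sup>2) \<le> Lp_modular mu 2 g / (4 * pi\<^sup>2)" if "finite F" for F
    using torus_coeff_best_approximation[OF g that, of "\<lambda>_. 0"]
      Lp_modular_nonneg[of mu 2 "\<lambda>x. g x - trig_sum F (torus_coeff g) x"]
    by (simp add: trig_sum_def pos_le_divide_eq mult.commute)
  then show "bdd_above (sum (\<lambda>s. (norm (torus_coeff g s))\<^sup>2) ` {F. F \<subseteq> I \<and> finite F})"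
    by (auto intro!: bdd_aboveI)
qed simp

lemma has_L2_fourier_series_iff:
  "has_L2_fourier_series f a I \<longleftrightarrow>
     ((\<lambda>F. Lp_modular mu 2 (\<lambda>x. f x - trig_sum F (\<lambda>s. a (fst s) (snd s)) x)) \<longlongrightarrow> 0) (finite_subsets_at_top I)"
  unfolding has_L2_fourier_series_def Lp_norm_2_tendsto_iff by (simp add: trig_sum_def case_prod_beta)

text \<open>The approximating sums may have unrelated coefficients, whereas a Fourier series fixes
  them once. By best approximation the Fourier sum over any finite set containing \<open>F\<close>
  is at least as close as a given sum over \<open>F\<close>, so the Fourier series of
  \<open>g\<close> converges to \<open>g\<close> along finite subsets of the index set.\<close>

lemma hardy_spaceI:
  assumes g: "g \<in> Lp_space mu 2"
    and dense: "\<And>e. 0 < e \<Longrightarrow> \<exists>F a. finite F \<and> F \<subseteq> hardy_index \<and> Lp_modular mu 2 (\<lambda>x. g x - trig_sum F a x) < e"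
  shows "g \<in> hardy_space"
proof -
  have "((\<lambda>F. Lp_modular mu 2 (\<lambda>x. g x - trig_sum F (torus_coeff g) x)) \<longlongrightarrow> 0) (finite_subsets_at_top hardy_index)"
  proof (rule tendstoI)
    fix e :: real assume "0 < e"
    then obtain F a where F: "finite F" "F \<subseteq> hardy_index" "Lp_modular mu 2 (\<lambda>x. g x - trig_sum F a x) < e"
      using dense by blast
    have "Lp_modular mu 2 (\<lambda>x. g x - trig_sum G (torus_coeff g) x) < e" if "finite G" "F \<subseteq> G" for G
    proof -
      have "Lp_modular mu 2 (\<lambda>x. g x - trig_sum G (torus_coeff g) x)
          \<le> Lp_modular mu 2 (\<lambda>x. g x - trig_sum G (\<lambda>s. if s \<in> F then a s else 0) x)"
        unfolding torus_coeff_best_approximation[OF g that(1), of "\<lambda>s. if s \<in> F then a s else 0"] by (simp add: sum_nonneg)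
      also have "trig_sum G (\<lambda>s. if s \<in> F then a s else 0) = trig_sum F a"
        using trig_sum_restrict[OF that(1), of F a] that(2) by (simp add: Int_absorb1)
      finally show ?thesis
        using F(3) by simp
    qed
    then show "\<forall>\<^sub>F G in finite_subsets_at_top hardy_index. dist (Lp_modular mu 2 (\<lambda>x. g x - trig_sum G (torus_coeff g) x)) 0 < e"
      using F unfolding eventually_finite_subsets_at_top by (intro exI[of _ F]) (auto simp: Lp_modular_nonneg)
  qed
  then have "has_L2_fourier_series g (\<lambda>j k. torus_coeff g (j, k)) hardy_index"
    by (simp add: has_L2_fourier_series_iff)
  moreover have "(\<lambda>(j, k). (norm (torus_coeff g (j, k)))\<^sup>2) summable_on hardy_index"
  proof -
    have "(\<lambda>(j, k). (norm (torus_coeff g (j, k)))\<^sup>2) = (\<lambda>s. (norm (torus_coeff g s))\<^sup>2)"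
      by (simp add: fun_eq_iff)
    then show ?thesis
      using torus_coeff_summable[OF g, of hardy_index] by (simp only:)
  qed
  ultimately show ?thesis
    unfolding hardy_space_def using g by (intro CollectI conjI exI[of _ "\<lambda>j k. torus_coeff g (j, k)"])
qed

text \<open>Finite partial sums of the series of \<open>h\<close> are orthogonal to
  \<open>u\<close>, and the inner product with the remainder tends to 0.\<close>

lemma hardy_space_orthogonal:
  assumes u: "u \<in> Lp_space mu 2"
    and orth: "\<And>s. s \<in> hardy_index \<Longrightarrow> (\<integral>x. u x * cnj (torus_char (fst s) (snd s) x) \<partial>mu) = 0"
    and h: "h \<in> hardy_space"
  shows "(\<integral>x. u x * cnj (h x) \<partial>mu) = 0"
proof -
  from h obtain a where hL: "h \<in> Lp_space mu 2" and
    lim: "((\<lambda>F. Lp_modular mu 2 (\<lambda>x. h x - trig_sum F (\<lambda>s. a (fst s) (snd s)) x)) \<longlongrightarrow> 0) (finite_subsets_at_top hardy_index)"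
    by (auto simp: hardy_space_def has_L2_fourier_series_iff)
  let ?t = "\<lambda>F. trig_sum F (\<lambda>s. a (fst s) (snd s))"
  have "((\<lambda>F. \<integral>x. u x * cnj (h x - ?t F x) \<partial>mu) \<longlongrightarrow> 0) (finite_subsets_at_top hardy_index)"
    by (intro L2_inner_tendsto_0 u lim always_eventually allI Lp_space_diff hL L2_trig_sum) simp
  moreover have "\<forall>\<^sub>F F in finite_subsets_at_top hardy_index.
      (\<integral>x. u x * cnj (h x - ?t F x) \<partial>mu) = (\<integral>x. u x * cnj (h x) \<partial>mu)"
    using eventually_finite_subsets_at_top_weakI
  proof (rule eventually_mono)
    fix F assume "finite F \<and> F \<subseteq> hardy_index"
    then show "(\<integral>x. u x * cnj (h x - ?t F x) \<partial>mu) = (\<integral>x. u x * cnj (h x) \<partial>mu)"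
      using orth by (subst L2_inner_diff_right[OF u hL L2_trig_sum]) (auto simp: inner_trig_sum_right[OF u] intro!: sum.neutral)
  qed auto
  ultimately have "((\<lambda>F. \<integral>x. u x * cnj (h x) \<partial>mu) \<longlongrightarrow> 0) (finite_subsets_at_top hardy_index)"
    by (rule Lim_transform_eventually)
  then show ?thesis
    by (simp add: tendsto_const_iff)
qed

text \<open>The limit \<open>g\<close> satisfies the two properties that define the orthogonal
  projection of \<open>f\<close>, and these determine it up to a null set. Hence it agrees with
  whatever representative \<open>SOME\<close> picks.\<close>

lemma szego_projection_eq_limit:
  assumes f: "f \<in> Lp_space mu 2" and g: "g \<in> Lp_space mu 2"
    and pairs: "\<And>n. (fn n, gn n) \<in> hardy_pairs"
    and lim: "(\<lambda>n. Lp_modular mu 2 (\<lambda>x. f x - fn n x)) \<longlonglongrightarrow> 0" "(\<lambda>n. Lp_modular mu 2 (\<lambda>x. g x - gn n x)) \<longlonglongrightarrow> 0"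
  shows "AE x in mu. szego_projection f x = g x"
proof -
  have L: "fn n \<in> Lp_space mu 2" "gn n \<in> Lp_space mu 2" for n
    using pairs[of n] hardy_pairs_Lp[of 2] by auto
  have "g \<in> hardy_space"
  proof (rule hardy_spaceI[OF g])
    fix e :: real assume "0 < e"
    then obtain n where n: "Lp_modular mu 2 (\<lambda>x. g x - gn n x) < e"
      using LIMSEQ_D[OF lim(2)] by (auto simp: Lp_modular_nonneg)
    obtain F a where "finite F" "gn n = trig_sum (F \<inter> hardy_index) a"
      using pairs[of n] by (auto simp: hardy_pairs_def)
    then show "\<exists>F a. finite F \<and> F \<subseteq> hardy_index \<and> Lp_modular mu 2 (\<lambda>x. g x - trig_sum F a x) < e"
      using n by (intro exI[of _ "F \<inter> hardy_index"] exI[of _ a]) auto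
  qed
  moreover have "(\<integral>x. (f x - g x) * cnj (h x) \<partial>mu) = 0" if "h \<in> hardy_space" for h
  proof (rule hardy_space_orthogonal[OF _ _ that])
    show fg: "(\<lambda>x. f x - g x) \<in> Lp_space mu 2"
      by (rule Lp_space_diff[OF _ f g]) simp
    fix s assume s: "s \<in> hardy_index"
    let ?e = "torus_char (fst s) (snd s)"
    have le: "Lp_modular mu 2 (\<lambda>x. (f x - g x) - (fn n x - gn n x))
        \<le> 2 powr 2 * (Lp_modular mu 2 (\<lambda>x. f x - fn n x) + Lp_modular mu 2 (\<lambda>x. g x - gn n x))" for n
    proof -
      have "(\<lambda>x. (f x - g x) - (fn n x - gn n x)) = (\<lambda>x. (f x - fn n x) + (gn n x - g x))"
        by (simp add: fun_eq_iff)
      then show ?thesis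
        using Lp_modular_add_le[OF _ Lp_space_diff[OF _ f L(1)[of n]] Lp_space_diff[OF _ L(2)[of n] g]]
          Lp_modular_minus_commute[of mu 2 "gn n" g] by simp
    qed
    have "(\<lambda>n. 2 powr 2 * (Lp_modular mu 2 (\<lambda>x. f x - fn n x) + Lp_modular mu 2 (\<lambda>x. g x - gn n x))) \<longlonglongrightarrow> 2 powr 2 * (0 + 0)"
      by (intro tendsto_intros lim)
    then have *: "(\<lambda>n. 2 powr 2 * (Lp_modular mu 2 (\<lambda>x. f x - fn n x) + Lp_modular mu 2 (\<lambda>x. g x - gn n x))) \<longlonglongrightarrow> 0"
      by simp
    have "(\<lambda>n. Lp_modular mu 2 (\<lambda>x. (f x - g x) - (fn n x - gn n x))) \<longlonglongrightarrow> 0"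
      by (intro tendsto_sandwich[OF always_eventually always_eventually tendsto_const *] allI Lp_modular_nonneg le)
    then have "(\<lambda>n. \<integral>x. ?e x * cnj ((f x - g x) - (fn n x - gn n x)) \<partial>mu) \<longlonglongrightarrow> 0"
      using L by (intro L2_inner_tendsto_0 L2_char always_eventually allI Lp_space_diff[OF _ fg] Lp_space_diff) auto
    \<comment> \<open>The difference \<open>fn n - gn n\<close> has no frequency in
      \<open>hardy_index\<close>, so it is orthogonal to this character. The sequence is therefore
      constant in \<open>n\<close>, and its limit 0 is its value.\<close>
    moreover have "(\<integral>x. ?e x * cnj ((f x - g x) - (fn n x - gn n x)) \<partial>mu) = cnj (\<integral>x. (f x - g x) * cnj (?e x) \<partial>mu)" for n
    proof -
      obtain F a where F: "finite F" "fn n = trig_sum F a" "gn n = trig_sum (F \<inter> hardy_index) a"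
        using pairs[of n] by (auto simp: hardy_pairs_def)
      have d: "(\<lambda>x. fn n x - gn n x) \<in> Lp_space mu 2"
        by (rule Lp_space_diff[OF _ L]) simp
      have "(\<integral>x. (fn n x - gn n x) * cnj (?e x) \<partial>mu) = 0"
        by (subst L2_inner_diff_left[OF L L2_char]) (use F s in \<open>simp add: inner_trig_sum_char\<close>)
      then have "(\<integral>x. ((f x - g x) - (fn n x - gn n x)) * cnj (?e x) \<partial>mu) = (\<integral>x. (f x - g x) * cnj (?e x) \<partial>mu)"
        by (subst L2_inner_diff_left[OF fg d L2_char]) simp
      then show ?thesis
        by (subst L2_inner_cnj) simp
    qed
    ultimately show "(\<integral>x. (f x - g x) * cnj (?e x) \<partial>mu) = 0"
      by (simp add: LIMSEQ_const_iff)
  qed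
  ultimately have g_szego: "g \<in> hardy_space \<and> (\<forall>h\<in>hardy_space. (\<integral>x. (f x - g x) * cnj (h x) \<partial>mu) = 0)"
    by blast
  define g' where "g' = szego_projection f"
  have g'_szego: "g' \<in> hardy_space \<and> (\<forall>h\<in>hardy_space. (\<integral>x. (f x - g' x) * cnj (h x) \<partial>mu) = 0)"
    unfolding g'_def szego_projection_def using g_szego
    by (rule someI[where P = "\<lambda>g. g \<in> hardy_space \<and> (\<forall>h\<in>hardy_space. (\<integral>x. (f x - g x) * cnj (h x) \<partial>mu) = 0)"])
  have g': "g' \<in> Lp_space mu 2"
    using g'_szego by (simp add: hardy_space_def)
  have fg: "(\<lambda>x. f x - g x) \<in> Lp_space mu 2" and fg': "(\<lambda>x. f x - g' x) \<in> Lp_space mu 2"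
    and d: "(\<lambda>x. g' x - g x) \<in> Lp_space mu 2"
    using f g g' by (auto intro!: Lp_space_diff)
  have orth: "(\<integral>x. (g' x - g x) * cnj (h x) \<partial>mu) = 0" if "h \<in> hardy_space" for h
  proof -
    have hL: "h \<in> Lp_space mu 2"
      using that by (simp add: hardy_space_def)
    have "(\<integral>x. ((f x - g x) - (f x - g' x)) * cnj (h x) \<partial>mu) = 0"
      using g_szego g'_szego that by (subst L2_inner_diff_left[OF fg fg' hL]) simp
    then show ?thesis
      by simp
  qed
  \<comment> \<open>The difference of two candidates is orthogonal to each of them, hence to
    itself.\<close>
  have "(\<integral>x. (g' x - g x) * cnj (g' x - g x) \<partial>mu) = 0"
    using orth[of g'] orth[of g] g_szego g'_szego by (subst L2_inner_diff_right[OF d g' g]) simp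
  then have "Lp_modular mu 2 (\<lambda>x. g' x - g x) = 0"
    using L2_inner_self[OF d] by simp
  from Lp_modular_eq_0_imp_AE[OF d this] show ?thesis
    by (simp add: g'_def)
qed

section \<open>The Szego projection on L^p\<close>

theorem theorem2:
  fixes p :: real
  assumes "1 < p"
  shows "Lp_dense hartogs_db_measure p
           (Lp_space hartogs_db_measure 2 \<inter> Lp_space hartogs_db_measure p) \<and>
         (\<exists>T. bounded_Lp_operator hartogs_db_measure p T \<and>
            (\<forall>f \<in> Lp_space hartogs_db_measure 2 \<inter> Lp_space hartogs_db_measure p.
               AE x in hartogs_db_measure. T f x = szego_projection f x))"
proof
  have p: "0 < p"
    using assms by simp
  show "Lp_dense mu p (Lp_space mu 2 \<inter> Lp_space mu p)"
    unfolding Lp_dense_def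
  proof (intro conjI ballI allI impI)
    fix f and e :: real assume f: "f \<in> Lp_space mu p" and e: "0 < e"
    have "0 < e powr p"
      using e by simp
    from trig_sum_dense_Lp[OF p f this]
    obtain F a where "Lp_modular mu p (\<lambda>x. f x - trig_sum F a x) < e powr p"
      by blast
    then have "Lp_norm mu p (\<lambda>x. f x - trig_sum F a x) < (e powr p) powr (1 / p)"
      unfolding Lp_norm_eq_modular using p by (intro powr_less_mono2 Lp_modular_nonneg) auto
    then have "Lp_norm mu p (\<lambda>x. f x - trig_sum F a x) < e"
      using p e by (simp add: powr_powr)
    then show "\<exists>g\<in>Lp_space mu 2 \<inter> Lp_space mu p. Lp_norm mu p (\<lambda>x. f x - g x) < e"
      using Lp_space_trig_sum[OF p] L2_trig_sum by blast
  qed simp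
  obtain T where T: "bounded_Lp_operator mu p T" "\<And>f fn gn. f \<in> Lp_space mu p \<Longrightarrow> (\<And>n. (fn n, gn n) \<in> hardy_pairs) \<Longrightarrow>
      (\<lambda>n. Lp_modular mu p (\<lambda>x. f x - fn n x)) \<longlonglongrightarrow> 0 \<Longrightarrow>
      (\<lambda>n. Lp_modular mu p (\<lambda>x. T f x - gn n x)) \<longlonglongrightarrow> 0"
    using hardy_operator[OF assms] by blast
  obtain T2 where T2: "bounded_Lp_operator mu 2 T2" "\<And>f fn gn. f \<in> Lp_space mu 2 \<Longrightarrow> (\<And>n. (fn n, gn n) \<in> hardy_pairs) \<Longrightarrow>
      (\<lambda>n. Lp_modular mu 2 (\<lambda>x. f x - fn n x)) \<longlonglongrightarrow> 0 \<Longrightarrow>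
      (\<lambda>n. Lp_modular mu 2 (\<lambda>x. T2 f x - gn n x)) \<longlonglongrightarrow> 0"
    using hardy_operator[of 2] by auto
  have "AE x in mu. T f x = szego_projection f x" if "f \<in> Lp_space mu 2 \<inter> Lp_space mu p" for f
  proof -
    \<comment> \<open>Approximation takes place at the larger exponent \<open>q\<close>, where
      \<open>f\<close> still lies, so one sequence converges to \<open>f\<close> for both 2 and
      \<open>p\<close>. The images converge to \<open>T f\<close> at exponent \<open>p\<close> and
      to \<open>T2 f\<close> at exponent 2; uniqueness of limits is invoked at the smaller exponent
      \<open>r\<close>, which both convergences imply.\<close>
    define q where "q = max p 2"
    define r where "r = min p 2"
    have q: "0 < q" "p \<le> q" "2 \<le> q" and r: "0 < r" "r \<le> p" "r \<le> 2"
      using p by (auto simp: q_def r_def)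
    have f2: "f \<in> Lp_space mu 2" and fp: "f \<in> Lp_space mu p" and fq: "f \<in> Lp_space mu q"
      using that by (auto simp: q_def max_def)
    obtain fn gn where pairs: "\<And>n. (fn n, gn n) \<in> hardy_pairs"
      and lim: "(\<lambda>n. Lp_modular mu q (\<lambda>x. f x - fn n x)) \<longlonglongrightarrow> 0"
      using approximating_hardy_pairs[OF q(1) fq] by blast
    have dq: "(\<lambda>x. f x - fn n x) \<in> Lp_space mu q" for n
      by (rule Lp_space_diff[OF q(1) fq hardy_pairs_Lp(1)[OF q(1) pairs]])
    have lim2: "(\<lambda>n. Lp_modular mu 2 (\<lambda>x. f x - fn n x)) \<longlonglongrightarrow> 0"
      by (rule mu.Lp_modular_tendsto_antimono[OF _ q(3) dq lim]) simp
    have limp: "(\<lambda>n. Lp_modular mu p (\<lambda>x. f x - fn n x)) \<longlonglongrightarrow> 0"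
      by (rule mu.Lp_modular_tendsto_antimono[OF p q(2) dq lim])
    have Tp: "T f \<in> Lp_space mu p" and T2f: "T2 f \<in> Lp_space mu 2"
      using T(1) T2(1) fp f2 by (auto simp: bounded_Lp_operator_def)
    have gp: "(\<lambda>x. T f x - gn n x) \<in> Lp_space mu p" and g2: "(\<lambda>x. T2 f x - gn n x) \<in> Lp_space mu 2" for n
      using hardy_pairs_Lp(2)[OF _ pairs[of n]] p by (auto intro!: Lp_space_diff Tp T2f)
    have "AE x in mu. T f x = T2 f x"
    proof (rule Lp_modular_limit_unique[OF r(1)])
      show "T f \<in> Lp_space mu r" "T2 f \<in> Lp_space mu r"
        using mu.Lp_space_antimono[OF r(1,2)] mu.Lp_space_antimono[OF r(1,3)] Tp T2f by auto
      show "gn n \<in> Lp_space mu r" for n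
        by (rule hardy_pairs_Lp(2)[OF r(1) pairs])
      show "(\<lambda>n. Lp_modular mu r (\<lambda>x. T f x - gn n x)) \<longlonglongrightarrow> 0"
        by (rule mu.Lp_modular_tendsto_antimono[OF r(1,2) gp T(2)[OF fp pairs limp]])
      show "(\<lambda>n. Lp_modular mu r (\<lambda>x. T2 f x - gn n x)) \<longlonglongrightarrow> 0"
        by (rule mu.Lp_modular_tendsto_antimono[OF r(1,3) g2 T2(2)[OF f2 pairs lim2]])
    qed
    moreover have "AE x in mu. szego_projection f x = T2 f x"
      by (rule szego_projection_eq_limit[OF f2 T2f pairs lim2 T2(2)[OF f2 pairs lim2]])
    ultimately show ?thesis
      by eventually_elim simp
  qed
  with T(1) show "\<exists>T. bounded_Lp_operator mu p T \<and>
      (\<forall>f\<in>Lp_space mu 2 \<inter> Lp_space mu p. AE x in mu. T f x = szego_projection f x)"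
    by blast
qed

end
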